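(* (1) Let $\mathbf A\in\mathsf{BKL}$ be a finite subdirectly irreducible algebra that generates an almost minimal variety in the lattice of subvarieties of $\mathsf{BKL}$, different from $\mathbb V(\mathbf K_4)=K(\mathsf{BA})$. Then $\mathbf A^-$ is rigid. (2) Let $\mathbf A\in\mathsf{BCRL}$ be a finite rigid algebra in which $0$ is meet irreducible. Then $K(\mathbf A)$ has a subalgebra that generates an almost minimal variety in the lattice of subvarieties of $\mathsf{BKL}$ different from $K(\mathsf{BA})$.
   Context: $\mathsf{BCRL}$ is the variety of bounded commutative residuated lattices $(A,\vee,\wedge,\cdot,\to,0,1)$: a lattice, a commutative monoid $(A,\cdot,1)$, $ab\le c$ iff $a\le b\to c$, $1$ greatest and $0$ least element. For $\mathbf A\in\mathsf{BCRL}$, $K(\mathbf A)$ is the algebra on $A\times A$ with $(a,b)\vee(c,d)=(a\vee c,b\wedge d)$, $(a,b)\wedge(c,d)=(a\wedge c,b\vee d)$, $(a,b)(c,d)=(ac,(a\to d)\wedge(c\to b))$, $(a,b)\to(c,d)=((a\to c)\wedge(d\to b),ad)$, unit $(1,1)$, constant $0$ as $(0,1)$. With $\sim x:=x\to1$, a K-lattice is a commutative residuated lattice satisfying $\sim\sim x=x$, the lattice distributive laws whenever one of the three elements is $1$, and $xy\wedge 1=(x\wedge1)(y\wedge1)$, $((x\wedge1)\to y)\wedge((\sim y\wedge 1)\to\sim x)=x\to y$; a bounded K-lattice is a K-lattice with an extra constant $0$ satisfying $0\le x$; $\mathsf{BKL}$ is their variety. For $\mathbf A\in\mathsf{BKL}$,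 $\mathbf A^-$ is the algebra on $\{a:a\le1\}$ with the same $\vee,\wedge,\cdot,0,1$ and $a\to^-b=(a\to b)\wedge1$. $K(\mathsf{BA})=\{\mathbf A\in\mathsf{BKL}:\mathbf A^-\text{ is a Boolean algebra}\}$; $\mathbf 2$ is the two-element Boolean algebra and $\mathbf K_4=K(\mathbf 2)$. An algebra $\mathbf A\in\mathsf{BCRL}$ is rigid if $|A|>2$, $\mathbf A$ is subdirectly irreducible, $\mathbf A$ has no proper subalgebras other than $\{0,1\}$, and $\mathbf A/\theta\cong\mathbf 2$ for every proper nontrivial congruence $\theta$. A variety is almost minimal if it covers an atom of the lattice of subvarieties. *)

theory Defs
  imports "HOL-Algebra.Group"
begin

section \<open>Algebras in the signature of bounded residuated lattices\<close>

record 'a rlat = "'a monoid" +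
  rl_join :: "'a \<Rightarrow> 'a \<Rightarrow> 'a"  (infixl \<open>\<curlyvee>\<index>\<close> 65)
  rl_meet :: "'a \<Rightarrow> 'a \<Rightarrow> 'a"  (infixl \<open>\<curlywedge>\<index>\<close> 67)
  rl_imp  :: "'a \<Rightarrow> 'a \<Rightarrow> 'a"  (infixr \<open>\<leadsto>\<index>\<close> 63)
  rl_zero :: 'a                 (\<open>\<zero>\<index>\<close>)

definition rl_le :: "'a rlat \<Rightarrow> 'a \<Rightarrow> 'a \<Rightarrow> bool"  (infix \<open>\<preceq>\<index>\<close> 50)
  where "x \<preceq>\<^bsub>A\<^esub> y \<longleftrightarrow> x \<curlywedge>\<^bsub>A\<^esub> y = x"

locale rl_algebra =
  fixes A :: "'a rlat" (structure)
  assumes mult_clos: "x \<in> carrier A \<Longrightarrow> y \<in> carrier A \<Longrightarrow> x \<otimes> y \<in> carrier A"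
    and join_clos: "x \<in> carrier A \<Longrightarrow> y \<in> carrier A \<Longrightarrow> x \<curlyvee> y \<in> carrier A"
    and meet_clos: "x \<in> carrier A \<Longrightarrow> y \<in> carrier A \<Longrightarrow> x \<curlywedge> y \<in> carrier A"
    and imp_clos: "x \<in> carrier A \<Longrightarrow> y \<in> carrier A \<Longrightarrow> x \<leadsto> y \<in> carrier A"
    and unit_clos: "\<one> \<in> carrier A"
    and zero_clos: "\<zero> \<in> carrier A"

text \<open>The constant \<open>\<zero>\<close> is part of the signature but is not constrained here.\<close>

locale comm_residuated_lattice = rl_algebra A + comm_monoid A for A :: "'a rlat" (structure) +
  assumes join_commute: "x \<in> carrier A \<Longrightarrow> y \<in> carrier A \<Longrightarrow> x \<curlyvee> y = y \<curlyvee> x"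
    and meet_commute: "x \<in> carrier A \<Longrightarrow> y \<in> carrier A \<Longrightarrow> x \<curlywedge> y = y \<curlywedge> x"
    and join_assoc: "x \<in> carrier A \<Longrightarrow> y \<in> carrier A \<Longrightarrow> z \<in> carrier A
      \<Longrightarrow> (x \<curlyvee> y) \<curlyvee> z = x \<curlyvee> (y \<curlyvee> z)"
    and meet_assoc: "x \<in> carrier A \<Longrightarrow> y \<in> carrier A \<Longrightarrow> z \<in> carrier A
      \<Longrightarrow> (x \<curlywedge> y) \<curlywedge> z = x \<curlywedge> (y \<curlywedge> z)"
    and join_absorb: "x \<in> carrier A \<Longrightarrow> y \<in> carrier A \<Longrightarrow> x \<curlyvee> (x \<curlywedge> y) = x"
    and meet_absorb: "x \<in> carrier A \<Longrightarrow> y \<in> carrier A \<Longrightarrow> x \<curlywedge> (x \<curlyvee> y) = x"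
    and residuation: "x \<in> carrier A \<Longrightarrow> y \<in> carrier A \<Longrightarrow> z \<in> carrier A
      \<Longrightarrow> x \<otimes> y \<preceq> z \<longleftrightarrow> x \<preceq> y \<leadsto> z"

locale BCRL = comm_residuated_lattice A for A :: "'a rlat" (structure) +
  assumes unit_greatest: "x \<in> carrier A \<Longrightarrow> x \<preceq> \<one>"
    and zero_least: "x \<in> carrier A \<Longrightarrow> \<zero> \<preceq> x"

definition rl_neg :: "'a rlat \<Rightarrow> 'a \<Rightarrow> 'a"  (\<open>\<sim>\<index> _\<close> [81] 80)
  where "\<sim>\<^bsub>A\<^esub> x = x \<leadsto>\<^bsub>A\<^esub> \<one>\<^bsub>A\<^esub>"

locale K_lattice = comm_residuated_lattice A for A :: "'a rlat" (structure) +
  assumes neg_neg: "x \<in> carrier A \<Longrightarrow> \<sim> (\<sim> x) = x"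
    and meet_join_distrib_unit:
      "x \<in> carrier A \<Longrightarrow> y \<in> carrier A \<Longrightarrow> z \<in> carrier A \<Longrightarrow> \<one> \<in> {x, y, z}
        \<Longrightarrow> x \<curlywedge> (y \<curlyvee> z) = (x \<curlywedge> y) \<curlyvee> (x \<curlywedge> z)"
    and join_meet_distrib_unit:
      "x \<in> carrier A \<Longrightarrow> y \<in> carrier A \<Longrightarrow> z \<in> carrier A \<Longrightarrow> \<one> \<in> {x, y, z}
        \<Longrightarrow> x \<curlyvee> (y \<curlywedge> z) = (x \<curlyvee> y) \<curlywedge> (x \<curlyvee> z)"
    and mult_meet_unit:
      "x \<in> carrier A \<Longrightarrow> y \<in> carrier A \<Longrightarrow> (x \<otimes> y) \<curlywedge> \<one> = (x \<curlywedge> \<one>) \<otimes> (y \<curlywedge> \<one>)"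
    and imp_decomp:
      "x \<in> carrier A \<Longrightarrow> y \<in> carrier A
        \<Longrightarrow> ((x \<curlywedge> \<one>) \<leadsto> y) \<curlywedge> ((\<sim> y \<curlywedge> \<one>) \<leadsto> \<sim> x) = x \<leadsto> y"

locale BKL = K_lattice A for A :: "'a rlat" (structure) +
  assumes zero_least: "x \<in> carrier A \<Longrightarrow> \<zero> \<preceq> x"

definition neg_cone :: "'a rlat \<Rightarrow> 'a rlat"
  where "neg_cone A =
    A\<lparr>carrier := {a \<in> carrier A. a \<preceq>\<^bsub>A\<^esub> \<one>\<^bsub>A\<^esub>},
      rl_imp := (\<lambda>a b. (a \<leadsto>\<^bsub>A\<^esub> b) \<curlywedge>\<^bsub>A\<^esub> \<one>\<^bsub>A\<^esub>)\<rparr>"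

definition K :: "'a rlat \<Rightarrow> ('a \<times> 'a) rlat"
  where "K A =
    \<lparr>carrier = carrier A \<times> carrier A,
     mult = (\<lambda>(a, b) (c, d). (a \<otimes>\<^bsub>A\<^esub> c, (a \<leadsto>\<^bsub>A\<^esub> d) \<curlywedge>\<^bsub>A\<^esub> (c \<leadsto>\<^bsub>A\<^esub> b))),
     one = (\<one>\<^bsub>A\<^esub>, \<one>\<^bsub>A\<^esub>),
     rl_join = (\<lambda>(a, b) (c, d). (a \<curlyvee>\<^bsub>A\<^esub> c, b \<curlywedge>\<^bsub>A\<^esub> d)),
     rl_meet = (\<lambda>(a, b) (c, d). (a \<curlywedge>\<^bsub>A\<^esub> c, b \<curlyvee>\<^bsub>A\<^esub> d)),
     rl_imp = (\<lambda>(a, b) (c, d). ((a \<leadsto>\<^bsub>A\<^esub> c) \<curlywedge>\<^bsub>A\<^esub> (d \<leadsto>\<^bsub>A\<^esub> b), a \<otimes>\<^bsub>A\<^esub> d)),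
     rl_zero = (\<zero>\<^bsub>A\<^esub>, \<one>\<^bsub>A\<^esub>)\<rparr>"

text \<open>Boolean algebras as members of \<^const>\<open>BCRL\<close>: multiplication is the meet and the bounded
  lattice reduct is distributive and complemented. By residuation \<open>\<leadsto>\<close> is then the Boolean
  implication.\<close>

locale boolean_rlat = BCRL A for A :: "'a rlat" (structure) +
  assumes mult_eq_meet: "x \<in> carrier A \<Longrightarrow> y \<in> carrier A \<Longrightarrow> x \<otimes> y = x \<curlywedge> y"
    and distrib: "x \<in> carrier A \<Longrightarrow> y \<in> carrier A \<Longrightarrow> z \<in> carrier A
      \<Longrightarrow> x \<curlywedge> (y \<curlyvee> z) = (x \<curlywedge> y) \<curlyvee> (x \<curlywedge> z)"
    and complemented: "x \<in> carrier A \<Longrightarrow> \<exists>y\<in>carrier A. x \<curlyvee> y = \<one> \<and> x \<curlywedge> y = \<zero>"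

definition two :: "bool rlat"
  where "two = \<lparr>carrier = UNIV, mult = (\<and>), one = True,
    rl_join = (\<or>), rl_meet = (\<and>), rl_imp = (\<longrightarrow>), rl_zero = False\<rparr>"

abbreviation K4 :: "(bool \<times> bool) rlat"
  where "K4 \<equiv> K two"


section \<open>Subalgebras, homomorphisms, congruences\<close>

definition subuniverse :: "'a set \<Rightarrow> 'a rlat \<Rightarrow> bool"
  where "subuniverse S A \<longleftrightarrow> S \<subseteq> carrier A \<and> rl_algebra (A\<lparr>carrier := S\<rparr>)"

definition rl_hom :: "('a \<Rightarrow> 'b) \<Rightarrow> 'a rlat \<Rightarrow> 'b rlat \<Rightarrow> bool"
  where "rl_hom h A B \<longleftrightarrow>
    h ` carrier A \<subseteq> carrier B \<and>
    (\<forall>x\<in>carrier A. \<forall>y\<in>carrier A.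
      h (x \<curlyvee>\<^bsub>A\<^esub> y) = h x \<curlyvee>\<^bsub>B\<^esub> h y \<and>
      h (x \<curlywedge>\<^bsub>A\<^esub> y) = h x \<curlywedge>\<^bsub>B\<^esub> h y \<and>
      h (x \<otimes>\<^bsub>A\<^esub> y) = h x \<otimes>\<^bsub>B\<^esub> h y \<and>
      h (x \<leadsto>\<^bsub>A\<^esub> y) = h x \<leadsto>\<^bsub>B\<^esub> h y) \<and>
    h \<zero>\<^bsub>A\<^esub> = \<zero>\<^bsub>B\<^esub> \<and> h \<one>\<^bsub>A\<^esub> = \<one>\<^bsub>B\<^esub>"

definition rl_iso :: "'a rlat \<Rightarrow> 'b rlat \<Rightarrow> bool"
  where "rl_iso A B \<longleftrightarrow> (\<exists>h. rl_hom h A B \<and> bij_betw h (carrier A) (carrier B))"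

definition congruence :: "'a rlat \<Rightarrow> 'a rel \<Rightarrow> bool"
  where "congruence A \<theta> \<longleftrightarrow> equiv (carrier A) \<theta> \<and>
    (\<forall>x x' y y'. (x, x') \<in> \<theta> \<longrightarrow> (y, y') \<in> \<theta> \<longrightarrow>
      (x \<curlyvee>\<^bsub>A\<^esub> y, x' \<curlyvee>\<^bsub>A\<^esub> y') \<in> \<theta> \<and>
      (x \<curlywedge>\<^bsub>A\<^esub> y, x' \<curlywedge>\<^bsub>A\<^esub> y') \<in> \<theta> \<and>
      (x \<otimes>\<^bsub>A\<^esub> y, x' \<otimes>\<^bsub>A\<^esub> y') \<in> \<theta> \<and>
      (x \<leadsto>\<^bsub>A\<^esub> y, x' \<leadsto>\<^bsub>A\<^esub> y') \<in> \<theta>)"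

text \<open>For a congruence \<open>\<theta>\<close> the result of an operation on two classes is the class
  of the result on any pair of representatives.\<close>

definition quot_op :: "'a rel \<Rightarrow> ('a \<Rightarrow> 'a \<Rightarrow> 'a) \<Rightarrow> 'a set \<Rightarrow> 'a set \<Rightarrow> 'a set"
  where "quot_op \<theta> f X Y = (\<Union>x\<in>X. \<Union>y\<in>Y. \<theta> `` {f x y})"

definition quotient_rlat :: "'a rlat \<Rightarrow> 'a rel \<Rightarrow> 'a set rlat"
  where "quotient_rlat A \<theta> =
    \<lparr>carrier = carrier A // \<theta>,
     mult = quot_op \<theta> (mult A),
     one = \<theta> `` {\<one>\<^bsub>A\<^esub>},
     rl_join = quot_op \<theta> (rl_join A),
     rl_meet = quot_op \<theta> (rl_meet A),
     rl_imp = quot_op \<theta> (rl_imp A),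
     rl_zero = \<theta> `` {\<zero>\<^bsub>A\<^esub>}\<rparr>"

text \<open>\<open>A\<close> is subdirectly irreducible if every subdirect embedding of \<open>A\<close>, that is, every
  family of surjective homomorphisms \<open>h i : A \<rightarrow> B i\<close> which jointly separate the points of \<open>A\<close>,
  contains an isomorphism. As the factors are quotients of \<open>A\<close> up to isomorphism, it is enough to
  let them live on \<^typ>\<open>'a set\<close> and to index them by \<^typ>\<open>'a rel\<close>. The empty family is allowed, so
  the one-element algebra is then not subdirectly irreducible.\<close>

definition subdirect_embedding ::
    "'i set \<Rightarrow> ('i \<Rightarrow> 'a \<Rightarrow> 'b) \<Rightarrow> 'a rlat \<Rightarrow> ('i \<Rightarrow> 'b rlat) \<Rightarrow> bool"
  where "subdirect_embedding I h A B \<longleftrightarrow>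
    (\<forall>i\<in>I. rl_algebra (B i) \<and> rl_hom (h i) A (B i) \<and> h i ` carrier A = carrier (B i)) \<and>
    (\<forall>x\<in>carrier A. \<forall>y\<in>carrier A. (\<forall>i\<in>I. h i x = h i y) \<longrightarrow> x = y)"

definition subdirectly_irreducible :: "'a rlat \<Rightarrow> bool"
  where "subdirectly_irreducible A \<longleftrightarrow>
    (\<forall>(I :: 'a rel set) h (B :: 'a rel \<Rightarrow> 'a set rlat). subdirect_embedding I h A B \<longrightarrow>
      (\<exists>i\<in>I. bij_betw (h i) (carrier A) (carrier (B i))))"

definition rigid :: "'a rlat \<Rightarrow> bool"
  where "rigid A \<longleftrightarrow>
    BCRL A \<and>
    (infinite (carrier A) \<or> card (carrier A) > 2) \<and>
    subdirectly_irreducible A \<and>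
    (\<forall>S. subuniverse S A \<and> S \<noteq> carrier A \<longrightarrow> S = {\<zero>\<^bsub>A\<^esub>, \<one>\<^bsub>A\<^esub>}) \<and>
    (\<forall>\<theta>. congruence A \<theta> \<and> \<theta> \<noteq> carrier A \<times> carrier A \<and> \<theta> \<noteq> Id_on (carrier A)
      \<longrightarrow> rl_iso (quotient_rlat A \<theta>) two)"

definition zero_meet_irreducible :: "'a rlat \<Rightarrow> bool"
  where "zero_meet_irreducible A \<longleftrightarrow>
    (\<forall>x\<in>carrier A. \<forall>y\<in>carrier A. x \<curlywedge>\<^bsub>A\<^esub> y = \<zero>\<^bsub>A\<^esub> \<longrightarrow> x = \<zero>\<^bsub>A\<^esub> \<or> y = \<zero>\<^bsub>A\<^esub>)"


section \<open>Varieties\<close>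

datatype trm = Var nat | Join trm trm | Meet trm trm | Mult trm trm | Imp trm trm | Zero | One

primrec trm_val :: "'a rlat \<Rightarrow> (nat \<Rightarrow> 'a) \<Rightarrow> trm \<Rightarrow> 'a"
  where
    "trm_val A v (Var n) = v n"
  | "trm_val A v (Join s t) = trm_val A v s \<curlyvee>\<^bsub>A\<^esub> trm_val A v t"
  | "trm_val A v (Meet s t) = trm_val A v s \<curlywedge>\<^bsub>A\<^esub> trm_val A v t"
  | "trm_val A v (Mult s t) = trm_val A v s \<otimes>\<^bsub>A\<^esub> trm_val A v t"
  | "trm_val A v (Imp s t) = trm_val A v s \<leadsto>\<^bsub>A\<^esub> trm_val A v t"
  | "trm_val A v Zero = \<zero>\<^bsub>A\<^esub>"
  | "trm_val A v One = \<one>\<^bsub>A\<^esub>"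

definition sat_identity :: "'a rlat \<Rightarrow> trm \<times> trm \<Rightarrow> bool"
  where "sat_identity A e \<longleftrightarrow>
    (\<forall>v. range v \<subseteq> carrier A \<longrightarrow> trm_val A v (fst e) = trm_val A v (snd e))"

definition identities :: "'a rlat \<Rightarrow> (trm \<times> trm) set"
  where "identities A = {e. sat_identity A e}"

text \<open>Varieties are equational classes. A class of algebras is represented by its members whose
  carrier is a subset of a universe type \<^typ>\<open>'u\<close>. If \<^typ>\<open>'u\<close> is infinite nothing is lost: an identity
  that fails in an algebra fails in a countable subalgebra of it, so a variety is determined by its
  members on \<^typ>\<open>'u\<close>, and the lattice of varieties (ordered by inclusion) does not depend on the
  choice of \<^typ>\<open>'u\<close>.\<close>

definition models :: "(trm \<times> trm) set \<Rightarrow> 'u rlat set"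
  where "models E = {B. rl_algebra B \<and> (\<forall>e\<in>E. sat_identity B e)}"

definition variety :: "'u rlat set \<Rightarrow> bool"
  where "variety V \<longleftrightarrow> (\<exists>E. V = models E)"

text \<open>The variety generated by \<open>A\<close>, where \<open>A\<close> itself need not live on \<^typ>\<open>'u\<close>: the least
  equational class containing \<open>A\<close> consists of the models of all identities of \<open>A\<close>.\<close>

definition variety_generated :: "'a rlat \<Rightarrow> 'u rlat set"
  where "variety_generated A = models (identities A)"

definition subvarieties_BKL :: "'u rlat set set"
  where "subvarieties_BKL = {V. variety V \<and> V \<subseteq> Collect BKL}"

definition K_BA :: "'u rlat set"
  where "K_BA = {A. BKL A \<and> boolean_rlat (neg_cone A)}"

definition covers_in :: "'s set set \<Rightarrow> 's set \<Rightarrow> 's set \<Rightarrow> bool"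
  where "covers_in L V W \<longleftrightarrow> V \<in> L \<and> W \<in> L \<and> W \<subset> V \<and> \<not> (\<exists>U\<in>L. W \<subset> U \<and> U \<subset> V)"

definition atom_in :: "'s set set \<Rightarrow> 's set \<Rightarrow> bool"
  where "atom_in L V \<longleftrightarrow> (\<exists>T\<in>L. (\<forall>U\<in>L. T \<subseteq> U) \<and> covers_in L V T)"

definition almost_minimal :: "'u rlat set \<Rightarrow> bool"
  where "almost_minimal V \<longleftrightarrow>
    (\<exists>W. atom_in subvarieties_BKL W \<and> covers_in subvarieties_BKL V W)"

end

theory Submission
  imports Defs
begin

text \<open>
  A bounded K-lattice \<open>A\<close> embeds into \<open>K (neg_cone A)\<close> by \<open>x \<mapsto> (x \<curlywedge> \<one>, \<sim> x \<curlywedge> \<one>)\<close>, so subalgebras and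
  congruences of the negative cone pull back to \<open>A\<close>. The three-element algebra \<open>K3\<close> (that is, \<open>K4\<close>
  without \<open>(\<zero>, \<zero>)\<close>) embeds into every nontrivial bounded K-lattice, hence generates the only atom.
  If the cone is Boolean, its ultrafilters yield enough homomorphisms from \<open>A\<close> to \<open>K4\<close> to separate
  points.

  For the first part, a proper subalgebra \<open>S \<noteq> {\<zero>, \<one>}\<close> of the cone pulls back to a proper subalgebra
  of \<open>A\<close> generating a variety strictly above the atom, so the same variety as \<open>A\<close>; as \<open>A\<close> is finite
  and subdirect irreducibility makes \<open>\<one>\<close> join irreducible in the cone, this contradicts Jonsson's
  lemma. The condition on quotients follows, because the classes of \<open>\<zero>\<close> and \<open>\<one>\<close>
  modulo a congruence form a subalgebra of the cone.

  For the second part, take the subalgebra of \<open>K A\<close> generated by \<open>A \<times> {\<one>}\<close>. It omits \<open>(\<zero>, \<zero>)\<close>, its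
  only subalgebras are \<open>K3\<close> and itself, and its proper quotients are trivial or \<open>K3\<close>; so every
  nontrivial subvariety other than the atom contains it.
\<close>

section \<open>Residuated lattices\<close>

text \<open>Varieties are given by identities, so no member of a variety is decomposed into
  subdirectly irreducible factors. Both parts work with terms instead: an equation s = t becomes the
  term (s \<leftrightarrow> t) \<curlywedge> \<one>, whose values lie in the negative cone and equal
  \<one> exactly where the equation holds. In the first part a join of such terms bounds the size of
  \<open>A\<close>. In the second part an identity of B that fails in the core produces an element q
  < \<one>; modulo the filter of q every identity of \<open>K3\<close> holds, so some power of q
  lies below the value of the term of that identity. Multiplying over finitely many assignments
  turns this into one identity of the core, which B inherits. The obstacle in the second part is
  \<open>K4\<close>: a subalgebra of \<open>K A\<close> that contains (\<zero>, \<zero>) contains a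
  copy of \<open>K4\<close>, so its variety includes K(BA), which is already strictly above the
  atom; unless it equals K(BA), it cannot cover the atom. The copies of \<open>K3\<close> come from
  the constants: their elements are \<zero>, \<one> and \<sim> \<zero>.\<close>

context comm_residuated_lattice
begin

lemma meet_idem [simp]: "x \<in> carrier A \<Longrightarrow> x \<curlywedge> x = x"
  by (metis join_absorb meet_absorb meet_clos)

lemma join_idem [simp]: "x \<in> carrier A \<Longrightarrow> x \<curlyvee> x = x"
  by (metis join_absorb meet_idem)

lemma le_refl [simp]: "x \<in> carrier A \<Longrightarrow> x \<preceq> x"
  by (simp add: rl_le_def)

lemma le_antisym: "x \<preceq> y \<Longrightarrow> y \<preceq> x \<Longrightarrow> x \<in> carrier A \<Longrightarrow> y \<in> carrier A \<Longrightarrow> x = y"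
  by (metis meet_commute rl_le_def)

lemma le_trans: "x \<preceq> y \<Longrightarrow> y \<preceq> z \<Longrightarrow> x \<in> carrier A \<Longrightarrow> y \<in> carrier A \<Longrightarrow> z \<in> carrier A \<Longrightarrow> x \<preceq> z"
  by (metis meet_assoc rl_le_def)

lemma le_iff_join: "x \<in> carrier A \<Longrightarrow> y \<in> carrier A \<Longrightarrow> x \<preceq> y \<longleftrightarrow> x \<curlyvee> y = y"
  by (metis join_absorb join_commute meet_absorb meet_commute rl_le_def)

lemma meet_le1 [simp]: "x \<in> carrier A \<Longrightarrow> y \<in> carrier A \<Longrightarrow> x \<curlywedge> y \<preceq> x"
  by (metis meet_assoc meet_commute meet_idem rl_le_def)

lemma meet_le2 [simp]: "x \<in> carrier A \<Longrightarrow> y \<in> carrier A \<Longrightarrow> x \<curlywedge> y \<preceq> y"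
  by (metis meet_commute meet_le1)

lemma le_meetI: "z \<preceq> x \<Longrightarrow> z \<preceq> y \<Longrightarrow> x \<in> carrier A \<Longrightarrow> y \<in> carrier A \<Longrightarrow> z \<in> carrier A \<Longrightarrow> z \<preceq> x \<curlywedge> y"
  by (metis meet_assoc rl_le_def)

lemma le_meet_iff: "x \<in> carrier A \<Longrightarrow> y \<in> carrier A \<Longrightarrow> z \<in> carrier A \<Longrightarrow> z \<preceq> x \<curlywedge> y \<longleftrightarrow> z \<preceq> x \<and> z \<preceq> y"
  by (meson le_meetI le_trans meet_clos meet_le1 meet_le2)

lemma join_ge1 [simp]: "x \<in> carrier A \<Longrightarrow> y \<in> carrier A \<Longrightarrow> x \<preceq> x \<curlyvee> y"
  by (simp add: meet_absorb rl_le_def)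

lemma join_ge2 [simp]: "x \<in> carrier A \<Longrightarrow> y \<in> carrier A \<Longrightarrow> y \<preceq> x \<curlyvee> y"
  by (metis join_commute join_ge1)

lemma join_leI: "x \<preceq> z \<Longrightarrow> y \<preceq> z \<Longrightarrow> x \<in> carrier A \<Longrightarrow> y \<in> carrier A \<Longrightarrow> z \<in> carrier A \<Longrightarrow> x \<curlyvee> y \<preceq> z"
  by (metis join_assoc join_clos le_iff_join)

lemma join_le_iff: "x \<in> carrier A \<Longrightarrow> y \<in> carrier A \<Longrightarrow> z \<in> carrier A \<Longrightarrow> x \<curlyvee> y \<preceq> z \<longleftrightarrow> x \<preceq> z \<and> y \<preceq> z"
  by (meson join_leI le_trans join_clos join_ge1 join_ge2)

text \<open>Yoneda principle: equations between meets and implications are proved below by comparing the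
  lower bounds of both sides.\<close>

lemma eqI_below:
  assumes "x \<in> carrier A" "y \<in> carrier A" "\<And>z. z \<in> carrier A \<Longrightarrow> z \<preceq> x \<longleftrightarrow> z \<preceq> y"
  shows "x = y"
  using assms le_antisym le_refl by blast

lemma mult_right_mono:
  assumes "x \<preceq> y" "x \<in> carrier A" "y \<in> carrier A" "z \<in> carrier A" shows "x \<otimes> z \<preceq> y \<otimes> z"
proof -
  have "y \<preceq> z \<leadsto> (y \<otimes> z)" using residuation[of y z "y \<otimes> z"] assms by simp
  then have "x \<preceq> z \<leadsto> (y \<otimes> z)" using assms le_trans[of x y] imp_clos by simp
  then show ?thesis using residuation[of x z "y \<otimes> z"] assms by simp
qed

lemma mult_mono:
  assumes "x \<preceq> y" "u \<preceq> v" "x \<in> carrier A" "y \<in> carrier A" "u \<in> carrier A" "v \<in> carrier A"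
  shows "x \<otimes> u \<preceq> y \<otimes> v"
proof -
  have "x \<otimes> u \<preceq> y \<otimes> u" using assms mult_right_mono by blast
  moreover have "y \<otimes> u \<preceq> y \<otimes> v" using assms mult_right_mono[of u v y] m_comm by metis
  ultimately show ?thesis using assms by (meson le_trans mult_clos)
qed

lemma imp_mult_le:
  assumes "x \<in> carrier A" "y \<in> carrier A" shows "(x \<leadsto> y) \<otimes> x \<preceq> y"
  using assms residuation[of "x \<leadsto> y" x y] imp_clos by simp

lemma le_imp_iff:
  assumes "x \<in> carrier A" "y \<in> carrier A" "z \<in> carrier A" shows "z \<preceq> x \<leadsto> y \<longleftrightarrow> z \<otimes> x \<preceq> y"
  using residuation assms by simp

lemma one_le_imp_iff:
  assumes "x \<in> carrier A" "y \<in> carrier A" shows "\<one> \<preceq> x \<leadsto> y \<longleftrightarrow> x \<preceq> y"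
  using le_imp_iff[of x y \<one>] assms by simp

lemma mult_join_distrib:
  assumes "x \<in> carrier A" "y \<in> carrier A" "z \<in> carrier A"
  shows "(x \<curlyvee> y) \<otimes> z = (x \<otimes> z) \<curlyvee> (y \<otimes> z)"
proof (rule le_antisym)
  have "x \<preceq> z \<leadsto> ((x \<otimes> z) \<curlyvee> (y \<otimes> z))" "y \<preceq> z \<leadsto> ((x \<otimes> z) \<curlyvee> (y \<otimes> z))"
    using assms by (simp_all add: le_imp_iff join_clos)
  then have "x \<curlyvee> y \<preceq> z \<leadsto> ((x \<otimes> z) \<curlyvee> (y \<otimes> z))"
    using assms by (simp add: join_leI imp_clos join_clos)
  then show "(x \<curlyvee> y) \<otimes> z \<preceq> (x \<otimes> z) \<curlyvee> (y \<otimes> z)"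
    using assms by (simp add: le_imp_iff join_clos)
  show "(x \<otimes> z) \<curlyvee> (y \<otimes> z) \<preceq> (x \<curlyvee> y) \<otimes> z"
    using assms by (simp add: join_leI mult_right_mono join_clos)
qed (use assms in \<open>simp_all add: join_clos\<close>)

lemma imp_meet_distrib:
  assumes "x \<in> carrier A" "y \<in> carrier A" "z \<in> carrier A"
  shows "x \<leadsto> (y \<curlywedge> z) = (x \<leadsto> y) \<curlywedge> (x \<leadsto> z)"
  by (rule eqI_below) (use assms in \<open>simp_all add: le_imp_iff le_meet_iff imp_clos meet_clos\<close>)

lemma join_imp_distrib:
  assumes "x \<in> carrier A" "y \<in> carrier A" "z \<in> carrier A"
  shows "(x \<curlyvee> y) \<leadsto> z = (x \<leadsto> z) \<curlywedge> (y \<leadsto> z)"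
  by (rule eqI_below)
    (use assms in \<open>simp_all add: le_imp_iff le_meet_iff imp_clos meet_clos join_clos m_comm[of _ "x \<curlyvee> y"] mult_join_distrib join_le_iff m_comm[of x] m_comm[of y]\<close>)

lemma mult_imp:
  assumes "x \<in> carrier A" "y \<in> carrier A" "z \<in> carrier A"
  shows "(x \<otimes> y) \<leadsto> z = x \<leadsto> (y \<leadsto> z)"
  by (rule eqI_below) (use assms in \<open>simp_all add: le_imp_iff imp_clos m_assoc\<close>)

lemma one_imp [simp]:
  assumes "x \<in> carrier A" shows "\<one> \<leadsto> x = x"
  by (rule eqI_below) (use assms in \<open>simp_all add: le_imp_iff imp_clos\<close>)

lemma imp_mono:
  assumes "y \<preceq> z" "x \<in> carrier A" "y \<in> carrier A" "z \<in> carrier A" shows "x \<leadsto> y \<preceq> x \<leadsto> z"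
  using assms by (metis imp_meet_distrib rl_le_def)

lemma power_clos [simp]: "x \<in> carrier A \<Longrightarrow> x [^] (n::nat) \<in> carrier A"
  by (rule nat_pow_closed)

end

section \<open>Integral bounded residuated lattices and the congruences of principal filters\<close>

context BCRL
begin

lemma mult_le1: "x \<in> carrier A \<Longrightarrow> y \<in> carrier A \<Longrightarrow> x \<otimes> y \<preceq> x"
  using mult_mono[of x x y \<one>] unit_greatest by simp

lemma mult_le2: "x \<in> carrier A \<Longrightarrow> y \<in> carrier A \<Longrightarrow> x \<otimes> y \<preceq> y"
  using mult_le1[of y x] m_comm by simp

lemma le_zero: "x \<in> carrier A \<Longrightarrow> x \<preceq> \<zero> \<Longrightarrow> x = \<zero>"
  using le_antisym zero_clos zero_least by blast

lemma one_le: "x \<in> carrier A \<Longrightarrow> \<one> \<preceq> x \<Longrightarrow> x = \<one>"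
  using le_antisym unit_clos unit_greatest by blast

lemma imp_eq_one_iff:
  assumes "x \<in> carrier A" "y \<in> carrier A" shows "x \<leadsto> y = \<one> \<longleftrightarrow> x \<preceq> y"
  using assms one_le_imp_iff one_le imp_clos by (metis le_refl one_closed)

lemma unit_simps [simp]:
  assumes "x \<in> carrier A"
  shows "x \<curlywedge> \<one> = x" "\<one> \<curlywedge> x = x" "x \<curlyvee> \<one> = \<one>" "\<one> \<curlyvee> x = \<one>" "x \<leadsto> \<one> = \<one>" "x \<leadsto> x = \<one>"
  using assms unit_greatest[of x] le_iff_join[of x \<one>] join_commute[of x \<one>] meet_commute[of x \<one>]
    imp_eq_one_iff[of x \<one>] imp_eq_one_iff[of x x]
  by (simp_all add: rl_le_def)

lemma zero_simps [simp]:
  assumes "x \<in> carrier A"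
  shows "x \<curlywedge> \<zero> = \<zero>" "\<zero> \<curlywedge> x = \<zero>" "x \<curlyvee> \<zero> = x" "\<zero> \<curlyvee> x = x" "\<zero> \<leadsto> x = \<one>"
    "x \<otimes> \<zero> = \<zero>" "\<zero> \<otimes> x = \<zero>"
  using assms zero_least[of x] le_iff_join[of \<zero> x] join_commute[of x \<zero>] meet_commute[of x \<zero>]
    imp_eq_one_iff[of \<zero> x] zero_clos le_zero[OF _ mult_le1[of \<zero> x]] le_zero[OF _ mult_le2[of x \<zero>]]
  by (simp_all add: rl_le_def)

lemma le_imp: "x \<in> carrier A \<Longrightarrow> y \<in> carrier A \<Longrightarrow> y \<preceq> x \<leadsto> y"
  by (simp add: le_imp_iff mult_le1)

lemma power_antimono:
  assumes "x \<in> carrier A" shows "x [^] (m + n) \<preceq> x [^] (n::nat)"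
  using mult_le2[of "x [^] m" "x [^] n"] assms by (simp add: nat_pow_mult)

text \<open>Multiplying out \<open>(x \<curlyvee> y) \<otimes> (x \<curlyvee> z)\<close> gives only
  terms below \<open>x\<close>, apart from \<open>y \<otimes> z\<close>; so a join equal to
  \<open>\<one>\<close> survives passing to products, and hence to powers.\<close>

lemma power_join_eq_one:
  assumes "a \<in> carrier A" "b \<in> carrier A" "a \<curlyvee> b = \<one>"
  shows "a [^] (m::nat) \<curlyvee> b [^] (n::nat) = \<one>"
proof -
  have step: "x \<curlyvee> (y \<otimes> z) = \<one>"
    if xyz: "x \<in> carrier A" "y \<in> carrier A" "z \<in> carrier A" and xy: "x \<curlyvee> y = \<one>" and xz: "x \<curlyvee> z = \<one>" for x y z
  proof -
    have "\<one> = (x \<curlyvee> y) \<otimes> (x \<curlyvee> z)" by (simp add: xy xz)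
    also have "\<dots> = (x \<otimes> (x \<curlyvee> z)) \<curlyvee> (y \<otimes> (x \<curlyvee> z))"
      using xyz by (simp add: mult_join_distrib join_clos)
    also have "y \<otimes> (x \<curlyvee> z) = (x \<otimes> y) \<curlyvee> (y \<otimes> z)"
      using xyz mult_join_distrib[of x z y] by (simp add: m_comm join_clos)
    finally have "\<one> = (x \<otimes> (x \<curlyvee> z)) \<curlyvee> ((x \<otimes> y) \<curlyvee> (y \<otimes> z))" .
    moreover have "(x \<otimes> (x \<curlyvee> z)) \<curlyvee> ((x \<otimes> y) \<curlyvee> (y \<otimes> z)) \<preceq> x \<curlyvee> (y \<otimes> z)"
      using xyz by (intro join_leI) (auto intro: mult_le1 le_trans[OF mult_le1 join_ge1] simp: join_clos)
    ultimately show ?thesis using one_le xyz by (simp add: join_clos)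
  qed
  have *: "x \<curlyvee> y [^] k = \<one>" if "x \<in> carrier A" "y \<in> carrier A" "x \<curlyvee> y = \<one>" for x y and k :: nat
    by (induction k) (use that step in \<open>simp_all\<close>)
  show ?thesis
    using *[of "b [^] n" a m] *[of a b n] assms join_commute by simp
qed

text \<open>The congruence of the filter generated by \<open>a\<close>: by residuation the condition
  says that some power of \<open>a\<close> lies below both \<open>x \<leadsto> y\<close> and
  \<open>y \<leadsto> x\<close>.\<close>

definition power_cong :: "'a \<Rightarrow> 'a rel"
  where "power_cong a = {(x, y). x \<in> carrier A \<and> y \<in> carrier A \<and>
    (\<exists>n::nat. a [^] n \<otimes> x \<preceq> y \<and> a [^] n \<otimes> y \<preceq> x)}"

text \<open>Powers of \<open>a\<close> decrease, so the sum of the two exponents serves both pairs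
  at once.\<close>

lemma power_cong_common:
  assumes "a \<in> carrier A" "(x, x') \<in> power_cong a" "(y, y') \<in> power_cong a"
  obtains c where "c \<in> carrier A" "\<exists>n::nat. c = a [^] n"
    "c \<otimes> x \<preceq> x'" "c \<otimes> x' \<preceq> x" "c \<otimes> y \<preceq> y'" "c \<otimes> y' \<preceq> y"
    "x \<in> carrier A" "x' \<in> carrier A" "y \<in> carrier A" "y' \<in> carrier A"
proof -
  obtain m n :: nat where mn: "a [^] m \<otimes> x \<preceq> x'" "a [^] m \<otimes> x' \<preceq> x" "a [^] n \<otimes> y \<preceq> y'" "a [^] n \<otimes> y' \<preceq> y"
    and cl: "x \<in> carrier A" "x' \<in> carrier A" "y \<in> carrier A" "y' \<in> carrier A"
    using assms unfolding power_cong_def by blast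
  have le: "a [^] (m + n) \<preceq> a [^] m" "a [^] (m + n) \<preceq> a [^] n"
    using power_antimono[of a m n] power_antimono[of a n m] assms by (simp_all add: add.commute)
  have tr: "a [^] (m + n) \<otimes> u \<preceq> v" if "a [^] k \<otimes> u \<preceq> v" "a [^] (m + n) \<preceq> a [^] k" "u \<in> carrier A" "v \<in> carrier A"
    for u v and k :: nat
    using that assms mult_right_mono le_trans by (meson mult_clos power_clos)
  show thesis
    by (rule that[of "a [^] (m + n)"]) (use assms cl mn le tr in \<open>auto\<close>)
qed

lemma congruence_power_cong:
  assumes a: "a \<in> carrier A" shows "congruence A (power_cong a)"
  unfolding congruence_def
proof (intro conjI allI impI)
  have refl: "(x, x) \<in> power_cong a" if "x \<in> carrier A" for x
    using that a mult_le2 unfolding power_cong_def by auto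
  have sym: "(y, x) \<in> power_cong a" if "(x, y) \<in> power_cong a" for x y
    using that unfolding power_cong_def by auto
  have trans: "(x, z) \<in> power_cong a" if xyz: "(x, y) \<in> power_cong a" "(y, z) \<in> power_cong a" for x y z
  proof -
    obtain m n :: nat where mn: "a [^] m \<otimes> x \<preceq> y" "a [^] m \<otimes> y \<preceq> x" "a [^] n \<otimes> y \<preceq> z" "a [^] n \<otimes> z \<preceq> y"
      and cl: "x \<in> carrier A" "y \<in> carrier A" "z \<in> carrier A"
      using xyz unfolding power_cong_def by blast
    have "a [^] (m + n) \<otimes> x = a [^] n \<otimes> (a [^] m \<otimes> x)" "a [^] (m + n) \<otimes> z = a [^] m \<otimes> (a [^] n \<otimes> z)"
      using a cl by (simp_all add: nat_pow_mult[symmetric] m_ac)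
    moreover have "a [^] n \<otimes> (a [^] m \<otimes> x) \<preceq> z"
      using le_trans[OF mult_mono[OF le_refl mn(1)] mn(3)] a cl by simp
    moreover have "a [^] m \<otimes> (a [^] n \<otimes> z) \<preceq> x"
      using le_trans[OF mult_mono[OF le_refl mn(4)] mn(2)] a cl by simp
    ultimately show ?thesis using cl unfolding power_cong_def by (auto intro!: exI[of _ "m + n"])
  qed
  show "equiv (carrier A) (power_cong a)"
  proof (rule equivI)
    show "power_cong a \<subseteq> carrier A \<times> carrier A" by (auto simp: power_cong_def)
    show "refl_on (carrier A) (power_cong a)" using refl by (simp add: refl_on_def)
    show "sym (power_cong a)" using sym by (rule symI)
    show "trans (power_cong a)" using trans by (rule transI)
  qed
  fix x x' y y' assume "(x, x') \<in> power_cong a" "(y, y') \<in> power_cong a"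
  with a obtain c where c: "c \<in> carrier A" "\<exists>n::nat. c = a [^] n"
    "c \<otimes> x \<preceq> x'" "c \<otimes> x' \<preceq> x" "c \<otimes> y \<preceq> y'" "c \<otimes> y' \<preceq> y"
    "x \<in> carrier A" "x' \<in> carrier A" "y \<in> carrier A" "y' \<in> carrier A"
    by (rule power_cong_common)
  have I: "(u, v) \<in> power_cong a"
    if "\<And>e f. e = u \<and> f = v \<or> e = v \<and> f = u \<Longrightarrow> e \<in> carrier A \<and> (c \<otimes> e \<preceq> f \<or> (c \<otimes> c) \<otimes> e \<preceq> f)" for u v
  proof -
    from c(2) obtain n :: nat where n: "c = a [^] n" by blast
    have uv: "u \<in> carrier A" "v \<in> carrier A" using that by auto
    have cc: "(c \<otimes> c) \<otimes> e \<preceq> f" if "c \<otimes> e \<preceq> f" "e \<in> carrier A" "f \<in> carrier A" for e f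
    proof -
      have "(c \<otimes> c) \<otimes> e = c \<otimes> (c \<otimes> e)" using that c m_assoc by simp
      then show ?thesis using le_trans[OF mult_le2[of c "c \<otimes> e"] that(1)] that c by simp
    qed
    have "(c \<otimes> c) \<otimes> u \<preceq> v" using that[of u v] cc[of u v] uv by blast
    moreover have "(c \<otimes> c) \<otimes> v \<preceq> u" using that[of v u] cc[of v u] uv by blast
    moreover have "c \<otimes> c = a [^] (n + n)" unfolding n using a by (simp add: nat_pow_mult)
    ultimately show ?thesis using uv unfolding power_cong_def by (auto intro!: exI[of _ "n + n"])
  qed
  have J: "c \<otimes> (e \<curlyvee> f) \<preceq> e' \<curlyvee> f'"
    if "c \<otimes> e \<preceq> e'" "c \<otimes> f \<preceq> f'" "e \<in> carrier A" "f \<in> carrier A" "e' \<in> carrier A" "f' \<in> carrier A" for e f e' f'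
  proof -
    have "c \<otimes> (e \<curlyvee> f) = (c \<otimes> e) \<curlyvee> (c \<otimes> f)"
      using that c mult_join_distrib[of e f c] by (simp add: m_comm join_clos)
    moreover have "c \<otimes> e \<preceq> e' \<curlyvee> f'" "c \<otimes> f \<preceq> e' \<curlyvee> f'"
      using that c le_trans[OF that(1) join_ge1[of e' f']] le_trans[OF that(2) join_ge2[of e' f']]
      by (simp_all add: join_clos)
    ultimately show ?thesis using that c by (simp add: join_leI join_clos)
  qed
  have M: "c \<otimes> (e \<curlywedge> f) \<preceq> e' \<curlywedge> f'"
    if "c \<otimes> e \<preceq> e'" "c \<otimes> f \<preceq> f'" "e \<in> carrier A" "f \<in> carrier A" "e' \<in> carrier A" "f' \<in> carrier A" for e f e' f'
    using that c
    by (intro le_meetI le_trans[OF mult_mono[OF le_refl meet_le1] that(1)] le_trans[OF mult_mono[OF le_refl meet_le2] that(2)])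
      (auto simp: meet_clos)
  have P: "(c \<otimes> c) \<otimes> (e \<otimes> f) \<preceq> e' \<otimes> f'"
    if "c \<otimes> e \<preceq> e'" "c \<otimes> f \<preceq> f'" "e \<in> carrier A" "f \<in> carrier A" "e' \<in> carrier A" "f' \<in> carrier A" for e f e' f'
    using that c mult_mono[OF that(1,2)] by (simp add: m_ac)
  \<comment> \<open>Implication reverses its first argument, so the first premise runs from
    \<open>e'\<close> to \<open>e\<close>. One factor \<open>c\<close> is spent on it, the other on
    passing from \<open>f\<close> to \<open>f'\<close>.\<close>
  have Im: "(c \<otimes> c) \<otimes> (e \<leadsto> f) \<preceq> e' \<leadsto> f'"
    if "c \<otimes> e' \<preceq> e" "c \<otimes> f \<preceq> f'" "e \<in> carrier A" "f \<in> carrier A" "e' \<in> carrier A" "f' \<in> carrier A" for e f e' f'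
  proof -
    have "(e \<leadsto> f) \<otimes> (c \<otimes> e') \<preceq> (e \<leadsto> f) \<otimes> e"
      using that c mult_mono imp_clos by simp
    then have "(e \<leadsto> f) \<otimes> (c \<otimes> e') \<preceq> f"
      using le_trans[OF _ imp_mult_le] that c imp_clos by simp
    then have "c \<otimes> ((e \<leadsto> f) \<otimes> (c \<otimes> e')) \<preceq> f'"
      using le_trans[OF mult_mono[OF le_refl] that(2)] that c imp_clos by simp
    then show ?thesis using that c imp_clos by (simp add: le_imp_iff m_ac)
  qed
  show "(x \<curlyvee> y, x' \<curlyvee> y') \<in> power_cong a" 
    by (rule I) (use c J[of x x' y y'] J[of x' x y' y] in \<open>metis join_clos\<close>)
  show "(x \<curlywedge> y, x' \<curlywedge> y') \<in> power_cong a" 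
    by (rule I) (use c M[of x x' y y'] M[of x' x y' y] in \<open>metis meet_clos\<close>)
  show "(x \<otimes> y, x' \<otimes> y') \<in> power_cong a" 
    by (rule I) (use c P[of x x' y y'] P[of x' x y' y] in \<open>metis mult_clos\<close>)
  show "(x \<leadsto> y, x' \<leadsto> y') \<in> power_cong a" 
    by (rule I) (use c Im[of x' x y y'] Im[of x x' y' y] in \<open>metis imp_clos\<close>)
qed

lemma power_cong_one:
  assumes "a \<in> carrier A" shows "(a, \<one>) \<in> power_cong a"
proof -
  have "a [^] (1::nat) \<otimes> a \<preceq> \<one>" "a [^] (1::nat) \<otimes> \<one> \<preceq> a"
    using assms by (simp_all add: unit_greatest)
  then show ?thesis using assms unfolding power_cong_def by blast
qed

end

section \<open>Homomorphisms, subuniverses and congruences\<close>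

lemma rl_homI:
  assumes "\<And>x. x \<in> carrier A \<Longrightarrow> h x \<in> carrier B"
    and "\<And>x y. x \<in> carrier A \<Longrightarrow> y \<in> carrier A \<Longrightarrow> h (x \<curlyvee>\<^bsub>A\<^esub> y) = h x \<curlyvee>\<^bsub>B\<^esub> h y"
    and "\<And>x y. x \<in> carrier A \<Longrightarrow> y \<in> carrier A \<Longrightarrow> h (x \<curlywedge>\<^bsub>A\<^esub> y) = h x \<curlywedge>\<^bsub>B\<^esub> h y"
    and "\<And>x y. x \<in> carrier A \<Longrightarrow> y \<in> carrier A \<Longrightarrow> h (x \<otimes>\<^bsub>A\<^esub> y) = h x \<otimes>\<^bsub>B\<^esub> h y"
    and "\<And>x y. x \<in> carrier A \<Longrightarrow> y \<in> carrier A \<Longrightarrow> h (x \<leadsto>\<^bsub>A\<^esub> y) = h x \<leadsto>\<^bsub>B\<^esub> h y"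
    and "h \<zero>\<^bsub>A\<^esub> = \<zero>\<^bsub>B\<^esub>" "h \<one>\<^bsub>A\<^esub> = \<one>\<^bsub>B\<^esub>"
  shows "rl_hom h A B"
  using assms unfolding rl_hom_def by blast

lemma rl_homD:
  assumes "rl_hom h A B"
  shows "x \<in> carrier A \<Longrightarrow> h x \<in> carrier B"
    and "x \<in> carrier A \<Longrightarrow> y \<in> carrier A \<Longrightarrow> h (x \<curlyvee>\<^bsub>A\<^esub> y) = h x \<curlyvee>\<^bsub>B\<^esub> h y"
    and "x \<in> carrier A \<Longrightarrow> y \<in> carrier A \<Longrightarrow> h (x \<curlywedge>\<^bsub>A\<^esub> y) = h x \<curlywedge>\<^bsub>B\<^esub> h y"
    and "x \<in> carrier A \<Longrightarrow> y \<in> carrier A \<Longrightarrow> h (x \<otimes>\<^bsub>A\<^esub> y) = h x \<otimes>\<^bsub>B\<^esub> h y"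
    and "x \<in> carrier A \<Longrightarrow> y \<in> carrier A \<Longrightarrow> h (x \<leadsto>\<^bsub>A\<^esub> y) = h x \<leadsto>\<^bsub>B\<^esub> h y"
    and "h \<zero>\<^bsub>A\<^esub> = \<zero>\<^bsub>B\<^esub>" "h \<one>\<^bsub>A\<^esub> = \<one>\<^bsub>B\<^esub>"
  using assms unfolding rl_hom_def by blast+

lemma rl_hom_comp: "rl_hom g A B \<Longrightarrow> rl_hom h B C \<Longrightarrow> rl_hom (h \<circ> g) A C"
  by (rule rl_homI) (simp_all add: rl_homD[of g A B] rl_homD[of h B C])

lemma rl_algebra_carrier_upd_iff:
  "rl_algebra (A\<lparr>carrier := S\<rparr>) \<longleftrightarrow>
    (\<forall>x\<in>S. \<forall>y\<in>S. x \<curlyvee>\<^bsub>A\<^esub> y \<in> S \<and> x \<curlywedge>\<^bsub>A\<^esub> y \<in> S \<and> x \<otimes>\<^bsub>A\<^esub> y \<in> S \<and> x \<leadsto>\<^bsub>A\<^esub> y \<in> S) \<and>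
    \<zero>\<^bsub>A\<^esub> \<in> S \<and> \<one>\<^bsub>A\<^esub> \<in> S"
  unfolding rl_algebra_def by auto

lemma subuniverseD:
  assumes "subuniverse S A"
  shows "S \<subseteq> carrier A" "\<zero>\<^bsub>A\<^esub> \<in> S" "\<one>\<^bsub>A\<^esub> \<in> S"
    "x \<in> S \<Longrightarrow> y \<in> S \<Longrightarrow> x \<curlyvee>\<^bsub>A\<^esub> y \<in> S" "x \<in> S \<Longrightarrow> y \<in> S \<Longrightarrow> x \<curlywedge>\<^bsub>A\<^esub> y \<in> S"
    "x \<in> S \<Longrightarrow> y \<in> S \<Longrightarrow> x \<otimes>\<^bsub>A\<^esub> y \<in> S" "x \<in> S \<Longrightarrow> y \<in> S \<Longrightarrow> x \<leadsto>\<^bsub>A\<^esub> y \<in> S"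
  using assms unfolding subuniverse_def rl_algebra_carrier_upd_iff by auto

lemma subuniverseI:
  assumes "S \<subseteq> carrier A" "\<zero>\<^bsub>A\<^esub> \<in> S" "\<one>\<^bsub>A\<^esub> \<in> S"
    "\<And>x y. x \<in> S \<Longrightarrow> y \<in> S \<Longrightarrow> x \<curlyvee>\<^bsub>A\<^esub> y \<in> S" "\<And>x y. x \<in> S \<Longrightarrow> y \<in> S \<Longrightarrow> x \<curlywedge>\<^bsub>A\<^esub> y \<in> S"
    "\<And>x y. x \<in> S \<Longrightarrow> y \<in> S \<Longrightarrow> x \<otimes>\<^bsub>A\<^esub> y \<in> S" "\<And>x y. x \<in> S \<Longrightarrow> y \<in> S \<Longrightarrow> x \<leadsto>\<^bsub>A\<^esub> y \<in> S"
  shows "subuniverse S A"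
  using assms unfolding subuniverse_def rl_algebra_carrier_upd_iff by simp

lemma subuniverse_rl_algebra: "subuniverse S A \<Longrightarrow> rl_algebra (A\<lparr>carrier := S\<rparr>)"
  by (simp add: subuniverse_def)

lemma subuniverse_hom_id: "subuniverse S A \<Longrightarrow> rl_hom id (A\<lparr>carrier := S\<rparr>) A"
  by (rule rl_homI) (auto dest: subuniverseD)

lemma rl_hom_subuniverse:
  "rl_hom h A B \<Longrightarrow> subuniverse S A \<Longrightarrow> rl_hom h (A\<lparr>carrier := S\<rparr>) B"
  using rl_hom_comp[OF subuniverse_hom_id, of S A h B] by simp

lemma rl_hom_into_subuniverse:
  "rl_hom h A B \<Longrightarrow> h ` carrier A \<subseteq> S \<Longrightarrow> rl_hom h A (B\<lparr>carrier := S\<rparr>)"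
  unfolding rl_hom_def by simp

lemma subuniverse_vimage:
  assumes "rl_algebra A" "rl_hom h A B" "subuniverse S B"
  shows "subuniverse {x \<in> carrier A. h x \<in> S} A"
proof -
  interpret rl_algebra A by fact
  show ?thesis
    by (rule subuniverseI)
      (auto simp: rl_homD[OF assms(2)] subuniverseD[OF assms(3)] join_clos meet_clos mult_clos imp_clos
        zero_clos unit_clos)
qed

lemma subuniverse_image:
  assumes "rl_algebra A" "rl_hom h A B"
  shows "subuniverse (h ` carrier A) B"
proof -
  interpret rl_algebra A by fact
  note h = rl_homD[OF assms(2)]
  show ?thesis
    by (rule subuniverseI)
      (auto simp: h(1) h(2-7)[symmetric] join_clos meet_clos mult_clos imp_clos zero_clos unit_clos)
qed

lemma subuniverse_Inter:
  assumes "\<S> \<noteq> {}" "\<And>S. S \<in> \<S> \<Longrightarrow> subuniverse S A"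
  shows "subuniverse (\<Inter>\<S>) A"
  by (rule subuniverseI) (use assms in \<open>auto dest: subuniverseD\<close>)

lemma congruenceD:
  assumes "congruence A \<theta>"
  shows "(x, y) \<in> \<theta> \<Longrightarrow> x \<in> carrier A" "(x, y) \<in> \<theta> \<Longrightarrow> y \<in> carrier A"
    "x \<in> carrier A \<Longrightarrow> (x, x) \<in> \<theta>" "(x, y) \<in> \<theta> \<Longrightarrow> (y, x) \<in> \<theta>"
    "(x, y) \<in> \<theta> \<Longrightarrow> (y, z) \<in> \<theta> \<Longrightarrow> (x, z) \<in> \<theta>"
    "(x, x') \<in> \<theta> \<Longrightarrow> (y, y') \<in> \<theta> \<Longrightarrow> (x \<curlyvee>\<^bsub>A\<^esub> y, x' \<curlyvee>\<^bsub>A\<^esub> y') \<in> \<theta>"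
    "(x, x') \<in> \<theta> \<Longrightarrow> (y, y') \<in> \<theta> \<Longrightarrow> (x \<curlywedge>\<^bsub>A\<^esub> y, x' \<curlywedge>\<^bsub>A\<^esub> y') \<in> \<theta>"
    "(x, x') \<in> \<theta> \<Longrightarrow> (y, y') \<in> \<theta> \<Longrightarrow> (x \<otimes>\<^bsub>A\<^esub> y, x' \<otimes>\<^bsub>A\<^esub> y') \<in> \<theta>"
    "(x, x') \<in> \<theta> \<Longrightarrow> (y, y') \<in> \<theta> \<Longrightarrow> (x \<leadsto>\<^bsub>A\<^esub> y, x' \<leadsto>\<^bsub>A\<^esub> y') \<in> \<theta>"
proof -
  have e: "\<theta> \<subseteq> carrier A \<times> carrier A" "refl_on (carrier A) \<theta>" "sym \<theta>" "trans \<theta>"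
    using assms by (auto simp: congruence_def equiv_def)
  show "(x, y) \<in> \<theta> \<Longrightarrow> x \<in> carrier A" "(x, y) \<in> \<theta> \<Longrightarrow> y \<in> carrier A" using e(1) by auto
  show "x \<in> carrier A \<Longrightarrow> (x, x) \<in> \<theta>" using e(2) by (rule refl_onD)
  show "(x, y) \<in> \<theta> \<Longrightarrow> (y, x) \<in> \<theta>" using e(3) by (rule symD)
  show "(x, y) \<in> \<theta> \<Longrightarrow> (y, z) \<in> \<theta> \<Longrightarrow> (x, z) \<in> \<theta>" using e(4) by (rule transD)
qed (use assms in \<open>simp_all add: congruence_def\<close>)

lemma congruenceI:
  assumes "\<And>x y. (x, y) \<in> \<theta> \<Longrightarrow> x \<in> carrier A \<and> y \<in> carrier A"
    "\<And>x. x \<in> carrier A \<Longrightarrow> (x, x) \<in> \<theta>" "\<And>x y. (x, y) \<in> \<theta> \<Longrightarrow> (y, x) \<in> \<theta>"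
    "\<And>x y z. (x, y) \<in> \<theta> \<Longrightarrow> (y, z) \<in> \<theta> \<Longrightarrow> (x, z) \<in> \<theta>"
    "\<And>x x' y y'. (x, x') \<in> \<theta> \<Longrightarrow> (y, y') \<in> \<theta> \<Longrightarrow> (x \<curlyvee>\<^bsub>A\<^esub> y, x' \<curlyvee>\<^bsub>A\<^esub> y') \<in> \<theta>"
    "\<And>x x' y y'. (x, x') \<in> \<theta> \<Longrightarrow> (y, y') \<in> \<theta> \<Longrightarrow> (x \<curlywedge>\<^bsub>A\<^esub> y, x' \<curlywedge>\<^bsub>A\<^esub> y') \<in> \<theta>"
    "\<And>x x' y y'. (x, x') \<in> \<theta> \<Longrightarrow> (y, y') \<in> \<theta> \<Longrightarrow> (x \<otimes>\<^bsub>A\<^esub> y, x' \<otimes>\<^bsub>A\<^esub> y') \<in> \<theta>"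
    "\<And>x x' y y'. (x, x') \<in> \<theta> \<Longrightarrow> (y, y') \<in> \<theta> \<Longrightarrow> (x \<leadsto>\<^bsub>A\<^esub> y, x' \<leadsto>\<^bsub>A\<^esub> y') \<in> \<theta>"
  shows "congruence A \<theta>"
proof -
  have "equiv (carrier A) \<theta>"
  proof (rule equivI)
    show "\<theta> \<subseteq> carrier A \<times> carrier A" using assms(1) by auto
    show "refl_on (carrier A) \<theta>" using assms(2) by (simp add: refl_on_def)
    show "sym \<theta>" using assms(3) by (rule symI)
    show "trans \<theta>" using assms(4) by (rule transI)
  qed
  then show ?thesis using assms(5-8) by (simp add: congruence_def)
qed

lemma congruence_vimage:
  assumes "rl_algebra A" "rl_hom h A B" "congruence B \<theta>"
  shows "congruence A {(x, y). x \<in> carrier A \<and> y \<in> carrier A \<and> (h x, h y) \<in> \<theta>}"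
proof -
  interpret rl_algebra A by fact
  note h = rl_homD[OF assms(2)] and c = congruenceD[OF assms(3)]
  show ?thesis
  proof (rule congruenceI, goal_cases)
    case (4 x y z)
    then show ?case using c(5)[of "h x" "h y" "h z"] by simp
  qed (auto simp: h join_clos meet_clos mult_clos imp_clos c(3,4) intro: c(6-9))
qed

lemma congruence_kernel:
  assumes "rl_algebra A" "rl_hom h A B"
  shows "congruence A {(x, y). x \<in> carrier A \<and> y \<in> carrier A \<and> h x = h y}"
proof -
  interpret rl_algebra A by fact
  note h = rl_homD[OF assms(2)]
  show ?thesis
    by (rule congruenceI) (auto simp: h join_clos meet_clos mult_clos imp_clos)
qed

lemma rl_algebra_BCRL: "BCRL A \<Longrightarrow> rl_algebra A"
  by (simp add: BCRL_def comm_residuated_lattice_def)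

lemma rl_algebra_BKL: "BKL A \<Longrightarrow> rl_algebra A"
  by (simp add: BKL_def K_lattice_def comm_residuated_lattice_def)

section \<open>The twist construction\<close>

lemma K_simps [simp]:
  "carrier (K A) = carrier A \<times> carrier A"
  "(a, b) \<otimes>\<^bsub>K A\<^esub> (c, d) = (a \<otimes>\<^bsub>A\<^esub> c, (a \<leadsto>\<^bsub>A\<^esub> d) \<curlywedge>\<^bsub>A\<^esub> (c \<leadsto>\<^bsub>A\<^esub> b))"
  "\<one>\<^bsub>K A\<^esub> = (\<one>\<^bsub>A\<^esub>, \<one>\<^bsub>A\<^esub>)"
  "(a, b) \<curlyvee>\<^bsub>K A\<^esub> (c, d) = (a \<curlyvee>\<^bsub>A\<^esub> c, b \<curlywedge>\<^bsub>A\<^esub> d)"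
  "(a, b) \<curlywedge>\<^bsub>K A\<^esub> (c, d) = (a \<curlywedge>\<^bsub>A\<^esub> c, b \<curlyvee>\<^bsub>A\<^esub> d)"
  "(a, b) \<leadsto>\<^bsub>K A\<^esub> (c, d) = ((a \<leadsto>\<^bsub>A\<^esub> c) \<curlywedge>\<^bsub>A\<^esub> (d \<leadsto>\<^bsub>A\<^esub> b), a \<otimes>\<^bsub>A\<^esub> d)"
  "\<zero>\<^bsub>K A\<^esub> = (\<zero>\<^bsub>A\<^esub>, \<one>\<^bsub>A\<^esub>)"
  by (simp_all add: K_def)

lemma rl_hom_K:
  assumes "rl_algebra A" "rl_hom h A B" shows "rl_hom (map_prod h h) (K A) (K B)"
proof -
  interpret rl_algebra A by fact
  note h = rl_homD[OF assms(2)]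
  show ?thesis
    by (rule rl_homI) (auto simp: h join_clos meet_clos mult_clos imp_clos)
qed

lemma subuniverse_K:
  assumes "subuniverse S A" shows "subuniverse (S \<times> S) (K A)"
proof -
  note S = subuniverseD[OF assms]
  show ?thesis
    by (rule subuniverseI) (use S(1) in \<open>auto simp: S(2-7)\<close>)
qed

lemma congruence_K:
  "congruence A \<theta> \<Longrightarrow> congruence (K A) {((a, b), (c, d)). (a, c) \<in> \<theta> \<and> (b, d) \<in> \<theta>}"
proof -
  assume "congruence A \<theta>"
  note c = congruenceD[OF this]
  show ?thesis
  proof (rule congruenceI, goal_cases)
    case (4 x y z)
    then show ?case using c(5)[of "fst x" "fst y" "fst z"] c(5)[of "snd x" "snd y" "snd z"]
      by (simp add: split_beta)
  qed (auto intro: c(1-4,6-9) c(7)[OF c(9) c(9)])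
qed

context BCRL
begin

lemma K_le_iff:
  assumes "a \<in> carrier A" "b \<in> carrier A" "c \<in> carrier A" "d \<in> carrier A"
  shows "(a, b) \<preceq>\<^bsub>K A\<^esub> (c, d) \<longleftrightarrow> a \<preceq> c \<and> d \<preceq> b"
  unfolding le_iff_join[OF assms(4,2)] by (simp add: rl_le_def join_commute[OF assms(2,4)])

lemma K_comm_residuated_lattice: "comm_residuated_lattice (K A)"
proof -
  have "rl_algebra (K A)"
    by unfold_locales (auto simp: join_clos meet_clos imp_clos zero_clos)
  moreover have "comm_monoid (K A)"
  proof (rule comm_monoidI)
    fix x y z assume "x \<in> carrier (K A)" "y \<in> carrier (K A)" "z \<in> carrier (K A)"
    then obtain a b c d e f where "x = (a, b)" "y = (c, d)" "z = (e, f)" and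
      cl: "a \<in> carrier A" "b \<in> carrier A" "c \<in> carrier A" "d \<in> carrier A" "e \<in> carrier A" "f \<in> carrier A"
      by auto
    \<comment> \<open>The lower bounds of either side are the z whose products with
      \<open>a \<otimes> c\<close>, \<open>a \<otimes> e\<close> and \<open>c \<otimes> e\<close>
      lie below \<open>f\<close>, \<open>d\<close> and \<open>b\<close> respectively.\<close>
    moreover have "((a \<otimes> c) \<leadsto> f) \<curlywedge> (e \<leadsto> ((a \<leadsto> d) \<curlywedge> (c \<leadsto> b))) =
      (a \<leadsto> ((c \<leadsto> f) \<curlywedge> (e \<leadsto> d))) \<curlywedge> ((c \<otimes> e) \<leadsto> b)"
      by (rule eqI_below)
        (use cl in \<open>auto simp: le_meet_iff le_imp_iff imp_clos meet_clos m_ac\<close>)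
    ultimately show "(x \<otimes>\<^bsub>K A\<^esub> y) \<otimes>\<^bsub>K A\<^esub> z = x \<otimes>\<^bsub>K A\<^esub> (y \<otimes>\<^bsub>K A\<^esub> z)"
      by (simp add: m_assoc)
  qed (auto simp: meet_clos imp_clos m_comm intro!: meet_commute)
  moreover have "comm_residuated_lattice_axioms (K A)"
  proof (unfold_locales, goal_cases)
    case (7 x y z)
    then obtain a b c d e f where "x = (a, b)" "y = (c, d)" "z = (e, f)" and
      cl: "a \<in> carrier A" "b \<in> carrier A" "c \<in> carrier A" "d \<in> carrier A" "e \<in> carrier A" "f \<in> carrier A"
      by auto
    \<comment> \<open>In the product this inequality sits in the second coordinate, where the order
      is reversed; in the implication it reappears in the first coordinate.\<close>
    moreover have "f \<preceq> a \<leadsto> d \<longleftrightarrow> a \<preceq> f \<leadsto> d" using cl by (simp add: le_imp_iff m_comm)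
    ultimately show ?case
      by (auto simp: K_le_iff meet_clos imp_clos le_meet_iff le_imp_iff m_comm)
  qed (auto simp: join_commute meet_commute join_assoc meet_assoc join_absorb meet_absorb)
  ultimately show ?thesis by (simp add: comm_residuated_lattice_def)
qed

lemma K_BKL: "BKL (K A)"
proof -
  interpret K: comm_residuated_lattice "K A" by (rule K_comm_residuated_lattice)
  have neg: "\<sim>\<^bsub>K A\<^esub> (a, b) = (b, a)" if "a \<in> carrier A" "b \<in> carrier A" for a b
    using that by (simp add: rl_neg_def)
  \<comment> \<open>The unit is the greatest element of \<open>A\<close>, so these instances reduce
    to absorption. In the second coordinate of \<open>K A\<close> the two laws trade places.\<close>
  have dist: "x \<curlywedge> (y \<curlyvee> z) = (x \<curlywedge> y) \<curlyvee> (x \<curlywedge> z)" "x \<curlyvee> (y \<curlywedge> z) = (x \<curlyvee> y) \<curlywedge> (x \<curlyvee> z)"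
    if "x \<in> carrier A" "y \<in> carrier A" "z \<in> carrier A" "\<one> \<in> {x, y, z}" for x y z
    using that join_absorb[of x y] join_absorb[of x z] meet_absorb[of x y] meet_absorb[of x z]
    by (auto simp: meet_clos join_clos join_commute[of _ x])
  show ?thesis
  proof (unfold_locales, goal_cases)
    case (2 x y z)
    then obtain a b c d e f where "x = (a, b)" "y = (c, d)" "z = (e, f)"
      "a \<in> carrier A" "b \<in> carrier A" "c \<in> carrier A" "d \<in> carrier A" "e \<in> carrier A" "f \<in> carrier A"
      by auto
    with 2(4) show ?case using dist(1)[of a c e] dist(2)[of b d f] by auto
  next
    case (3 x y z)
    then obtain a b c d e f where "x = (a, b)" "y = (c, d)" "z = (e, f)"
      "a \<in> carrier A" "b \<in> carrier A" "c \<in> carrier A" "d \<in> carrier A" "e \<in> carrier A" "f \<in> carrier A"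
      by auto
    with 3(4) show ?case using dist(2)[of a c e] dist(1)[of b d f] by auto
  qed (auto simp: neg imp_clos meet_clos m_comm K_le_iff unit_greatest zero_least zero_clos)
qed

end

section \<open>The negative cone\<close>

lemma neg_cone_simps [simp]:
  "carrier (neg_cone A) = {a \<in> carrier A. a \<preceq>\<^bsub>A\<^esub> \<one>\<^bsub>A\<^esub>}"
  "x \<otimes>\<^bsub>neg_cone A\<^esub> y = x \<otimes>\<^bsub>A\<^esub> y"
  "x \<curlyvee>\<^bsub>neg_cone A\<^esub> y = x \<curlyvee>\<^bsub>A\<^esub> y"
  "x \<curlywedge>\<^bsub>neg_cone A\<^esub> y = x \<curlywedge>\<^bsub>A\<^esub> y"
  "x \<leadsto>\<^bsub>neg_cone A\<^esub> y = (x \<leadsto>\<^bsub>A\<^esub> y) \<curlywedge>\<^bsub>A\<^esub> \<one>\<^bsub>A\<^esub>"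
  "\<one>\<^bsub>neg_cone A\<^esub> = \<one>\<^bsub>A\<^esub>"
  "\<zero>\<^bsub>neg_cone A\<^esub> = \<zero>\<^bsub>A\<^esub>"
  "x \<preceq>\<^bsub>neg_cone A\<^esub> y \<longleftrightarrow> x \<preceq>\<^bsub>A\<^esub> y"
  by (simp_all add: neg_cone_def rl_le_def)

definition cone_map :: "'a rlat \<Rightarrow> 'a \<Rightarrow> 'a \<times> 'a"
  where "cone_map A x = (x \<curlywedge>\<^bsub>A\<^esub> \<one>\<^bsub>A\<^esub>, \<sim>\<^bsub>A\<^esub> x \<curlywedge>\<^bsub>A\<^esub> \<one>\<^bsub>A\<^esub>)"

context BKL
begin

lemma neg_cone_BCRL: "BCRL (neg_cone A)"
proof -
  have m: "x \<otimes> y \<preceq> \<one>" if "x \<in> carrier A" "y \<in> carrier A" "x \<preceq> \<one>" "y \<preceq> \<one>" for x y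
    using mult_mono[of x \<one> y \<one>] that by simp
  have "rl_algebra (neg_cone A)"
    by unfold_locales
      (auto simp: join_clos meet_clos imp_clos zero_clos zero_least m join_leI intro: le_trans[OF meet_le1])
  moreover have "comm_monoid (neg_cone A)"
    by (rule comm_monoidI) (auto simp: m m_ac)
  moreover have "comm_residuated_lattice_axioms (neg_cone A)"
    by unfold_locales
      (auto simp: join_commute meet_commute join_assoc meet_assoc join_absorb meet_absorb
        le_meet_iff imp_clos le_imp_iff)
  ultimately show ?thesis
    by (auto simp: BCRL_def comm_residuated_lattice_def BCRL_axioms_def zero_least)
qed

lemma neg_clos [simp]: "x \<in> carrier A \<Longrightarrow> \<sim> x \<in> carrier A"
  by (simp add: rl_neg_def imp_clos)

lemma neg_join: "x \<in> carrier A \<Longrightarrow> y \<in> carrier A \<Longrightarrow> \<sim> (x \<curlyvee> y) = \<sim> x \<curlywedge> \<sim> y"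
  by (simp add: rl_neg_def join_imp_distrib)

lemma neg_meet: "x \<in> carrier A \<Longrightarrow> y \<in> carrier A \<Longrightarrow> \<sim> (x \<curlywedge> y) = \<sim> x \<curlyvee> \<sim> y"
  by (metis neg_clos neg_join neg_neg join_clos)

lemma neg_mult: "x \<in> carrier A \<Longrightarrow> y \<in> carrier A \<Longrightarrow> \<sim> (x \<otimes> y) = x \<leadsto> \<sim> y"
  by (simp add: rl_neg_def mult_imp)

lemma neg_imp: "x \<in> carrier A \<Longrightarrow> y \<in> carrier A \<Longrightarrow> \<sim> (x \<leadsto> y) = x \<otimes> \<sim> y"
  by (metis neg_clos neg_mult neg_neg mult_clos)

lemma neg_one [simp]: "\<sim> \<one> = \<one>"
  by (simp add: rl_neg_def)

text \<open>If z and \<open>x\<close> are below \<open>\<one>\<close>, so is their product; a bound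
  z below \<open>\<one>\<close> therefore does not notice that \<open>y\<close> is cut down to
  \<open>y \<curlywedge> \<one>\<close>.\<close>

lemma imp_meet_one:
  assumes "x \<in> carrier A" "y \<in> carrier A" "x \<preceq> \<one>"
  shows "(x \<leadsto> y) \<curlywedge> \<one> = (x \<leadsto> (y \<curlywedge> \<one>)) \<curlywedge> \<one>"
proof (rule eqI_below)
  fix z assume z: "z \<in> carrier A"
  have "z \<otimes> x \<preceq> \<one>" if "z \<preceq> \<one>" using mult_mono[of z \<one> x \<one>] assms z that by simp
  then show "z \<preceq> (x \<leadsto> y) \<curlywedge> \<one> \<longleftrightarrow> z \<preceq> (x \<leadsto> (y \<curlywedge> \<one>)) \<curlywedge> \<one>"
    using assms z by (auto simp: le_meet_iff le_imp_iff imp_clos meet_clos)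
qed (use assms in \<open>simp_all add: imp_clos meet_clos\<close>)

text \<open>This is the last K-lattice axiom restricted to the cone. The right-hand side is the
  first coordinate of the implication of \<open>cone_map A x\<close> and \<open>cone_map A y\<close>
  in \<open>K (neg_cone A)\<close>.\<close>

lemma imp_meet_one_decomp:
  assumes "x \<in> carrier A" "y \<in> carrier A"
  shows "(x \<leadsto> y) \<curlywedge> \<one> = (((x \<curlywedge> \<one>) \<leadsto> (y \<curlywedge> \<one>)) \<curlywedge> \<one>) \<curlywedge> (((\<sim> y \<curlywedge> \<one>) \<leadsto> (\<sim> x \<curlywedge> \<one>)) \<curlywedge> \<one>)"
proof -
  have "(x \<leadsto> y) \<curlywedge> \<one> = (((x \<curlywedge> \<one>) \<leadsto> y) \<curlywedge> ((\<sim> y \<curlywedge> \<one>) \<leadsto> \<sim> x)) \<curlywedge> \<one>"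
    using assms by (simp add: imp_decomp)
  also have "\<dots> = (((x \<curlywedge> \<one>) \<leadsto> y) \<curlywedge> \<one>) \<curlywedge> (((\<sim> y \<curlywedge> \<one>) \<leadsto> \<sim> x) \<curlywedge> \<one>)"
    by (rule eqI_below) (use assms in \<open>auto simp: le_meet_iff imp_clos meet_clos\<close>)
  finally show ?thesis
    using imp_meet_one[of "x \<curlywedge> \<one>" y] imp_meet_one[of "\<sim> y \<curlywedge> \<one>" "\<sim> x"] assms by (simp add: meet_clos)
qed

lemma join_meet_one:
  "x \<in> carrier A \<Longrightarrow> y \<in> carrier A \<Longrightarrow> (x \<curlyvee> y) \<curlywedge> \<one> = (x \<curlywedge> \<one>) \<curlyvee> (y \<curlywedge> \<one>)"
  using meet_join_distrib_unit[of \<one> x y] by (simp add: meet_commute join_clos)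

lemma meet_meet_one:
  "x \<in> carrier A \<Longrightarrow> y \<in> carrier A \<Longrightarrow> (x \<curlywedge> y) \<curlywedge> \<one> = (x \<curlywedge> \<one>) \<curlywedge> (y \<curlywedge> \<one>)"
  by (rule eqI_below) (auto simp: le_meet_iff meet_clos)

lemma cone_map_hom: "rl_hom (cone_map A) A (K (neg_cone A))"
proof (rule rl_homI)
  fix x y assume xy: "x \<in> carrier A" "y \<in> carrier A"
  show "cone_map A (x \<curlyvee> y) = cone_map A x \<curlyvee>\<^bsub>K (neg_cone A)\<^esub> cone_map A y"
    using xy by (simp add: cone_map_def join_meet_one neg_join meet_meet_one)
  show "cone_map A (x \<curlywedge> y) = cone_map A x \<curlywedge>\<^bsub>K (neg_cone A)\<^esub> cone_map A y"
    using xy by (simp add: cone_map_def join_meet_one neg_meet meet_meet_one)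
  \<comment> \<open>The second coordinate on the left comes from
    \<open>\<sim> (x \<otimes> y) = x \<leadsto> \<sim> y\<close>, so the decomposition of an
    implication is applied to \<open>x\<close> and \<open>\<sim> y\<close>.\<close>
  show "cone_map A (x \<otimes> y) = cone_map A x \<otimes>\<^bsub>K (neg_cone A)\<^esub> cone_map A y"
    using xy imp_meet_one_decomp[of x "\<sim> y"] by (simp add: cone_map_def mult_meet_unit neg_mult neg_neg)
  show "cone_map A (x \<leadsto> y) = cone_map A x \<leadsto>\<^bsub>K (neg_cone A)\<^esub> cone_map A y"
    using xy imp_meet_one_decomp[of x y] by (simp add: cone_map_def mult_meet_unit neg_imp)
next
  have "\<one> \<preceq> \<sim> \<zero>"
    using zero_least[of \<one>] zero_clos by (simp add: rl_neg_def one_le_imp_iff)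
  then have "\<one> = \<sim> \<zero> \<curlywedge> \<one>" using meet_commute[of \<one> "\<sim> \<zero>"] zero_clos by (simp add: rl_le_def)
  moreover have "\<zero> \<curlywedge> \<one> = \<zero>" using zero_least[of \<one>] by (simp add: rl_le_def)
  ultimately show "cone_map A \<zero> = \<zero>\<^bsub>K (neg_cone A)\<^esub>" by (simp add: cone_map_def)
qed (simp_all add: cone_map_def meet_clos)

text \<open>The last K-lattice axiom reduces \<open>x \<preceq> y\<close> to
  \<open>x \<curlywedge> \<one> \<preceq> y\<close> and
  \<open>\<sim> y \<curlywedge> \<one> \<preceq> \<sim> x\<close>; both follow once the cone
  coordinates of \<open>x\<close> and \<open>y\<close> agree.\<close>

lemma cone_map_le_iff_imp:
  assumes "x \<in> carrier A" "y \<in> carrier A" "cone_map A x = cone_map A y" shows "x \<preceq> y"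
proof -
  have "x \<curlywedge> \<one> \<preceq> y" "\<sim> y \<curlywedge> \<one> \<preceq> \<sim> x"
    using assms by (metis Pair_inject cone_map_def meet_le1 one_closed neg_clos)+
  then have "\<one> \<preceq> ((x \<curlywedge> \<one>) \<leadsto> y) \<curlywedge> ((\<sim> y \<curlywedge> \<one>) \<leadsto> \<sim> x)"
    using assms by (simp add: le_meet_iff imp_clos meet_clos one_le_imp_iff)
  then show ?thesis using assms by (simp add: imp_decomp one_le_imp_iff)
qed

lemma cone_map_inj: "inj_on (cone_map A) (carrier A)"
  by (rule inj_onI) (metis cone_map_le_iff_imp le_antisym)

lemma cone_map_cone:
  assumes "x \<in> carrier A" "x \<preceq> \<one>" shows "cone_map A x = (x, \<one>)"
proof -
  have "\<one> \<preceq> \<sim> x" using assms by (simp add: rl_neg_def one_le_imp_iff)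
  then show ?thesis using assms meet_commute[of "\<sim> x" \<one>] by (simp add: cone_map_def rl_le_def)
qed

end

section \<open>Identities\<close>

lemma trm_val_clos:
  assumes "rl_algebra A" "range v \<subseteq> carrier A" shows "trm_val A v t \<in> carrier A"
proof -
  interpret rl_algebra A by fact
  show ?thesis
    by (induction t) (use assms(2) in \<open>auto simp: join_clos meet_clos mult_clos imp_clos zero_clos unit_clos\<close>)
qed

lemma trm_val_hom:
  assumes "rl_algebra A" "rl_hom h A B" "range v \<subseteq> carrier A"
  shows "h (trm_val A v t) = trm_val B (h \<circ> v) t"
  by (induction t) (simp_all add: rl_homD[OF assms(2)] trm_val_clos[OF assms(1,3)])

lemma trm_val_carrier_upd [simp]: "trm_val (A\<lparr>carrier := S\<rparr>) v t = trm_val A v t"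
  by (induction t) simp_all

lemma identities_hom_inj:
  assumes "rl_algebra A" "rl_hom h A B" "inj_on h (carrier A)"
  shows "identities B \<subseteq> identities A"
proof
  fix e assume e: "e \<in> identities B"
  have "trm_val A v (fst e) = trm_val A v (snd e)" if v: "range v \<subseteq> carrier A" for v
  proof -
    have "range (h \<circ> v) \<subseteq> carrier B" using v rl_homD(1)[OF assms(2)] by auto
    then have "trm_val B (h \<circ> v) (fst e) = trm_val B (h \<circ> v) (snd e)"
      using e by (simp add: identities_def sat_identity_def)
    then have "h (trm_val A v (fst e)) = h (trm_val A v (snd e))"
      by (simp add: trm_val_hom[OF assms(1,2) v])
    then show ?thesis using assms(1,3) v trm_val_clos by (metis inj_onD)
  qed
  then show "e \<in> identities A" by (simp add: identities_def sat_identity_def)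
qed

lemma identities_hom_surj:
  assumes "rl_algebra A" "rl_hom h A B" "carrier B \<subseteq> h ` carrier A"
  shows "identities A \<subseteq> identities B"
proof
  fix e assume e: "e \<in> identities A"
  have "trm_val B v (fst e) = trm_val B v (snd e)" if v: "range v \<subseteq> carrier B" for v
  proof -
    let ?w = "inv_into (carrier A) h \<circ> v"
    have im: "v n \<in> h ` carrier A" for n using v assms(3) by auto
    then have w: "range ?w \<subseteq> carrier A" by (auto intro: inv_into_into)
    have "h \<circ> ?w = v" using im by (simp add: fun_eq_iff f_inv_into_f)
    moreover have "trm_val A ?w (fst e) = trm_val A ?w (snd e)"
      using e w by (simp add: identities_def sat_identity_def)
    ultimately show ?thesis using trm_val_hom[OF assms(1,2) w] by metis
  qed
  then show "e \<in> identities B" by (simp add: identities_def sat_identity_def)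
qed

lemma identities_subuniverse:
  "subuniverse S A \<Longrightarrow> identities A \<subseteq> identities (A\<lparr>carrier := S\<rparr>)"
  by (rule identities_hom_inj[OF subuniverse_rl_algebra subuniverse_hom_id]) auto

text \<open>\<open>A\<close> has its own element type, while varieties consist of algebras on
  \<open>'u\<close>. A copy of a finite \<open>A\<close> along an injection into \<open>'u\<close>
  makes the identities of \<open>A\<close> recoverable from the class it generates.\<close>

lemma identities_copy:
  fixes A :: "'a rlat" (structure)
  assumes "infinite (UNIV :: 'u set)" "rl_algebra A" "finite (carrier A)"
  shows "\<exists>B :: 'u rlat. rl_algebra B \<and> identities B = identities A"
proof -
  interpret rl_algebra A by fact
  obtain f :: "'a \<Rightarrow> 'u" where inj: "inj_on f (carrier A)"
    using assms(1,3) by (metis infinite_arbitrarily_large inj_on_iff_card_le order_refl)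
  define g where "g = inv_into (carrier A) f"
  have g: "g (f x) = x" if "x \<in> carrier A" for x
    using that inj by (simp add: g_def)
  define B :: "'u rlat" where "B = \<lparr>carrier = f ` carrier A, mult = (\<lambda>x y. f (g x \<otimes> g y)), one = f \<one>,
    rl_join = (\<lambda>x y. f (g x \<curlyvee> g y)), rl_meet = (\<lambda>x y. f (g x \<curlywedge> g y)),
    rl_imp = (\<lambda>x y. f (g x \<leadsto> g y)), rl_zero = f \<zero>\<rparr>"
  have h: "rl_hom f A B" by (rule rl_homI) (auto simp: B_def g)
  have "rl_algebra B"
    by unfold_locales (auto simp: B_def g join_clos meet_clos mult_clos imp_clos zero_clos unit_clos)
  moreover have "identities B = identities A"
    using identities_hom_inj[OF assms(2) h inj] identities_hom_surj[OF assms(2) h] by (auto simp: B_def)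
  ultimately show ?thesis by blast
qed

lemma mem_variety_generated_iff:
  "B \<in> variety_generated A \<longleftrightarrow> rl_algebra B \<and> identities A \<subseteq> identities B"
  by (auto simp: variety_generated_def models_def identities_def)

lemma variety_generated_mono:
  "identities B \<subseteq> identities A \<Longrightarrow> variety_generated A \<subseteq> variety_generated B"
  unfolding subset_iff mem_variety_generated_iff by blast

lemma variety_generated_subset_iff:
  assumes "infinite (UNIV :: 'u set)" "rl_algebra A" "finite (carrier A)"
  shows "(variety_generated A :: 'u rlat set) \<subseteq> variety_generated B \<longleftrightarrow> identities B \<subseteq> identities A"
  using identities_copy[OF assms] variety_generated_mono by (metis (no_types) mem_variety_generated_iff order_refl subsetD)

text \<open>The equations defining \<open>U\<close> hold in \<open>B\<close>, hence in
  \<open>A\<close>, hence in all models of the identities of \<open>A\<close>; this also covers an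
  \<open>A\<close> that does not live on \<open>'u\<close>.\<close>

lemma variety_generated_subset_variety:
  assumes "variety U" "B \<in> U" "identities B \<subseteq> identities A"
  shows "variety_generated A \<subseteq> U"
proof -
  obtain E where U: "U = models E" using assms(1) by (auto simp: variety_def)
  then have "E \<subseteq> identities A" using assms(2,3) by (auto simp: models_def identities_def)
  then show ?thesis
    unfolding U by (fastforce simp: models_def mem_variety_generated_iff identities_def)
qed

lemma sat_identity3:
  assumes "sat_identity A e" "x \<in> carrier A" "y \<in> carrier A" "z \<in> carrier A"
  shows "trm_val A (\<lambda>n. if n = 0 then x else if n = 1 then y else z) (fst e) =
    trm_val A (\<lambda>n. if n = 0 then x else if n = 1 then y else z) (snd e)"
  using assms unfolding sat_identity_def by (simp add: image_subset_iff)

text \<open>The last two identities of the first group express residuation equationally: they say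
  \<open>x \<preceq> y \<leadsto> (x \<otimes> y \<curlyvee> z)\<close> and \<open>(x \<curlywedge> (y \<leadsto> z)) \<otimes> y \<preceq> z\<close>.\<close>

definition BKL_identities :: "(trm \<times> trm) set"
  where "BKL_identities = (let x = Var 0; y = Var 1; z = Var 2 in
   {(Mult (Mult x y) z, Mult x (Mult y z)), (Mult x y, Mult y x), (Mult One x, x),
    (Join x y, Join y x), (Meet x y, Meet y x),
    (Join (Join x y) z, Join x (Join y z)), (Meet (Meet x y) z, Meet x (Meet y z)),
    (Join x (Meet x y), x), (Meet x (Join x y), x),
    (Meet x (Imp y (Join (Mult x y) z)), x),
    (Meet (Mult (Meet x (Imp y z)) y) z, Mult (Meet x (Imp y z)) y)} \<union>
   {(Imp (Imp x One) One, x),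
    (Meet One (Join y z), Join (Meet One y) (Meet One z)),
    (Meet x (Join One z), Join (Meet x One) (Meet x z)),
    (Meet x (Join y One), Join (Meet x y) (Meet x One)),
    (Join One (Meet y z), Meet (Join One y) (Join One z)),
    (Join x (Meet One z), Meet (Join x One) (Join x z)),
    (Join x (Meet y One), Meet (Join x y) (Join x One)),
    (Meet (Mult x y) One, Mult (Meet x One) (Meet y One)),
    (Meet (Imp (Meet x One) y) (Imp (Meet (Imp y One) One) (Imp x One)), Imp x y),
    (Meet Zero x, Zero)})"

lemma BKL_identities_sat:
  fixes A (structure)
  assumes "BKL A" shows "BKL_identities \<subseteq> identities A"
proof -
  interpret BKL A by fact
  have r: "x \<curlywedge> (y \<leadsto> ((x \<otimes> y) \<curlyvee> z)) = x" "((x \<curlywedge> (y \<leadsto> z)) \<otimes> y) \<curlywedge> z = (x \<curlywedge> (y \<leadsto> z)) \<otimes> y"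
    if "x \<in> carrier A" "y \<in> carrier A" "z \<in> carrier A" for x y z
  proof -
    have "x \<preceq> y \<leadsto> ((x \<otimes> y) \<curlyvee> z)" using that by (simp add: le_imp_iff join_clos)
    then show "x \<curlywedge> (y \<leadsto> ((x \<otimes> y) \<curlyvee> z)) = x" by (simp add: rl_le_def)
    have "x \<curlywedge> (y \<leadsto> z) \<preceq> y \<leadsto> z" using that by (simp add: imp_clos)
    then have "(x \<curlywedge> (y \<leadsto> z)) \<otimes> y \<preceq> z" using that by (simp add: le_imp_iff imp_clos meet_clos)
    then show "((x \<curlywedge> (y \<leadsto> z)) \<otimes> y) \<curlywedge> z = (x \<curlywedge> (y \<leadsto> z)) \<otimes> y" by (simp add: rl_le_def)
  qed
  have v: "v n \<in> carrier A" if "range v \<subseteq> carrier A" for v :: "nat \<Rightarrow> 'a" and n using that by auto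
  have d: "((x \<curlywedge> \<one>) \<leadsto> y) \<curlywedge> (((y \<leadsto> \<one>) \<curlywedge> \<one>) \<leadsto> (x \<leadsto> \<one>)) = x \<leadsto> y"
    if "x \<in> carrier A" "y \<in> carrier A" for x y
    using that imp_decomp[of x y] by (simp add: rl_neg_def)
  have d': "\<zero> \<curlywedge> x = \<zero>" "(x \<leadsto> \<one>) \<leadsto> \<one> = x" if "x \<in> carrier A" for x
    using that zero_least[of x] neg_neg[of x] by (auto simp: rl_le_def rl_neg_def)
  show ?thesis
    unfolding BKL_identities_def Let_def identities_def sat_identity_def
    by (auto simp: v r d d' m_assoc join_assoc meet_assoc join_absorb meet_absorb mult_meet_unit
        meet_join_distrib_unit join_meet_distrib_unit intro: m_comm join_commute meet_commute)
qed

text \<open>Being a bounded K-lattice is thus an equational property, inherited by subalgebras and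
  by every member of a variety generated by a bounded K-lattice.\<close>

lemma BKL_if_sat:
  fixes A (structure)
  assumes "rl_algebra A" "BKL_identities \<subseteq> identities A" shows "BKL A"
proof -
  interpret rl_algebra A by fact
  have *: "\<forall>e\<in>BKL_identities. trm_val A (\<lambda>n. if n = 0 then x else if n = 1 then y else z) (fst e) =
    trm_val A (\<lambda>n. if n = 0 then x else if n = 1 then y else z) (snd e)"
    if "x \<in> carrier A" "y \<in> carrier A" "z \<in> carrier A" for x y z
    using sat_identity3[of A _ x y z] assms(2) that by (auto simp: identities_def)
  have e: "x \<otimes> y \<otimes> z = x \<otimes> (y \<otimes> z)" "x \<otimes> y = y \<otimes> x" "\<one> \<otimes> x = x" "x \<curlyvee> y = y \<curlyvee> x" "x \<curlywedge> y = y \<curlywedge> x"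
    "x \<curlyvee> y \<curlyvee> z = x \<curlyvee> (y \<curlyvee> z)" "x \<curlywedge> y \<curlywedge> z = x \<curlywedge> (y \<curlywedge> z)" "x \<curlyvee> (x \<curlywedge> y) = x" "x \<curlywedge> (x \<curlyvee> y) = x"
    "x \<curlywedge> (y \<leadsto> ((x \<otimes> y) \<curlyvee> z)) = x" "((x \<curlywedge> (y \<leadsto> z)) \<otimes> y) \<curlywedge> z = (x \<curlywedge> (y \<leadsto> z)) \<otimes> y"
    "(x \<leadsto> \<one>) \<leadsto> \<one> = x"
    "\<one> \<curlywedge> (y \<curlyvee> z) = (\<one> \<curlywedge> y) \<curlyvee> (\<one> \<curlywedge> z)" "x \<curlywedge> (\<one> \<curlyvee> z) = (x \<curlywedge> \<one>) \<curlyvee> (x \<curlywedge> z)"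
    "x \<curlywedge> (y \<curlyvee> \<one>) = (x \<curlywedge> y) \<curlyvee> (x \<curlywedge> \<one>)"
    "\<one> \<curlyvee> (y \<curlywedge> z) = (\<one> \<curlyvee> y) \<curlywedge> (\<one> \<curlyvee> z)" "x \<curlyvee> (\<one> \<curlywedge> z) = (x \<curlyvee> \<one>) \<curlywedge> (x \<curlyvee> z)"
    "x \<curlyvee> (y \<curlywedge> \<one>) = (x \<curlyvee> y) \<curlywedge> (x \<curlyvee> \<one>)"
    "(x \<otimes> y) \<curlywedge> \<one> = (x \<curlywedge> \<one>) \<otimes> (y \<curlywedge> \<one>)"
    "((x \<curlywedge> \<one>) \<leadsto> y) \<curlywedge> (((y \<leadsto> \<one>) \<curlywedge> \<one>) \<leadsto> (x \<leadsto> \<one>)) = x \<leadsto> y" "\<zero> \<curlywedge> x = \<zero>"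
    if "x \<in> carrier A" "y \<in> carrier A" "z \<in> carrier A" for x y z
    using *[OF that, unfolded BKL_identities_def Let_def ball_Un, simplified] by blast+
  note c = mult_clos join_clos meet_clos imp_clos unit_clos zero_clos
  have res: "x \<otimes> y \<preceq> z \<longleftrightarrow> x \<preceq> y \<leadsto> z" if xyz: "x \<in> carrier A" "y \<in> carrier A" "z \<in> carrier A" for x y z
  proof
    assume "x \<otimes> y \<preceq> z"
    then have "(x \<otimes> y) \<curlyvee> z = z"
      using e(4)[of z "x \<otimes> y" z] e(5)[of z "x \<otimes> y" z] e(8)[of z "x \<otimes> y" z] c xyz by (simp add: rl_le_def)
    then show "x \<preceq> y \<leadsto> z" using e(10)[OF xyz] by (simp add: rl_le_def)
  next
    assume "x \<preceq> y \<leadsto> z"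
    then show "x \<otimes> y \<preceq> z" using e(11)[OF xyz] by (simp add: rl_le_def)
  qed
  note e2 = e(2,4,5,8,9,19,20)[OF _ _ unit_clos] and e1 = e(3,12,21)[OF _ unit_clos unit_clos]
  have d: "\<one> \<in> {x, y, z} \<Longrightarrow> x \<curlywedge> (y \<curlyvee> z) = (x \<curlywedge> y) \<curlyvee> (x \<curlywedge> z)"
    "\<one> \<in> {x, y, z} \<Longrightarrow> x \<curlyvee> (y \<curlywedge> z) = (x \<curlyvee> y) \<curlywedge> (x \<curlyvee> z)"
    if "x \<in> carrier A" "y \<in> carrier A" "z \<in> carrier A" for x y z
    using e(13-18)[OF that] by auto
  have "comm_monoid A" by (rule comm_monoidI) (simp_all add: e(1) e1(1) c, rule e2(1))
  moreover have "comm_residuated_lattice_axioms A"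
    by unfold_locales (simp_all add: e(6,7) e2(4,5) res c, rule e2(2), assumption+, rule e2(3))
  moreover have "K_lattice_axioms A"
    by unfold_locales (use d e2(6,7) e1(2) in \<open>auto simp: rl_neg_def\<close>)
  moreover have "BKL_axioms A"
    by unfold_locales (use e1(3) in \<open>auto simp: rl_le_def\<close>)
  ultimately show ?thesis
    using assms(1) by (simp add: BKL_def K_lattice_def comm_residuated_lattice_def)
qed

section \<open>Boolean algebras\<close>

text \<open>Excluded middle suffices: multiplying it by \<open>x\<close> gives
  \<open>x = x \<otimes> x\<close>, idempotence turns the product into the meet, and distributivity
  becomes that of the product over joins.\<close>

lemma (in BCRL) boolean_iff: "boolean_rlat A \<longleftrightarrow> (\<forall>x\<in>carrier A. x \<curlyvee> (x \<leadsto> \<zero>) = \<one>)"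
proof
  assume "boolean_rlat A"
  then interpret boolean_rlat A .
  show "\<forall>x\<in>carrier A. x \<curlyvee> (x \<leadsto> \<zero>) = \<one>"
  proof
    fix x assume x: "x \<in> carrier A"
    then obtain y where y: "y \<in> carrier A" "x \<curlyvee> y = \<one>" "x \<curlywedge> y = \<zero>" using complemented by blast
    then have "y \<otimes> x \<preceq> \<zero>" using x zero_clos by (simp add: mult_eq_meet meet_commute)
    then have "y \<preceq> x \<leadsto> \<zero>" using x y zero_clos by (simp add: le_imp_iff)
    then have "x \<curlyvee> y \<preceq> x \<curlyvee> (x \<leadsto> \<zero>)"
      using x y zero_clos imp_clos join_clos by (meson join_ge1 join_ge2 join_leI le_trans)
    then show "x \<curlyvee> (x \<leadsto> \<zero>) = \<one>" using x y one_le imp_clos join_clos zero_clos by simp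
  qed
next
  assume em: "\<forall>x\<in>carrier A. x \<curlyvee> (x \<leadsto> \<zero>) = \<one>"
  have neg0: "(x \<leadsto> \<zero>) \<otimes> x = \<zero>" if "x \<in> carrier A" for x
    using that imp_mult_le[of x \<zero>] le_zero zero_clos imp_clos by simp
  have idem: "x \<otimes> x = x" if x: "x \<in> carrier A" for x
  proof -
    have "x = (x \<curlyvee> (x \<leadsto> \<zero>)) \<otimes> x" using x em by simp
    also have "\<dots> = x \<otimes> x" using x imp_clos zero_clos by (simp add: mult_join_distrib neg0)
    finally show ?thesis by simp
  qed
  have mm: "x \<otimes> y = x \<curlywedge> y" if xy: "x \<in> carrier A" "y \<in> carrier A" for x y
  proof (rule le_antisym)
    show "x \<otimes> y \<preceq> x \<curlywedge> y" using xy by (simp add: le_meet_iff mult_le1 mult_le2)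
    have "(x \<curlywedge> y) \<otimes> (x \<curlywedge> y) \<preceq> x \<otimes> y" using xy by (intro mult_mono) (simp_all add: meet_clos)
    then show "x \<curlywedge> y \<preceq> x \<otimes> y" using xy by (simp add: idem meet_clos)
  qed (use xy in \<open>simp_all add: meet_clos\<close>)
  have "boolean_rlat_axioms A"
  proof
    fix x y z assume c: "x \<in> carrier A" "y \<in> carrier A" "z \<in> carrier A"
    show "x \<curlywedge> (y \<curlyvee> z) = (x \<curlywedge> y) \<curlyvee> (x \<curlywedge> z)"
      using c mult_join_distrib[of y z x] by (simp add: mm[symmetric] m_comm join_clos)
  next
    fix x assume x: "x \<in> carrier A"
    then show "\<exists>y\<in>carrier A. x \<curlyvee> y = \<one> \<and> x \<curlywedge> y = \<zero>"
      using em neg0[OF x] imp_clos zero_clos by (intro bexI[of _ "x \<leadsto> \<zero>"]) (simp_all add: mm[symmetric] m_comm)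
  qed (rule mm)
  then show "boolean_rlat A" using BCRL_axioms by (simp add: boolean_rlat_def)
qed

text \<open>Excluded middle in the negative cone: \<open>Meet (Var 0) One\<close> ranges over the
  cone, and \<open>Meet (Imp x Zero) One\<close> is the cone's own implication to zero. It holds in
  \<open>K3\<close> and \<open>K4\<close> and thus detects algebras outside their varieties.\<close>

definition em_identity :: "trm \<times> trm"
  where "em_identity =
    (let x = Meet (Var 0) One in (Join x (Meet (Imp x Zero) One), One))"

lemma (in BKL) em_identity_iff:
  "em_identity \<in> identities A \<longleftrightarrow> (\<forall>x\<in>carrier (neg_cone A). x \<curlyvee> ((x \<leadsto> \<zero>) \<curlywedge> \<one>) = \<one>)"
proof -
  have "em_identity \<in> identities A \<longleftrightarrow>
    (\<forall>x\<in>carrier A. (x \<curlywedge> \<one>) \<curlyvee> (((x \<curlywedge> \<one>) \<leadsto> \<zero>) \<curlywedge> \<one>) = \<one>)" (is "?l = ?r")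
  proof
    assume ?l
    then have "sat_identity A em_identity" by (simp_all add: identities_def)
    then show ?r using sat_identity3[of A em_identity _ \<one> \<one>] by (auto simp: em_identity_def Let_def)
  qed (auto simp: identities_def sat_identity_def em_identity_def Let_def image_subset_iff)
  also have "\<dots> \<longleftrightarrow> (\<forall>x\<in>carrier (neg_cone A). x \<curlyvee> ((x \<leadsto> \<zero>) \<curlywedge> \<one>) = \<one>)"
    by (auto simp: meet_clos) (metis rl_le_def)
  finally show ?thesis .
qed

lemma (in BKL) boolean_neg_cone_iff: "boolean_rlat (neg_cone A) \<longleftrightarrow> em_identity \<in> identities A"
  using BCRL.boolean_iff[OF neg_cone_BCRL] em_identity_iff by simp

lemma two_boolean: "boolean_rlat two"
  by unfold_locales (auto simp: two_def rl_le_def)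

lemma two_BCRL: "BCRL two"
  using two_boolean by (simp add: boolean_rlat_def)

lemma two_simps [simp]:
  "carrier two = UNIV" "\<one>\<^bsub>two\<^esub> = True" "\<zero>\<^bsub>two\<^esub> = False" "x \<otimes>\<^bsub>two\<^esub> y = (x \<and> y)"
  "x \<curlyvee>\<^bsub>two\<^esub> y = (x \<or> y)" "x \<curlywedge>\<^bsub>two\<^esub> y = (x \<and> y)" "x \<leadsto>\<^bsub>two\<^esub> y = (x \<longrightarrow> y)"
  by (simp_all add: two_def)

section \<open>Ultrafilters of Boolean algebras\<close>

context boolean_rlat
begin

text \<open>Properness is relative to \<open>c\<close>, so that a maximal such filter is an
  ultrafilter that omits the prescribed element.\<close>

definition proper_filter :: "'a \<Rightarrow> 'a set \<Rightarrow> bool"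
  where "proper_filter c F \<longleftrightarrow> F \<subseteq> carrier A \<and> \<one> \<in> F \<and> c \<notin> F \<and>
    (\<forall>x\<in>F. \<forall>y\<in>F. x \<otimes> y \<in> F) \<and> (\<forall>x\<in>F. \<forall>y\<in>carrier A. x \<preceq> y \<longrightarrow> y \<in> F)"

lemma exists_maximal_filter:
  assumes "c \<in> carrier A" "c \<noteq> \<one>"
  shows "\<exists>M. proper_filter c M \<and> (\<forall>F. proper_filter c F \<longrightarrow> M \<subseteq> F \<longrightarrow> F = M)"
proof -
  have "proper_filter c {\<one>}" using assms one_le by (auto simp: proper_filter_def)
  moreover have "proper_filter c (\<Union>C)" if "C \<noteq> {}" "subset.chain (Collect (proper_filter c)) C" for C
  proof -
    have F: "proper_filter c F" if "F \<in> C" for F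
      using \<open>subset.chain _ C\<close> that by (auto simp: subset_chain_def)
    have "x \<otimes> y \<in> \<Union>C" if "F \<in> C" "G \<in> C" "x \<in> F" "y \<in> G" for F G x y
    proof -
      have "F \<subseteq> G \<or> G \<subseteq> F" using \<open>subset.chain _ C\<close> that by (auto simp: subset_chain_def)
      then show ?thesis using F that unfolding proper_filter_def by (meson UnionI subsetD)
    qed
    moreover have "y \<in> \<Union>C" if "F \<in> C" "x \<in> F" "y \<in> carrier A" "x \<preceq> y" for F x y
      using F that unfolding proper_filter_def by (meson UnionI)
    moreover have "\<Union>C \<subseteq> carrier A" "\<one> \<in> \<Union>C" "c \<notin> \<Union>C"
      using F \<open>C \<noteq> {}\<close> unfolding proper_filter_def by blast+
    ultimately show ?thesis unfolding proper_filter_def by auto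
  qed
  ultimately have "\<exists>M\<in>Collect (proper_filter c). \<forall>X\<in>Collect (proper_filter c). M \<subseteq> X \<longrightarrow> X = M"
    by (intro subset_Zorn_nonempty) auto
  then show ?thesis by auto
qed

lemma exists_hom_two:
  assumes c: "c \<in> carrier A" "c \<noteq> \<one>"
  shows "\<exists>h. rl_hom h A two \<and> \<not> h c"
proof -
  obtain M where M: "proper_filter c M" and max: "\<And>F. proper_filter c F \<Longrightarrow> M \<subseteq> F \<Longrightarrow> F = M"
    using exists_maximal_filter[OF c] by blast
  have M1: "\<one> \<in> M" "c \<notin> M" and MA: "x \<in> M \<Longrightarrow> x \<in> carrier A"
    and Mm: "x \<in> M \<Longrightarrow> y \<in> M \<Longrightarrow> x \<otimes> y \<in> M" and Mup: "x \<in> M \<Longrightarrow> y \<in> carrier A \<Longrightarrow> x \<preceq> y \<Longrightarrow> y \<in> M" for x y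
    using M unfolding proper_filter_def by blast+
  have M0: "\<zero> \<notin> M" using M1(2) Mup[of \<zero> c] c zero_least by blast
  have em: "x \<curlyvee> (x \<leadsto> \<zero>) = \<one>" if "x \<in> carrier A" for x
    using that boolean_iff boolean_rlat_axioms by blast
  have gen: "\<exists>m\<in>M. m \<otimes> x \<preceq> c" if x: "x \<in> carrier A" "x \<notin> M" for x
  proof (rule ccontr)
    assume no: "\<not> ?thesis"
    \<comment> \<open>The filter generated by \<open>M\<close> and \<open>x\<close>. Under the
      assumption \<open>no\<close> it omits \<open>c\<close>, against the maximality of
      \<open>M\<close>.\<close>
    define F where "F = {y \<in> carrier A. \<exists>m\<in>M. m \<otimes> x \<preceq> y}"
    have MF: "M \<subseteq> F" using MA x mult_le1 by (auto simp: F_def)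
    have "x \<in> F" using M1 x unfolding F_def by (auto intro!: bexI[of _ \<one>])
    have "y \<otimes> z \<in> F" if yz: "y \<in> F" "z \<in> F" for y z
    proof -
      obtain m n where mn: "m \<in> M" "n \<in> M" "m \<otimes> x \<preceq> y" "n \<otimes> x \<preceq> z" "y \<in> carrier A" "z \<in> carrier A"
        using yz by (auto simp: F_def)
      have "(m \<otimes> x) \<otimes> (n \<otimes> x) \<preceq> y \<otimes> z" using mn x MA by (intro mult_mono) simp_all
      moreover have "(m \<otimes> x) \<otimes> (n \<otimes> x) = (m \<otimes> n) \<otimes> (x \<otimes> x)" using mn x MA by (simp add: m_ac)
      moreover have "x \<otimes> x = x" using x by (simp add: mult_eq_meet)
      ultimately show ?thesis using mn Mm unfolding F_def by auto
    qed
    moreover have "z \<in> F" if "y \<in> F" "z \<in> carrier A" "y \<preceq> z" for y z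
      using that x MA unfolding F_def by (auto dest: le_trans[OF _ \<open>y \<preceq> z\<close>])
    ultimately have "proper_filter c F"
      using no M1 MF unfolding proper_filter_def by (auto simp: F_def)
    with max MF \<open>x \<in> F\<close> x show False by blast
  qed
  \<comment> \<open>If neither \<open>x\<close> nor its complement is in \<open>M\<close>, there are
    m and n in \<open>M\<close> with \<open>m \<otimes> x\<close> and
    \<open>n \<otimes> (x \<leadsto> \<zero>)\<close> below \<open>c\<close>. Excluded middle then
    puts \<open>m \<otimes> n\<close> below \<open>c\<close>, so \<open>c\<close> would be in
    \<open>M\<close>.\<close>
  have prime: "x \<in> M \<longleftrightarrow> x \<leadsto> \<zero> \<notin> M" if x: "x \<in> carrier A" for x
  proof
    assume "x \<in> M"
    then show "x \<leadsto> \<zero> \<notin> M"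
      using Mm[of "x \<leadsto> \<zero>" x] Mup[OF _ zero_clos] imp_mult_le[of x \<zero>] M0 x zero_clos by blast
  next
    assume n: "x \<leadsto> \<zero> \<notin> M"
    show "x \<in> M"
    proof (rule ccontr)
      assume "x \<notin> M"
      then obtain m n where mn: "m \<in> M" "n \<in> M" "m \<otimes> x \<preceq> c" "n \<otimes> (x \<leadsto> \<zero>) \<preceq> c"
        using gen[of x] gen[of "x \<leadsto> \<zero>"] n x imp_clos zero_clos by blast
      have cl: "m \<in> carrier A" "n \<in> carrier A" "x \<leadsto> \<zero> \<in> carrier A" using mn MA x imp_clos zero_clos by auto
      have "(m \<otimes> n) \<otimes> x \<preceq> c" "(m \<otimes> n) \<otimes> (x \<leadsto> \<zero>) \<preceq> c"
        using le_trans[OF mult_le2[of n "m \<otimes> x"] mn(3)] le_trans[OF mult_le2[of m "n \<otimes> (x \<leadsto> \<zero>)"] mn(4)] cl x c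
        by (simp_all add: m_ac)
      then have "(x \<otimes> (m \<otimes> n)) \<curlyvee> ((x \<leadsto> \<zero>) \<otimes> (m \<otimes> n)) \<preceq> c"
        using cl x c by (intro join_leI) (simp_all add: m_comm)
      then have "m \<otimes> n \<preceq> c"
        using mult_join_distrib[of x "x \<leadsto> \<zero>" "m \<otimes> n"] em[OF x] cl x by simp
      then show False using Mm mn Mup c M1 by blast
    qed
  qed
  have meet: "x \<otimes> y \<in> M \<longleftrightarrow> x \<in> M \<and> y \<in> M" if "x \<in> carrier A" "y \<in> carrier A" for x y
    using that Mm Mup mult_le1 mult_le2 by (meson mult_clos)
  have join: "x \<curlyvee> y \<in> M \<longleftrightarrow> x \<in> M \<or> y \<in> M" if xy: "x \<in> carrier A" "y \<in> carrier A" for x y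
  proof -
    have "(x \<curlyvee> y) \<leadsto> \<zero> = (x \<leadsto> \<zero>) \<otimes> (y \<leadsto> \<zero>)"
      using xy zero_clos imp_clos by (simp add: join_imp_distrib mult_eq_meet)
    then show ?thesis using prime[of "x \<curlyvee> y"] prime[OF xy(1)] prime[OF xy(2)] meet xy join_clos imp_clos zero_clos
      by simp
  qed
  have imp: "x \<leadsto> y \<in> M \<longleftrightarrow> (x \<in> M \<longrightarrow> y \<in> M)" if xy: "x \<in> carrier A" "y \<in> carrier A" for x y
  proof
    assume "x \<leadsto> y \<in> M"
    then show "x \<in> M \<longrightarrow> y \<in> M" using Mm[of "x \<leadsto> y" x] Mup[OF _ xy(2)] imp_mult_le xy by blast
  next
    assume "x \<in> M \<longrightarrow> y \<in> M"
    then consider "x \<leadsto> \<zero> \<in> M" | "y \<in> M" using prime xy by blast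
    then show "x \<leadsto> y \<in> M"
    proof cases
      case 1
      then show ?thesis using Mup[OF 1] imp_mono[of \<zero> y x] zero_least zero_clos imp_clos xy by blast
    next
      case 2
      then show ?thesis using Mup[OF 2] le_imp imp_clos xy by blast
    qed
  qed
  have "rl_hom (\<lambda>x. x \<in> M) A two"
    by (rule rl_homI) (simp_all add: meet join imp M0 M1 mult_eq_meet[symmetric])
  with M1 show ?thesis by blast
qed

text \<open>If \<open>x\<close> is not below \<open>y\<close>, then \<open>x \<leadsto> y\<close> is
  not \<open>\<one>\<close>; a homomorphism sending this implication to \<open>False\<close> must
  send \<open>x\<close> to \<open>True\<close> and \<open>y\<close> to \<open>False\<close>.\<close>

lemma exists_hom_two_separating:
  assumes "x \<in> carrier A" "y \<in> carrier A" "x \<noteq> y"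
  shows "\<exists>h. rl_hom h A two \<and> h x \<noteq> h y"
proof -
  have "\<exists>h. rl_hom h A two \<and> h x \<noteq> h y" if xy: "x \<in> carrier A" "y \<in> carrier A" "\<not> x \<preceq> y" for x y
  proof -
    have "x \<leadsto> y \<noteq> \<one>" using imp_eq_one_iff xy by blast
    then obtain h where h: "rl_hom h A two" "\<not> h (x \<leadsto> y)" using exists_hom_two[of "x \<leadsto> y"] xy imp_clos by blast
    then show ?thesis using rl_homD(5)[OF h(1) xy(1,2)] by (intro exI[of _ h]) auto
  qed
  moreover have "\<not> x \<preceq> y \<or> \<not> y \<preceq> x" using assms le_antisym by blast
  ultimately show ?thesis using assms by metis
qed

end

section \<open>The varieties generated by the small algebras\<close>

lemma K4_BKL: "BKL K4"
  by (rule BCRL.K_BKL[OF two_BCRL])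

lemma K4_em: "em_identity \<in> identities K4"
  by (auto simp: BKL.em_identity_iff[OF K4_BKL] rl_le_def)

lemma identities_K4_boolean:
  assumes "BKL A" "em_identity \<in> identities A" shows "identities K4 \<subseteq> identities A"
proof
  interpret BKL A by fact
  interpret C: boolean_rlat "neg_cone A" using assms boolean_neg_cone_iff by simp
  have A: "rl_algebra A" and C: "rl_algebra (neg_cone A)"
    using assms(1) rl_algebra_BKL C.rl_algebra_axioms by auto
  fix e assume e: "e \<in> identities K4"
  have "trm_val A v (fst e) = trm_val A v (snd e)" if v: "range v \<subseteq> carrier A" for v
  proof -
    let ?s = "trm_val A v (fst e)" and ?t = "trm_val A v (snd e)"
    have cl: "?s \<in> carrier A" "?t \<in> carrier A" using A v trm_val_clos by auto
    have "map_prod h h (cone_map A ?s) = map_prod h h (cone_map A ?t)" if h: "rl_hom h (neg_cone A) two" for h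
    proof -
      let ?g = "map_prod h h \<circ> cone_map A"
      have g: "rl_hom ?g A K4" using rl_hom_comp[OF cone_map_hom rl_hom_K[OF C h]] .
      have "range (?g \<circ> v) \<subseteq> carrier K4" by auto
      then have "trm_val K4 (?g \<circ> v) (fst e) = trm_val K4 (?g \<circ> v) (snd e)"
        using e unfolding identities_def sat_identity_def by blast
      then show ?thesis using trm_val_hom[OF A g v, of "fst e"] trm_val_hom[OF A g v, of "snd e"] by simp
    qed
    moreover have "cone_map A x \<in> carrier (K (neg_cone A))" if "x \<in> carrier A" for x
      using rl_homD(1)[OF cone_map_hom that] .
    ultimately have "fst (cone_map A ?s) = fst (cone_map A ?t)" "snd (cone_map A ?s) = snd (cone_map A ?t)"
      using cl C.exists_hom_two_separating by (metis K_simps(1) fst_map_prod mem_Times_iff, metis K_simps(1) snd_map_prod mem_Times_iff)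
    then have "cone_map A ?s = cone_map A ?t" by (rule prod_eqI)
    then show ?thesis using cl cone_map_inj by (metis inj_onD)
  qed
  then show "e \<in> identities A" by (simp add: identities_def sat_identity_def)
qed

theorem variety_generated_K4: "(variety_generated K4 :: 'u rlat set) = K_BA"
proof (intro Set.set_eqI iffI)
  fix B :: "'u rlat" assume "B \<in> variety_generated K4"
  then have B: "rl_algebra B" "identities K4 \<subseteq> identities B" by (auto simp: mem_variety_generated_iff)
  then have "BKL B" using BKL_if_sat BKL_identities_sat[OF K4_BKL] by blast
  then show "B \<in> K_BA" using B K4_em BKL.boolean_neg_cone_iff by (auto simp: K_BA_def)
next
  fix B :: "'u rlat" assume "B \<in> K_BA"
  then have "BKL B" "em_identity \<in> identities B" using BKL.boolean_neg_cone_iff by (auto simp: K_BA_def)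
  then show "B \<in> variety_generated K4"
    using identities_K4_boolean rl_algebra_BKL by (auto simp: mem_variety_generated_iff)
qed

definition K3 :: "(bool \<times> bool) rlat"
  where "K3 = K4\<lparr>carrier := {(True, True), (True, False), (False, True)}\<rparr>"

lemma subuniverse_K3: "subuniverse {(True, True), (True, False), (False, True)} K4"
  by (rule subuniverseI) auto

lemma BKL_subuniverse: "BKL A \<Longrightarrow> subuniverse S A \<Longrightarrow> BKL (A\<lparr>carrier := S\<rparr>)"
  using BKL_if_sat[OF subuniverse_rl_algebra] BKL_identities_sat identities_subuniverse by blast

lemma K3_BKL: "BKL K3"
  unfolding K3_def by (rule BKL_subuniverse[OF K4_BKL subuniverse_K3])

lemma K3_em: "em_identity \<in> identities K3"
  using K4_em identities_subuniverse[OF subuniverse_K3] by (auto simp: K3_def)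

text \<open>If the constants coincide, \<open>\<one>\<close> is the least element; applied to
  \<open>\<sim> x\<close> this also gives \<open>x \<preceq> \<one>\<close>, so every element is
  \<open>\<one>\<close>.\<close>

lemma (in BKL) nontrivial: assumes "x \<in> carrier A" "x \<noteq> \<one>" shows "\<zero> \<noteq> \<one>"
proof
  assume "\<zero> = \<one>"
  then have ge: "\<one> \<preceq> y" if "y \<in> carrier A" for y using zero_least that by metis
  have "\<one> \<preceq> \<sim> x" using ge assms by simp
  then have "x \<preceq> \<one>" using assms by (simp add: rl_neg_def one_le_imp_iff)
  then show False using ge assms le_antisym by blast
qed

lemma (in BCRL) rl_hom_two: "rl_hom (\<lambda>b. if b then \<one> else \<zero>) two A"
  by (rule rl_homI) (auto simp: zero_clos)

text \<open>The embedding of \<open>K3\<close> is built inside \<open>K (neg_cone A)\<close>, and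
  its values are the images under \<open>cone_map A\<close> of \<open>\<one>\<close>,
  \<open>\<sim> \<zero>\<close> and \<open>\<zero>\<close>. It therefore lands in the copy of
  \<open>A\<close> given by the image of \<open>cone_map A\<close>.\<close>

lemma identities_subset_K3:
  fixes A (structure)
  assumes "BKL A" "\<zero> \<noteq> \<one>" shows "identities A \<subseteq> identities K3"
proof -
  interpret BKL A by fact
  interpret C: BCRL "neg_cone A" by (rule neg_cone_BCRL)
  note A = rl_algebra_BKL[OF assms(1)]
  let ?T = "cone_map A ` carrier A" and ?g = "\<lambda>b. if b then \<one> else \<zero>"
  have "rl_hom ?g two (neg_cone A)" using C.rl_hom_two unfolding neg_cone_simps .
  then have g: "rl_hom (map_prod ?g ?g) K4 (K (neg_cone A))"
    using rl_hom_K rl_algebra_BCRL[OF two_BCRL] by blast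
  have "cone_map A (\<sim> \<zero>) = (\<one>, \<zero>)"
    using cone_map_cone[of \<zero>] zero_clos zero_least[of \<one>] neg_neg[of \<zero>] by (simp add: cone_map_def)
  moreover have "cone_map A \<zero> = (\<zero>, \<one>)" "cone_map A \<one> = (\<one>, \<one>)"
    using cone_map_cone[of \<zero>] cone_map_cone[of \<one>] zero_clos zero_least[of \<one>] by simp_all
  ultimately have "(\<one>, \<zero>) \<in> ?T" "(\<zero>, \<one>) \<in> ?T" "(\<one>, \<one>) \<in> ?T"
    using zero_clos by (metis image_eqI neg_clos one_closed)+
  then have "map_prod ?g ?g ` carrier K3 \<subseteq> ?T" by (auto simp: K3_def)
  then have k: "rl_hom (map_prod ?g ?g) K3 (K (neg_cone A)\<lparr>carrier := ?T\<rparr>)"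
    using rl_hom_into_subuniverse[OF rl_hom_subuniverse[OF g subuniverse_K3]] unfolding K3_def by simp
  have "inj_on (map_prod ?g ?g) (carrier K3)" using assms(2) by (auto simp: inj_on_def K3_def)
  then have "identities (K (neg_cone A)\<lparr>carrier := ?T\<rparr>) \<subseteq> identities K3"
    using identities_hom_inj[OF rl_algebra_BKL[OF K3_BKL] k] by blast
  moreover have "identities A \<subseteq> identities (K (neg_cone A)\<lparr>carrier := ?T\<rparr>)"
    by (rule identities_hom_surj[OF A rl_hom_into_subuniverse[OF cone_map_hom]]) auto
  ultimately show ?thesis by blast
qed

section \<open>The bottom of the lattice of subvarieties and its only atom\<close>

lemma generated_in_subvarieties:
  assumes "BKL A" shows "(variety_generated A :: 'u rlat set) \<in> subvarieties_BKL"
proof -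
  have "variety (variety_generated A)" by (auto simp: variety_def variety_generated_def)
  moreover have "BKL B" if "B \<in> variety_generated A" for B :: "'u rlat"
    using that BKL_if_sat BKL_identities_sat[OF assms] by (auto simp: mem_variety_generated_iff)
  ultimately show ?thesis by (auto simp: subvarieties_BKL_def)
qed

definition trivial_algebras :: "'u rlat set"
  where "trivial_algebras = {B. rl_algebra B \<and> carrier B = {\<one>\<^bsub>B\<^esub>}}"

lemma trivial_algebras_sat:
  assumes "B \<in> trivial_algebras" shows "sat_identity B e"
proof -
  have B: "rl_algebra B" "carrier B = {\<one>\<^bsub>B\<^esub>}" using assms by (auto simp: trivial_algebras_def)
  show ?thesis using trm_val_clos[OF B(1)] unfolding sat_identity_def by (metis B(2) singletonD)
qed

lemma trivial_algebras_eq: "(trivial_algebras :: 'u rlat set) = models {(Var 0, Var 1)}"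
proof (intro Set.set_eqI iffI)
  fix B :: "'u rlat" assume "B \<in> trivial_algebras"
  then show "B \<in> models {(Var 0, Var 1)}"
    using trivial_algebras_sat[of B] by (auto simp: models_def trivial_algebras_def)
next
  fix B :: "'u rlat" assume B: "B \<in> models {(Var 0, Var 1)}"
  then interpret rl_algebra B by (simp add: models_def)
  have "x = \<one>\<^bsub>B\<^esub>" if "x \<in> carrier B" for x
    using B sat_identity3[of B "(Var 0, Var 1)" x "\<one>\<^bsub>B\<^esub>" "\<one>\<^bsub>B\<^esub>"] that unit_clos by (simp add: models_def)
  then have "carrier B = {\<one>\<^bsub>B\<^esub>}" using unit_clos by blast
  then show "B \<in> trivial_algebras"
    using rl_algebra_axioms unfolding trivial_algebras_def by blast
qed

lemma trivial_algebras_least: "variety U \<Longrightarrow> trivial_algebras \<subseteq> U"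
  by (auto simp: variety_def models_def trivial_algebras_sat) (simp add: trivial_algebras_def)

lemma trivial_algebras_in_subvarieties: "(trivial_algebras :: 'u rlat set) \<in> subvarieties_BKL"
proof -
  have "BKL B" if "B \<in> trivial_algebras" for B :: "'u rlat"
    using BKL_if_sat[of B] trivial_algebras_sat[OF that] that by (auto simp: trivial_algebras_def identities_def)
  then show ?thesis using trivial_algebras_eq by (auto simp: subvarieties_BKL_def variety_def)
qed

lemma variety_K3_subset:
  assumes "U \<in> subvarieties_BKL" "U \<noteq> trivial_algebras" shows "variety_generated K3 \<subseteq> U"
proof -
  have U: "variety U" "U \<subseteq> Collect BKL" using assms by (auto simp: subvarieties_BKL_def)
  then obtain B where B: "B \<in> U" "B \<notin> trivial_algebras" using assms trivial_algebras_least by blast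
  then interpret BKL B using U by blast
  obtain x where "x \<in> carrier B" "x \<noteq> \<one>\<^bsub>B\<^esub>"
    using B rl_algebra_axioms one_closed by (fastforce simp: trivial_algebras_def)
  then have "\<zero>\<^bsub>B\<^esub> \<noteq> \<one>\<^bsub>B\<^esub>" by (rule nontrivial)
  then show ?thesis using variety_generated_subset_variety U B identities_subset_K3 BKL_axioms by blast
qed

lemma variety_K3_nontrivial:
  assumes "infinite (UNIV :: 'u set)" shows "(variety_generated K3 :: 'u rlat set) \<noteq> trivial_algebras"
proof
  assume *: "(variety_generated K3 :: 'u rlat set) = trivial_algebras"
  have "finite (carrier K3)" by (simp add: K3_def)
  then obtain B :: "'u rlat" where B: "rl_algebra B" "identities B = identities K3"
    using identities_copy[OF assms] rl_algebra_BKL[OF K3_BKL] by blast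
  then have "B \<in> trivial_algebras" using * by (auto simp: mem_variety_generated_iff)
  then have "sat_identity K3 (Zero, One)"
    using trivial_algebras_sat B(2) by (auto simp: identities_def)
  then have "trm_val K3 (\<lambda>_. (True, True)) Zero = trm_val K3 (\<lambda>_. (True, True)) One"
    unfolding sat_identity_def by (auto simp: K3_def)
  then show False by (simp add: K3_def)
qed

text \<open>Every subvariety other than the trivial one contains the class generated by
  \<open>K3\<close>, so only that class can cover the bottom. Infinity of \<open>'u\<close>
  guarantees that it has a nontrivial member there.\<close>

lemma atom_iff:
  assumes "infinite (UNIV :: 'u set)"
  shows "atom_in subvarieties_BKL W \<longleftrightarrow> W = (variety_generated K3 :: 'u rlat set)"
proof -
  let ?L = "subvarieties_BKL :: 'u rlat set set"
  have least: "T \<in> ?L \<and> (\<forall>U\<in>?L. T \<subseteq> U) \<longleftrightarrow> T = trivial_algebras" for T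
    using trivial_algebras_in_subvarieties trivial_algebras_least by (auto simp: subvarieties_BKL_def)
  have "covers_in ?L W trivial_algebras \<longleftrightarrow> W = variety_generated K3"
  proof
    assume c: "covers_in ?L W trivial_algebras"
    then have "variety_generated K3 \<subseteq> W" using variety_K3_subset by (auto simp: covers_in_def)
    moreover have "trivial_algebras \<subset> (variety_generated K3 :: 'u rlat set)"
      using least generated_in_subvarieties[OF K3_BKL] variety_K3_nontrivial[OF assms] by blast
    ultimately show "W = variety_generated K3"
      using c generated_in_subvarieties[OF K3_BKL] unfolding covers_in_def by blast
  next
    assume "W = variety_generated K3"
    moreover have "\<not> (\<exists>U\<in>?L. trivial_algebras \<subset> U \<and> U \<subset> variety_generated K3)"
      using variety_K3_subset by blast
    ultimately show "covers_in ?L W trivial_algebras"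
      using least generated_in_subvarieties[OF K3_BKL] variety_K3_nontrivial[OF assms]
      unfolding covers_in_def by blast
  qed
  then show ?thesis unfolding atom_in_def using least by metis
qed

lemma almost_minimal_iff:
  assumes "infinite (UNIV :: 'u set)"
  shows "almost_minimal (V :: 'u rlat set) \<longleftrightarrow> covers_in subvarieties_BKL V (variety_generated K3)"
  unfolding almost_minimal_def atom_iff[OF assms] by blast

section \<open>Quotients and subdirect irreducibility\<close>

lemma quot_op_classes:
  assumes "equiv S \<theta>" "x \<in> S" "y \<in> S"
    and "\<And>x x' y y'. (x, x') \<in> \<theta> \<Longrightarrow> (y, y') \<in> \<theta> \<Longrightarrow> (f x y, f x' y') \<in> \<theta>"
  shows "quot_op \<theta> f (\<theta> `` {x}) (\<theta> `` {y}) = \<theta> `` {f x y}"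
proof -
  have "\<theta> `` {f x' y'} = \<theta> `` {f x y}" if "x' \<in> \<theta> `` {x}" "y' \<in> \<theta> `` {y}" for x' y'
    using assms(4)[of x x' y y'] that equiv_class_eq[OF assms(1)] by auto
  moreover have "x \<in> \<theta> `` {x}" "y \<in> \<theta> `` {y}" using assms(1-3) equiv_class_self by fast+
  ultimately show ?thesis unfolding quot_op_def by blast
qed

lemma quotient_hom:
  assumes "rl_algebra A" "congruence A \<theta>"
  shows "rl_hom (\<lambda>x. \<theta> `` {x}) A (quotient_rlat A \<theta>)" "rl_algebra (quotient_rlat A \<theta>)"
    "(\<lambda>x. \<theta> `` {x}) ` carrier A = carrier (quotient_rlat A \<theta>)"
proof -
  have e: "equiv (carrier A) \<theta>" using assms(2) by (simp add: congruence_def)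
  note c = congruenceD[OF assms(2)]
  show im: "(\<lambda>x. \<theta> `` {x}) ` carrier A = carrier (quotient_rlat A \<theta>)"
    by (auto simp: quotient_rlat_def quotient_def)
  show h: "rl_hom (\<lambda>x. \<theta> `` {x}) A (quotient_rlat A \<theta>)"
    by (rule rl_homI) (simp_all add: quotient_rlat_def quotientI quot_op_classes[OF e] c(6-9))
  have "(quotient_rlat A \<theta>)\<lparr>carrier := carrier (quotient_rlat A \<theta>)\<rparr> = quotient_rlat A \<theta>" by simp
  then show "rl_algebra (quotient_rlat A \<theta>)"
    using subuniverse_rl_algebra[OF subuniverse_image[OF assms(1) h]] im by simp
qed

text \<open>A pair of distinct elements in the monolith, the least congruence other than the
  identity. Such a pair witnesses subdirect irreducibility, as the lemmas below show, and is easier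
  to transport than the monolith itself.\<close>

definition monolith_pair :: "'a rlat \<Rightarrow> 'a \<Rightarrow> 'a \<Rightarrow> bool"
  where "monolith_pair A x y \<longleftrightarrow> x \<in> carrier A \<and> y \<in> carrier A \<and> x \<noteq> y \<and>
    (\<forall>\<theta>. congruence A \<theta> \<longrightarrow> \<theta> \<noteq> Id_on (carrier A) \<longrightarrow> (x, y) \<in> \<theta>)"

lemma monolith_pairD:
  "monolith_pair A x y \<Longrightarrow> congruence A \<theta> \<Longrightarrow> \<theta> \<noteq> Id_on (carrier A) \<Longrightarrow> (x, y) \<in> \<theta>"
  by (simp add: monolith_pair_def)

lemma congruence_eq_IdI:
  assumes "congruence A \<theta>" "\<And>x y. (x, y) \<in> \<theta> \<Longrightarrow> x = y" shows "\<theta> = Id_on (carrier A)"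
  using assms(2) congruenceD(1,3)[OF assms(1)] by (auto simp: Id_on_iff)

text \<open>Without such a pair the quotients by all congruences other than the identity separate
  points, although none of the quotient maps is injective. Each quotient is indexed by its own
  congruence, which fits the types in the definition.\<close>

lemma subdirectly_irreducible_monolith_pair:
  assumes "rl_algebra (A :: 'a rlat)" "subdirectly_irreducible A"
  shows "\<exists>x y. monolith_pair A x y"
proof (rule ccontr)
  assume no: "\<nexists>x y. monolith_pair A x y"
  define I where "I = {\<theta>. congruence A \<theta> \<and> \<theta> \<noteq> Id_on (carrier A)}"
  have cls: "\<theta> `` {x} = \<theta> `` {y} \<longleftrightarrow> (x, y) \<in> \<theta>"
    if "congruence A \<theta>" "x \<in> carrier A" "y \<in> carrier A" for \<theta> x y
    using that eq_equiv_class_iff by (fastforce simp: congruence_def)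
  have "subdirect_embedding I (\<lambda>\<theta> x. \<theta> `` {x}) A (quotient_rlat A)"
    unfolding subdirect_embedding_def
  proof (intro conjI ballI impI)
    fix x y assume xy: "x \<in> carrier A" "y \<in> carrier A" "\<forall>\<theta>\<in>I. \<theta> `` {x} = \<theta> `` {y}"
    then have "(x, y) \<in> \<theta>" if "\<theta> \<in> I" for \<theta> using cls that by (simp add: I_def)
    then show "x = y" using no xy(1,2) unfolding monolith_pair_def I_def by blast
  qed (use quotient_hom[OF assms(1)] in \<open>auto simp: I_def\<close>)
  then obtain \<theta> where "\<theta> \<in> I" "inj_on (\<lambda>x. \<theta> `` {x}) (carrier A)"
    using assms(2) unfolding subdirectly_irreducible_def bij_betw_def by blast
  moreover from this have "\<theta> = Id_on (carrier A)"
    using congruence_eq_IdI[of A \<theta>] cls congruenceD(1,2) unfolding I_def inj_on_def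
    by (metis (mono_tags, lifting) mem_Collect_eq)
  ultimately show False by (simp add: I_def)
qed

text \<open>The kernel of a non-injective homomorphism contains the pair, so a family of such
  homomorphisms cannot separate it.\<close>

lemma monolith_pair_subdirectly_irreducible:
  assumes "rl_algebra A" "monolith_pair A x y" shows "subdirectly_irreducible A"
  unfolding subdirectly_irreducible_def
proof (intro allI impI)
  fix I :: "'a rel set" and h and B :: "'a rel \<Rightarrow> 'a set rlat"
  assume e: "subdirect_embedding I h A B"
  show "\<exists>i\<in>I. bij_betw (h i) (carrier A) (carrier (B i))"
  proof (rule ccontr)
    assume no: "\<not> ?thesis"
    have "h i x = h i y" if i: "i \<in> I" for i
    proof -
      let ?\<theta> = "{(x, y). x \<in> carrier A \<and> y \<in> carrier A \<and> h i x = h i y}"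
      have "rl_hom (h i) A (B i)" "h i ` carrier A = carrier (B i)"
        using e i by (auto simp: subdirect_embedding_def)
      then have "congruence A ?\<theta>" "\<not> inj_on (h i) (carrier A)"
        using congruence_kernel[OF assms(1)] no i by (auto simp: bij_betw_def)
      moreover from this have "?\<theta> \<noteq> Id_on (carrier A)" unfolding inj_on_def Id_on_def by blast
      ultimately have "(x, y) \<in> ?\<theta>" using monolith_pairD[OF assms(2)] by blast
      then show ?thesis by simp
    qed
    moreover have "x \<in> carrier A" "y \<in> carrier A" "x \<noteq> y" using assms(2) by (auto simp: monolith_pair_def)
    ultimately show False using e unfolding subdirect_embedding_def by metis
  qed
qed

text \<open>If \<open>a\<close> and \<open>b\<close> both differ from \<open>\<one>\<close>, their
  principal filters both identify \<open>x\<close> with \<open>y\<close>. The powers involved still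
  join to \<open>\<one>\<close>, so multiplying \<open>x\<close> by this join gives
  \<open>x \<preceq> y\<close>, and symmetrically.\<close>

lemma (in BCRL) one_join_irreducible:
  assumes m: "monolith_pair A x y" and ab: "a \<in> carrier A" "b \<in> carrier A" "a \<curlyvee> b = \<one>"
  shows "a = \<one> \<or> b = \<one>"
proof (rule ccontr)
  assume n: "\<not> ?thesis"
  have pc: "(x, y) \<in> power_cong c" if c: "c \<in> carrier A" "c \<noteq> \<one>" for c
  proof -
    have "power_cong c \<noteq> Id_on (carrier A)" using power_cong_one[OF c(1)] c(2) by auto
    then show ?thesis by (rule monolith_pairD[OF m congruence_power_cong[OF c(1)]])
  qed
  then obtain j k :: nat where jk: "a [^] j \<otimes> x \<preceq> y" "a [^] j \<otimes> y \<preceq> x" "b [^] k \<otimes> x \<preceq> y" "b [^] k \<otimes> y \<preceq> x"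
    using n ab pc[of a] pc[of b] unfolding power_cong_def by blast
  have xy: "x \<in> carrier A" "y \<in> carrier A" "x \<noteq> y" using m by (auto simp: monolith_pair_def)
  have le: "u \<preceq> v" if "a [^] j \<otimes> u \<preceq> v" "b [^] k \<otimes> u \<preceq> v" "u \<in> carrier A" "v \<in> carrier A" for u v
  proof -
    have "u = (a [^] j \<curlyvee> b [^] k) \<otimes> u" using power_join_eq_one ab that by simp
    also have "\<dots> \<preceq> v" using that ab by (simp add: mult_join_distrib join_leI)
    finally show ?thesis .
  qed
  show False using le[of x y] le[of y x] jk xy le_antisym by blast
qed

text \<open>Congruences of the cone pull back to \<open>A\<close>, so both coordinates of the images
  of \<open>x\<close> and \<open>y\<close> are identified by every congruence of the cone other than
  the identity. As \<open>cone_map\<close> is injective, one of these two coordinate pairs consists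
  of distinct elements, whatever the congruence.\<close>

lemma (in BKL) monolith_pair_neg_cone:
  assumes "monolith_pair A x y" shows "\<exists>u v. monolith_pair (neg_cone A) u v"
proof -
  have xy: "x \<in> carrier A" "y \<in> carrier A" "x \<noteq> y" using assms by (auto simp: monolith_pair_def)
  have *: "(x \<curlywedge> \<one>, y \<curlywedge> \<one>) \<in> \<theta> \<and> (\<sim> x \<curlywedge> \<one>, \<sim> y \<curlywedge> \<one>) \<in> \<theta>"
    if th: "congruence (neg_cone A) \<theta>" "\<theta> \<noteq> Id_on (carrier (neg_cone A))" for \<theta>
  proof -
    let ?\<psi> = "{(x, y). x \<in> carrier A \<and> y \<in> carrier A \<and> (cone_map A x, cone_map A y) \<in>
      {((a, b), (c, d)). (a, c) \<in> \<theta> \<and> (b, d) \<in> \<theta>}}"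
    have c: "congruence A ?\<psi>"
      by (rule congruence_vimage[OF rl_algebra_BKL[OF BKL_axioms] cone_map_hom congruence_K[OF th(1)]])
    obtain a b where ab: "(a, b) \<in> \<theta>" "a \<noteq> b" using congruence_eq_IdI[OF th(1)] th(2) by blast
    then have in_psi: "(a, b) \<in> ?\<psi>"
      using congruenceD(1,2)[OF th(1) ab(1)] congruenceD(3)[OF th(1), of \<one>] by (simp add: cone_map_cone)
    have "?\<psi> \<noteq> Id_on (carrier A)"
    proof
      assume "?\<psi> = Id_on (carrier A)"
      from in_psi[unfolded this] ab(2) show False by (simp add: Id_on_iff)
    qed
    then have "(x, y) \<in> ?\<psi>" by (rule monolith_pairD[OF assms c])
    then show ?thesis by (simp add: cone_map_def)
  qed
  have cl: "z \<curlywedge> \<one> \<in> carrier (neg_cone A)" if "z \<in> carrier A" for z using that by (simp add: meet_clos)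
  have "x \<curlywedge> \<one> \<noteq> y \<curlywedge> \<one> \<or> \<sim> x \<curlywedge> \<one> \<noteq> \<sim> y \<curlywedge> \<one>"
    using xy cone_map_inj by (auto simp: cone_map_def inj_on_def)
  then show ?thesis using * cl[OF xy(1)] cl[OF xy(2)] cl[of "\<sim> x"] cl[of "\<sim> y"] xy unfolding monolith_pair_def
    by (metis neg_clos)
qed

section \<open>Finite members of a variety generated by a smaller algebra\<close>

text \<open>Turns an equation into an element of the negative cone, so that disjunctions of
  equations can be expressed by joins and conjunctions by products.\<close>

definition eqv_trm :: "trm \<Rightarrow> trm \<Rightarrow> trm"
  where "eqv_trm s t = Meet (Meet (Imp s t) (Imp t s)) One"

lemma (in comm_residuated_lattice) eqv_trm_val:
  assumes "range v \<subseteq> carrier A"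
  shows "trm_val A v (eqv_trm s t) \<preceq> \<one>"
    and "trm_val A v (eqv_trm s t) = \<one> \<longleftrightarrow> trm_val A v s = trm_val A v t"
proof -
  let ?s = "trm_val A v s" and ?t = "trm_val A v t"
  have cl: "?s \<in> carrier A" "?t \<in> carrier A" using trm_val_clos[OF rl_algebra_axioms assms] by auto
  show le: "trm_val A v (eqv_trm s t) \<preceq> \<one>" using cl by (simp add: eqv_trm_def imp_clos meet_clos)
  have "trm_val A v (eqv_trm s t) = \<one> \<longleftrightarrow> \<one> \<preceq> trm_val A v (eqv_trm s t)"
    using le le_antisym[OF le] trm_val_clos[OF rl_algebra_axioms assms] by (metis le_refl one_closed)
  also have "\<dots> \<longleftrightarrow> ?s \<preceq> ?t \<and> ?t \<preceq> ?s"
    using cl by (simp add: eqv_trm_def imp_clos meet_clos le_meet_iff one_le_imp_iff)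
  also have "\<dots> \<longleftrightarrow> ?s = ?t" using cl le_antisym le_refl by metis
  finally show "trm_val A v (eqv_trm s t) = \<one> \<longleftrightarrow> ?s = ?t" .
qed

definition joins :: "trm list \<Rightarrow> trm"
  where "joins ts = foldr Join ts Zero"

text \<open>The first claim uses only that all values are below \<open>\<one>\<close>; the second
  applies join irreducibility along the list. An empty join has value \<open>\<zero>\<close>, which
  is where \<open>nt\<close> enters.\<close>

lemma (in BKL) joins_val_eq_one_iff:
  assumes v: "range v \<subseteq> carrier A" and le: "\<And>t. t \<in> set ts \<Longrightarrow> trm_val A v t \<preceq> \<one>"
    and nt: "\<zero> \<noteq> \<one>"
  shows "\<exists>t\<in>set ts. trm_val A v t = \<one> \<Longrightarrow> trm_val A v (joins ts) = \<one>"
    and "(\<And>a b. a \<in> carrier (neg_cone A) \<Longrightarrow> b \<in> carrier (neg_cone A) \<Longrightarrow> a \<curlyvee> b = \<one> \<Longrightarrow> a = \<one> \<or> b = \<one>) \<Longrightarrow>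
      trm_val A v (joins ts) = \<one> \<Longrightarrow> \<exists>t\<in>set ts. trm_val A v t = \<one>"
proof -
  note cl = trm_val_clos[OF rl_algebra_axioms v]
  have bnd: "trm_val A v (joins ts) \<preceq> \<one>" if "\<And>t. t \<in> set ts \<Longrightarrow> trm_val A v t \<preceq> \<one>" for ts
    using that
  proof (induction ts)
    case (Cons t ts)
    then show ?case using cl[of t] cl[of "joins ts"] by (simp add: joins_def join_leI)
  qed (simp add: joins_def zero_least)
  have one: "x \<curlyvee> \<one> = \<one>" "\<one> \<curlyvee> x = \<one>" if "x \<in> carrier A" "x \<preceq> \<one>" for x
    using that le_iff_join[of x \<one>] join_commute[of x \<one>] by simp_all
  show "\<exists>t\<in>set ts. trm_val A v t = \<one> \<Longrightarrow> trm_val A v (joins ts) = \<one>"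
    using le
  proof (induction ts)
    case (Cons t ts)
    then have "trm_val A v t = \<one> \<or> trm_val A v (joins ts) = \<one>" by auto
    then show ?case
      using cl[of t] cl[of "joins ts"] bnd[of ts] one Cons.prems by (auto simp: joins_def)
  qed simp
  show "\<exists>t\<in>set ts. trm_val A v t = \<one>"
    if ji: "\<And>a b. a \<in> carrier (neg_cone A) \<Longrightarrow> b \<in> carrier (neg_cone A) \<Longrightarrow> a \<curlyvee> b = \<one> \<Longrightarrow> a = \<one> \<or> b = \<one>"
      and "trm_val A v (joins ts) = \<one>"
    using le that(2)
  proof (induction ts)
    case (Cons t ts)
    have "trm_val A v t = \<one> \<or> trm_val A v (joins ts) = \<one>"
      using Cons.prems bnd[of ts] cl[of t] cl[of "joins ts"]
      by (intro ji) (auto simp: joins_def)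
    then show ?case using Cons by auto
  qed (use nt in \<open>simp add: joins_def\<close>)
qed

text \<open>Special case of Jonsson's lemma. By the pigeonhole principle the smaller algebra \<open>T\<close> satisfies
  the identity saying that the join of all \<open>(x\<^sub>m \<leftrightarrow> x\<^sub>n) \<curlywedge> \<one>\<close>, where \<open>m < n < card A\<close>, equals \<open>\<one>\<close>.\<close>

lemma card_le_if_identities:
  assumes "BKL A" "BKL T" "finite (carrier A)" "finite (carrier T)" "identities T \<subseteq> identities A"
    and ji: "\<And>a b. a \<in> carrier (neg_cone A) \<Longrightarrow> b \<in> carrier (neg_cone A) \<Longrightarrow>
      a \<curlyvee>\<^bsub>A\<^esub> b = \<one>\<^bsub>A\<^esub> \<Longrightarrow> a = \<one>\<^bsub>A\<^esub> \<or> b = \<one>\<^bsub>A\<^esub>"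
    and nt: "\<zero>\<^bsub>A\<^esub> \<noteq> \<one>\<^bsub>A\<^esub>"
  shows "card (carrier A) \<le> card (carrier T)"
proof (rule ccontr)
  interpret A: BKL A by fact
  interpret T: BKL T by fact
  assume less: "\<not> ?thesis"
  let ?N = "card (carrier A)"
  define ts where "ts = [eqv_trm (Var m) (Var n). n \<leftarrow> [0..<?N], m \<leftarrow> [0..<n]]"
  have ts: "set ts = {eqv_trm (Var m) (Var n) | m n. m < n \<and> n < ?N}"
    by (auto simp: ts_def) blast
  have ntT: "\<zero>\<^bsub>T\<^esub> \<noteq> \<one>\<^bsub>T\<^esub>"
  proof
    assume "\<zero>\<^bsub>T\<^esub> = \<one>\<^bsub>T\<^esub>"
    then have "sat_identity T (Zero, One)" by (simp add: sat_identity_def)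
    then have "sat_identity A (Zero, One)" using assms(5) by (auto simp: identities_def)
    then have "trm_val A (\<lambda>_. \<one>\<^bsub>A\<^esub>) Zero = trm_val A (\<lambda>_. \<one>\<^bsub>A\<^esub>) One"
      unfolding sat_identity_def by (metis A.one_closed fst_conv image_subsetI snd_conv)
    then show False using nt by simp
  qed
  have "trm_val T v (joins ts) = \<one>\<^bsub>T\<^esub>" if v: "range v \<subseteq> carrier T" for v
  proof (rule T.joins_val_eq_one_iff(1)[OF v _ ntT])
    have "\<not> inj_on v {..<?N}"
      using less card_inj_on_le[of v "{..<?N}" "carrier T"] v assms(4) by auto
    then obtain m n where "m < ?N" "n < ?N" "v m = v n" "m < n"
      unfolding inj_on_def by (metis lessThan_iff linorder_neqE_nat)
    then show "\<exists>t\<in>set ts. trm_val T v t = \<one>\<^bsub>T\<^esub>"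
      unfolding ts using T.eqv_trm_val(2)[OF v, of "Var m" "Var n"] by auto
  qed (use T.eqv_trm_val(1)[OF v] in \<open>auto simp: ts\<close>)
  then have "(joins ts, One) \<in> identities T" by (simp add: identities_def sat_identity_def)
  then have id: "sat_identity A (joins ts, One)" using assms(5) by (auto simp: identities_def)
  obtain f where f: "bij_betw f {..<?N} (carrier A)"
    using ex_bij_betw_nat_finite[OF assms(3)] by (auto simp: lessThan_atLeast0)
  \<comment> \<open>The assignment lists the carrier without repetition, so no two variables below
    \<open>?N\<close> agree. The remaining variables do not occur in \<open>ts\<close> and only need
    some value in the carrier.\<close>
  define v where "v n = (if n < ?N then f n else \<one>\<^bsub>A\<^esub>)" for n
  have v: "range v \<subseteq> carrier A" using f by (auto simp: v_def bij_betw_def)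
  have "trm_val A v (joins ts) = \<one>\<^bsub>A\<^esub>" using id v by (simp add: sat_identity_def)
  moreover have "trm_val A v t \<preceq>\<^bsub>A\<^esub> \<one>\<^bsub>A\<^esub>" if "t \<in> set ts" for t
    using A.eqv_trm_val(1)[OF v] that by (auto simp: ts)
  ultimately obtain t where "t \<in> set ts" "trm_val A v t = \<one>\<^bsub>A\<^esub>"
    using A.joins_val_eq_one_iff(2)[OF v, of ts] nt ji by blast
  then obtain m n where "m < n" "n < ?N" "v m = v n"
    using A.eqv_trm_val(2)[OF v] by (auto simp: ts)
  then show False using f by (auto simp: v_def bij_betw_def inj_on_def)
qed

section \<open>Negative cones of algebras generating almost minimal varieties\<close>

text \<open>The elements congruent to \<open>\<zero>\<close> or \<open>\<one>\<close> form a
  subuniverse. It is not \<open>{\<zero>, \<one>}\<close>, so it is everything, and there are just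
  two classes.\<close>

lemma (in BCRL) quotient_iso_two:
  assumes sub: "\<And>S. subuniverse S A \<Longrightarrow> S \<noteq> carrier A \<Longrightarrow> S = {\<zero>, \<one>}"
    and th: "congruence A \<theta>" "\<theta> \<noteq> carrier A \<times> carrier A" "\<theta> \<noteq> Id_on (carrier A)"
  shows "rl_iso (quotient_rlat A \<theta>) two"
proof -
  note c = congruenceD[OF th(1)]
  have e: "equiv (carrier A) \<theta>" using th(1) by (simp add: congruence_def)
  have n01: "(\<zero>, \<one>) \<notin> \<theta>"
  proof
    assume 01: "(\<zero>, \<one>) \<in> \<theta>"
    have "(\<zero>, x) \<in> \<theta>" if "x \<in> carrier A" for x using c(7)[OF 01 c(3)[OF that]] that by simp
    then have "(x, y) \<in> \<theta>" if "x \<in> carrier A" "y \<in> carrier A" for x y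
      using c(5)[OF c(4)] that by metis
    then show False using th(2) c(1,2) by (metis subrelI subset_antisym mem_Sigma_iff SigmaE2)
  qed
  let ?S = "{x \<in> carrier A. \<exists>e\<in>{\<zero>, \<one>}. (x, e) \<in> \<theta>}"
  have ops: "e \<curlyvee> f \<in> {\<zero>, \<one>} \<and> e \<curlywedge> f \<in> {\<zero>, \<one>} \<and> e \<otimes> f \<in> {\<zero>, \<one>} \<and> e \<leadsto> f \<in> {\<zero>, \<one>}"
    if "e \<in> {\<zero>, \<one>}" "f \<in> {\<zero>, \<one>}" for e f using that by (auto simp: zero_clos)
  have "subuniverse ?S A"
  proof (rule subuniverseI, goal_cases)
    case (4 x y) then show ?case using ops c(6) join_clos by (smt (verit, best) mem_Collect_eq)
  next
    case (5 x y) then show ?case using ops c(7) meet_clos by (smt (verit, best) mem_Collect_eq)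
  next
    case (6 x y) then show ?case using ops c(8) mult_clos by (smt (verit, best) mem_Collect_eq)
  next
    case (7 x y) then show ?case using ops c(9) imp_clos by (smt (verit, best) mem_Collect_eq)
  qed (auto simp: zero_clos c(3))
  \<comment> \<open>For congruent \<open>x\<close> and \<open>y\<close> the element
    \<open>x \<leadsto> y\<close> is congruent to \<open>\<one>\<close>. If \<open>?S\<close> had no
    other elements it would equal \<open>\<one>\<close>, whence \<open>x \<preceq> y\<close>, and
    the congruence would be the identity.\<close>
  moreover have "?S \<noteq> {\<zero>, \<one>}"
  proof
    assume S: "?S = {\<zero>, \<one>}"
    have "x \<preceq> y" if xy: "(x, y) \<in> \<theta>" for x y
    proof -
      have cl: "x \<in> carrier A" "y \<in> carrier A" using c(1,2) xy by auto
      have *: "(x \<leadsto> y, \<one>) \<in> \<theta>" using c(9)[OF xy c(3)[OF cl(2)]] cl by simp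
      then have "x \<leadsto> y \<in> ?S" using cl imp_clos by blast
      then have "x \<leadsto> y = \<zero> \<or> x \<leadsto> y = \<one>" unfolding S by simp
      then have "x \<leadsto> y = \<one>" using * n01 by metis
      then show ?thesis using imp_eq_one_iff cl by simp
    qed
    then have "\<theta> = Id_on (carrier A)"
      using congruence_eq_IdI[OF th(1)] le_antisym c(1,2,4) by blast
    then show False using th(3) by simp
  qed
  ultimately have S: "?S = carrier A" using sub by blast
  define k where "k x \<longleftrightarrow> (x, \<one>) \<in> \<theta>" for x
  have kv: "k x \<longleftrightarrow> e = \<one>" if "(x, e) \<in> \<theta>" "e \<in> {\<zero>, \<one>}" for x e
    using that n01 c(3)[OF one_closed] c(5)[OF c(4)[OF that(1)], of \<one>] c(5)[OF that(1), of \<one>]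
    unfolding k_def by auto
  have n: "\<zero> \<noteq> \<one>" using n01 c(3)[of \<one>] by auto
  have khom: "rl_hom k A two"
  proof (rule rl_homI)
    fix x y assume "x \<in> carrier A" "y \<in> carrier A"
    then obtain e f where ef: "e \<in> {\<zero>, \<one>}" "f \<in> {\<zero>, \<one>}" "(x, e) \<in> \<theta>" "(y, f) \<in> \<theta>" using S by blast
    note o = ops[OF ef(1,2)]
    note k = kv[OF ef(3,1)] kv[OF ef(4,2)]
    show "k (x \<curlyvee> y) = k x \<curlyvee>\<^bsub>two\<^esub> k y" using kv[OF c(6)[OF ef(3,4)]] o k ef(1,2) n by (auto simp: zero_clos)
    show "k (x \<curlywedge> y) = k x \<curlywedge>\<^bsub>two\<^esub> k y" using kv[OF c(7)[OF ef(3,4)]] o k ef(1,2) n by (auto simp: zero_clos)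
    show "k (x \<otimes> y) = k x \<otimes>\<^bsub>two\<^esub> k y" using kv[OF c(8)[OF ef(3,4)]] o k ef(1,2) n by (auto simp: zero_clos)
    show "k (x \<leadsto> y) = k x \<leadsto>\<^bsub>two\<^esub> k y" using kv[OF c(9)[OF ef(3,4)]] o k ef(1,2) n by (auto simp: zero_clos)
  qed (use n01 c(3) in \<open>simp_all add: k_def\<close>)
  have k_eq: "(x, y) \<in> \<theta>" if xy: "x \<in> carrier A" "y \<in> carrier A" "k x = k y" for x y
  proof -
    obtain e f where ef: "e \<in> {\<zero>, \<one>}" "f \<in> {\<zero>, \<one>}" "(x, e) \<in> \<theta>" "(y, f) \<in> \<theta>" using S xy by blast
    have "e = \<one> \<longleftrightarrow> f = \<one>" using kv[OF ef(3,1)] kv[OF ef(4,2)] xy(3) by simp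
    then have "e = f" using ef(1,2) by blast
    then show ?thesis using c(5)[OF ef(3) c(4)[OF ef(4)[folded \<open>e = f\<close>]]] by simp
  qed
  define h where "h X \<longleftrightarrow> \<one> \<in> X" for X
  have hk: "h (\<theta> `` {x}) = k x" for x by (simp add: h_def k_def)
  note kh = rl_homD[OF khom]
  have "rl_hom h (quotient_rlat A \<theta>) two"
  proof (rule rl_homI)
    fix X Y assume "X \<in> carrier (quotient_rlat A \<theta>)" "Y \<in> carrier (quotient_rlat A \<theta>)"
    then obtain x y where xy: "x \<in> carrier A" "y \<in> carrier A" "X = \<theta> `` {x}" "Y = \<theta> `` {y}"
      by (auto simp: quotient_rlat_def quotient_def)
    show "h (X \<curlyvee>\<^bsub>quotient_rlat A \<theta>\<^esub> Y) = h X \<curlyvee>\<^bsub>two\<^esub> h Y"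
      using kh(2)[OF xy(1,2)] xy by (simp add: quotient_rlat_def quot_op_classes[OF e] c(6) hk)
    show "h (X \<curlywedge>\<^bsub>quotient_rlat A \<theta>\<^esub> Y) = h X \<curlywedge>\<^bsub>two\<^esub> h Y"
      using kh(3)[OF xy(1,2)] xy by (simp add: quotient_rlat_def quot_op_classes[OF e] c(7) hk)
    show "h (X \<otimes>\<^bsub>quotient_rlat A \<theta>\<^esub> Y) = h X \<otimes>\<^bsub>two\<^esub> h Y"
      using kh(4)[OF xy(1,2)] xy by (simp add: quotient_rlat_def quot_op_classes[OF e] c(8) hk)
    show "h (X \<leadsto>\<^bsub>quotient_rlat A \<theta>\<^esub> Y) = h X \<leadsto>\<^bsub>two\<^esub> h Y"
      using kh(5)[OF xy(1,2)] xy by (simp add: quotient_rlat_def quot_op_classes[OF e] c(9) hk)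
  qed (use kh(6,7) in \<open>simp_all add: quotient_rlat_def hk\<close>)
  moreover have "bij_betw h (carrier (quotient_rlat A \<theta>)) (carrier two)"
    unfolding bij_betw_def
  proof
    show "inj_on h (carrier (quotient_rlat A \<theta>))"
      using k_eq equiv_class_eq[OF e] by (auto simp: inj_on_def quotient_rlat_def quotient_def hk)
    have "h (\<theta> `` {\<one>})" "\<not> h (\<theta> `` {\<zero>})" "\<theta> `` {\<one>} \<in> carrier (quotient_rlat A \<theta>)" "\<theta> `` {\<zero>} \<in> carrier (quotient_rlat A \<theta>)"
      using kh(6,7) by (auto simp: hk quotient_rlat_def zero_clos intro: quotientI)
    then show "h ` carrier (quotient_rlat A \<theta>) = carrier two" by (auto simp: image_iff)
  qed
  ultimately show ?thesis by (auto simp: rl_iso_def)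
qed

text \<open>The cone is a copy of \<open>two\<close>, so \<open>A\<close> embeds into
  \<open>K4\<close> with an image that contains the three elements of \<open>K3\<close>. Whether
  \<open>(False, False)\<close> belongs to the image decides between the two cases.\<close>

lemma identities_of_two_element_cone:
  fixes A (structure)
  assumes "BKL A" "\<zero> \<noteq> \<one>" "carrier (neg_cone A) = {\<zero>, \<one>}"
  shows "identities A = identities K4 \<or> identities K3 \<subseteq> identities A"
proof -
  interpret BKL A by fact
  interpret C: BCRL "neg_cone A" by (rule neg_cone_BCRL)
  note A = rl_algebra_BKL[OF assms(1)]
  have "em_identity \<in> identities A"
    unfolding em_identity_iff assms(3) using C.zero_simps[of \<one>] C.unit_simps[of \<zero>] C.one_closed C.zero_clos C.zero_simps[of \<zero>] by auto
  then interpret C: boolean_rlat "neg_cone A" using boolean_neg_cone_iff by simp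
  obtain h where h: "rl_hom h (neg_cone A) two" using C.exists_hom_two[of \<zero>] C.zero_clos assms(2) by auto
  have h01: "\<not> h \<zero>" "h \<one>" using rl_homD(6,7)[OF h] by simp_all
  let ?g = "map_prod h h \<circ> cone_map A"
  have g: "rl_hom ?g A K4" using rl_hom_comp[OF cone_map_hom rl_hom_K[OF C.rl_algebra_axioms h]] .
  have "inj_on h (carrier (neg_cone A))" unfolding assms(3) using h01 by (auto simp: inj_on_def)
  then have "inj_on (map_prod h h) (carrier (K (neg_cone A)))" by (simp add: map_prod_inj_on)
  moreover have "cone_map A ` carrier A \<subseteq> carrier (K (neg_cone A))" using rl_homD(1)[OF cone_map_hom] by blast
  ultimately have inj: "inj_on ?g (carrier A)" using cone_map_inj by (meson comp_inj_on inj_on_subset)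
  note G = subuniverseD[OF subuniverse_image[OF A g]]
  have "(False, True) \<in> ?g ` carrier A" "(True, True) \<in> ?g ` carrier A" using G(2,3) by simp_all
  \<comment> \<open>The third element is the negation of zero: the implication from
    \<open>(False, True)\<close> to \<open>(True, True)\<close>.\<close>
  then have G3: "(False, True) \<in> ?g ` carrier A" "(True, True) \<in> ?g ` carrier A" "(True, False) \<in> ?g ` carrier A"
    using G(7)[of "(False, True)" "(True, True)"] by simp_all
  show ?thesis
  proof (cases "(False, False) \<in> ?g ` carrier A")
    case True
    then have "(a, b) \<in> ?g ` carrier A" for a b using G3 by (cases a; cases b) simp_all
    then have "carrier K4 \<subseteq> ?g ` carrier A" by (simp add: subset_iff)
    then show ?thesis using identities_hom_surj[OF A g] identities_hom_inj[OF A g inj] by blast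
  next
    case False
    then have "?g ` carrier A \<subseteq> {(True, True), (True, False), (False, True)}"
      by (metis (full_types) insertCI subrelI)
    then have "rl_hom ?g A K3" unfolding K3_def by (rule rl_hom_into_subuniverse[OF g])
    then show ?thesis using identities_hom_inj[OF A _ inj] by blast
  qed
qed

theorem rigid_neg_cone:
  fixes A :: "'a rlat" (structure)
  assumes inf: "infinite (UNIV :: 'u set)" and A: "BKL A" "finite (carrier A)" "subdirectly_irreducible A"
    and am: "almost_minimal (variety_generated A :: 'u rlat set)"
    and ne: "(variety_generated A :: 'u rlat set) \<noteq> variety_generated K4"
  shows "rigid (neg_cone A)"
proof -
  interpret BKL A by fact
  interpret C: BCRL "neg_cone A" by (rule neg_cone_BCRL)
  note alg = rl_algebra_BKL[OF A(1)]
  have cov: "covers_in subvarieties_BKL (variety_generated A :: 'u rlat set) (variety_generated K3)"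
    using am almost_minimal_iff[OF inf] by blast
  obtain x y where xy: "monolith_pair A x y"
    using subdirectly_irreducible_monolith_pair[OF alg A(3)] by blast
  then have nt: "\<zero> \<noteq> \<one>" using nontrivial[of x] nontrivial[of y] by (auto simp: monolith_pair_def)
  obtain u v where uv: "monolith_pair (neg_cone A) u v" using monolith_pair_neg_cone[OF xy] by blast
  note ji = C.one_join_irreducible[OF uv, simplified]
  have sub: "S = {\<zero>, \<one>}" if S: "subuniverse S (neg_cone A)" "S \<noteq> carrier (neg_cone A)" for S
  proof (rule ccontr)
    assume "S \<noteq> {\<zero>, \<one>}"
    then obtain s where s: "s \<in> S" "s \<noteq> \<zero>" "s \<noteq> \<one>" using subuniverseD(2,3)[OF S(1)] by auto
    then have sC: "s \<in> carrier A" "s \<preceq> \<one>" using subuniverseD(1)[OF S(1)] by auto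
    have S1: "\<one> \<in> S" "\<zero> \<in> S" using subuniverseD(2,3)[OF S(1)] by simp_all
    define T where "T = {x \<in> carrier A. cone_map A x \<in> S \<times> S}"
    have T: "subuniverse T A"
      unfolding T_def by (rule subuniverse_vimage[OF alg cone_map_hom subuniverse_K[OF S(1)]])
    let ?B = "A\<lparr>carrier := T\<rparr>"
    have B: "BKL ?B" by (rule BKL_subuniverse[OF A(1) T])
    have finB: "finite (carrier ?B)" using subuniverseD(1)[OF T] A(2) by (auto intro: finite_subset)
    \<comment> \<open>Excluded middle fails at \<open>s\<close>: since \<open>\<one>\<close> is join
      irreducible and \<open>s\<close> is not \<open>\<one>\<close>, the complement of
      \<open>s\<close> would be \<open>\<one>\<close>, forcing \<open>s = \<zero>\<close>.\<close>
    have em: "em_identity \<notin> identities ?B"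
    proof
      assume "em_identity \<in> identities ?B"
      moreover have "s \<in> carrier (neg_cone ?B)" using s sC S1 by (simp add: T_def cone_map_cone rl_le_def)
      ultimately have "s \<curlyvee> ((s \<leadsto> \<zero>) \<curlywedge> \<one>) = \<one>" using BKL.em_identity_iff[OF B] by auto
      then have "(s \<leadsto> \<zero>) \<curlywedge> \<one> = \<one>"
        using ji[of s "(s \<leadsto> \<zero>) \<curlywedge> \<one>"] s sC imp_clos meet_clos zero_clos by simp
      then have "\<one> \<preceq> s \<leadsto> \<zero>" using sC imp_clos zero_clos by (metis meet_le1 one_closed)
      then have "s \<preceq> \<zero>" using sC zero_clos by (simp add: one_le_imp_iff)
      then show False using s sC zero_least zero_clos le_antisym by blast
    qed
    have sub1: "(variety_generated ?B :: 'u rlat set) \<subseteq> variety_generated A"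
      by (rule variety_generated_mono[OF identities_subuniverse[OF T]])
    have sub2: "(variety_generated K3 :: 'u rlat set) \<subseteq> variety_generated ?B"
      using variety_generated_mono[OF identities_subset_K3[OF B]] nt by simp
    have "(variety_generated K3 :: 'u rlat set) \<noteq> variety_generated ?B"
      using variety_generated_subset_iff[OF inf rl_algebra_BKL[OF B] finB, of K3] em K3_em by blast
    then have "(variety_generated ?B :: 'u rlat set) = variety_generated A"
      using cov sub1 sub2 generated_in_subvarieties[OF B] unfolding covers_in_def by blast
    then have "identities ?B \<subseteq> identities A"
      using variety_generated_subset_iff[OF inf alg A(2), of ?B] by blast
    then have "card (carrier A) \<le> card T"
      using card_le_if_identities[OF A(1) B A(2) finB] ji nt by simp
    then have "T = carrier A" using subuniverseD(1)[OF T] A(2) card_seteq by blast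
    then have "cone_map A c \<in> S \<times> S" if "c \<in> carrier A" for c using that unfolding T_def by blast
    then have "carrier (neg_cone A) \<subseteq> S" using cone_map_cone by force
    then show False using S subuniverseD(1) by blast
  qed
  have "card (carrier (neg_cone A)) > 2"
  proof (rule ccontr)
    assume le: "\<not> ?thesis"
    have fin: "finite (carrier (neg_cone A))" using A(2) by simp
    have in01: "{\<zero>, \<one>} \<subseteq> carrier (neg_cone A)" using C.zero_clos C.one_closed by simp
    have "carrier (neg_cone A) = {\<zero>, \<one>}"
      using card_seteq[OF fin in01] le nt by simp
    \<comment> \<open>The alternative, having the identities of \<open>K4\<close>, is ruled out by
      \<open>ne\<close>; what remains contradicts that the variety of \<open>A\<close> is strictly
      above the atom.\<close>
    then have "identities K3 \<subseteq> identities A"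
      using identities_of_two_element_cone[OF A(1) nt] ne by (auto simp: variety_generated_def)
    then have "(variety_generated A :: 'u rlat set) \<subseteq> variety_generated K3" by (rule variety_generated_mono)
    then show False using cov unfolding covers_in_def by blast
  qed
  then show ?thesis
    unfolding rigid_def
    using C.BCRL_axioms monolith_pair_subdirectly_irreducible[OF C.rl_algebra_axioms uv] sub C.quotient_iso_two
    by simp
qed

section \<open>Substitution and compactness\<close>

primrec tsubst :: "(nat \<Rightarrow> trm) \<Rightarrow> trm \<Rightarrow> trm"
  where
    "tsubst \<tau> (Var n) = \<tau> n"
  | "tsubst \<tau> (Join s t) = Join (tsubst \<tau> s) (tsubst \<tau> t)"
  | "tsubst \<tau> (Meet s t) = Meet (tsubst \<tau> s) (tsubst \<tau> t)"
  | "tsubst \<tau> (Mult s t) = Mult (tsubst \<tau> s) (tsubst \<tau> t)"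
  | "tsubst \<tau> (Imp s t) = Imp (tsubst \<tau> s) (tsubst \<tau> t)"
  | "tsubst \<tau> Zero = Zero"
  | "tsubst \<tau> One = One"

lemma trm_val_tsubst: "trm_val A v (tsubst \<tau> t) = trm_val A (\<lambda>n. trm_val A v (\<tau> n)) t"
  by (induction t) simp_all

lemma identities_tsubst:
  assumes "rl_algebra A" "(s, t) \<in> identities A" shows "(tsubst \<tau> s, tsubst \<tau> t) \<in> identities A"
proof -
  have "range (\<lambda>n. trm_val A v (\<tau> n)) \<subseteq> carrier A" if "range v \<subseteq> carrier A" for v
    using trm_val_clos[OF assms(1) that] by auto
  then show ?thesis using assms(2) by (simp add: identities_def sat_identity_def trm_val_tsubst)
qed

text \<open>\<open>N\<close> bounds the variables of the term. The bound is expressed through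
  values, which is all that the reduction to finitely many assignments requires.\<close>

lemma trm_val_local:
  "\<exists>N. \<forall>v w. (\<forall>n<N. v n = w n) \<longrightarrow> trm_val A v t = trm_val A w t"
proof -
  have bin: "\<exists>N. \<forall>v w. (\<forall>n<N. v n = w n) \<longrightarrow> f (trm_val A v s) (trm_val A v t) = f (trm_val A w s) (trm_val A w t)"
    if "\<exists>N. \<forall>v w. (\<forall>n<N. v n = w n) \<longrightarrow> trm_val A v s = trm_val A w s"
      "\<exists>N. \<forall>v w. (\<forall>n<N. v n = w n) \<longrightarrow> trm_val A v t = trm_val A w t" for s t and f :: "'a \<Rightarrow> 'a \<Rightarrow> 'a"
  proof -
    from that obtain M N where *: "\<And>v w. (\<forall>n<M. v n = w n) \<Longrightarrow> trm_val A v s = trm_val A w s"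
      "\<And>v w. (\<forall>n<N. v n = w n) \<Longrightarrow> trm_val A v t = trm_val A w t" by metis
    show ?thesis
    proof (intro exI[of _ "max M N"] allI impI)
      fix v w :: "nat \<Rightarrow> 'a" assume "\<forall>n<max M N. v n = w n"
      then have "trm_val A v s = trm_val A w s" "trm_val A v t = trm_val A w t" using *[of v w] by simp_all
      then show "f (trm_val A v s) (trm_val A v t) = f (trm_val A w s) (trm_val A w t)" by simp
    qed
  qed
  show ?thesis
  proof (induction t)
    case (Var n)
    show ?case by (rule exI[of _ "Suc n"]) simp
  next
    case (Join s t) then show ?case using bin[of s t "rl_join A"] by simp
  next
    case (Meet s t) then show ?case using bin[of s t "rl_meet A"] by simp
  next
    case (Mult s t) then show ?case using bin[of s t "mult A"] by simp
  next
    case (Imp s t) then show ?case using bin[of s t "rl_imp A"] by simp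
  qed simp_all
qed

definition prods :: "trm list \<Rightarrow> trm"
  where "prods ts = foldr Mult ts One"

lemma (in comm_residuated_lattice) prods_le:
  assumes "range v \<subseteq> carrier A" "\<And>t. t \<in> set ts \<Longrightarrow> trm_val A v t \<preceq> \<one>"
  shows "trm_val A v (prods ts) \<preceq> \<one>" "t \<in> set ts \<Longrightarrow> trm_val A v (prods ts) \<preceq> trm_val A v t"
proof -
  note cl = trm_val_clos[OF rl_algebra_axioms assms(1)]
  have "trm_val A v (prods ts) \<preceq> \<one> \<and> (\<forall>t\<in>set ts. trm_val A v (prods ts) \<preceq> trm_val A v t)"
    using assms(2)
  proof (induction ts)
    case (Cons t ts)
    then have IH: "trm_val A v (prods ts) \<preceq> \<one>" "\<forall>s\<in>set ts. trm_val A v (prods ts) \<preceq> trm_val A v s"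
      and t: "trm_val A v t \<preceq> \<one>" by auto
    have p: "trm_val A v (prods (t # ts)) = trm_val A v t \<otimes> trm_val A v (prods ts)" by (simp add: prods_def)
    have le: "trm_val A v (prods (t # ts)) \<preceq> trm_val A v t" "trm_val A v (prods (t # ts)) \<preceq> trm_val A v (prods ts)"
      using mult_mono[OF le_refl IH(1), of "trm_val A v t"] mult_mono[OF t le_refl, of "trm_val A v (prods ts)"] cl p
      by simp_all
    moreover have "trm_val A v (prods (t # ts)) \<preceq> \<one>" using le_trans[OF le(1) t] cl by simp
    ultimately show ?case using IH(2) le_trans[OF le(2)] cl by auto
  qed (simp add: prods_def)
  then show "trm_val A v (prods ts) \<preceq> \<one>" "t \<in> set ts \<Longrightarrow> trm_val A v (prods ts) \<preceq> trm_val A v t" by auto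
qed

lemma (in comm_residuated_lattice) prods_identity:
  assumes "\<And>t. t \<in> set ts \<Longrightarrow> (t, One) \<in> identities A" shows "(prods ts, One) \<in> identities A"
  using assms by (induction ts) (auto simp: prods_def identities_def sat_identity_def)

text \<open>Only finitely many variables occur in \<open>p\<close>, so finitely many of the terms \<open>u\<close> suffice; their
  product lies below \<open>p\<close> throughout \<open>M\<close> and takes the value \<open>\<one>\<close> throughout \<open>B\<close>.\<close>

lemma one_le_if_locally:
  assumes M: "BKL M" "finite (carrier M)" and B: "BKL B" "identities M \<subseteq> identities B"
    and loc: "\<And>i. range i \<subseteq> carrier M \<Longrightarrow> \<exists>u. (u, One) \<in> identities B \<and>
      (\<forall>j. range j \<subseteq> carrier M \<longrightarrow> trm_val M j u \<preceq>\<^bsub>M\<^esub> \<one>\<^bsub>M\<^esub>) \<and> trm_val M i u \<preceq>\<^bsub>M\<^esub> trm_val M i p"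
    and v: "range v \<subseteq> carrier B"
  shows "\<one>\<^bsub>B\<^esub> \<preceq>\<^bsub>B\<^esub> trm_val B v p"
proof -
  interpret M: BKL M by fact
  interpret B: BKL B by fact
  obtain N where N: "\<And>v w. (\<forall>n<N. v n = w n) \<Longrightarrow> trm_val M v p = trm_val M w p"
    using trm_val_local[of M p] by blast
  \<comment> \<open>Assignments that are constantly \<open>\<one>\<close> from \<open>N\<close> on:
    finitely many, because the carrier of \<open>M\<close> is finite.\<close>
  define J where "J = {i. \<forall>n. (n \<in> {..<N} \<longrightarrow> i n \<in> carrier M) \<and> (n \<notin> {..<N} \<longrightarrow> i n = \<one>\<^bsub>M\<^esub>)}"
  have "finite J" unfolding J_def by (rule finite_set_of_finite_funs) (use M(2) in simp_all)
  then obtain js where js: "set js = J" using finite_list by blast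
  have JM: "range i \<subseteq> carrier M" if "i \<in> J" for i using that by (auto simp: J_def) (metis M.one_closed)
  obtain u where u: "\<And>i. i \<in> J \<Longrightarrow> (u i, One) \<in> identities B"
    "\<And>i j. i \<in> J \<Longrightarrow> range j \<subseteq> carrier M \<Longrightarrow> trm_val M j (u i) \<preceq>\<^bsub>M\<^esub> \<one>\<^bsub>M\<^esub>"
    "\<And>i. i \<in> J \<Longrightarrow> trm_val M i (u i) \<preceq>\<^bsub>M\<^esub> trm_val M i p"
    using loc JM by metis
  \<comment> \<open>Substituting \<open>One\<close> for the variables from \<open>N\<close> on turns
    an arbitrary assignment into a member of \<open>J\<close> that agrees with it below
    \<open>N\<close>, so the term chosen for that member applies.\<close>
  define \<sigma> where "\<sigma> n = (if n < N then Var n else One)" for n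
  define Q where "Q = prods (map (\<lambda>i. tsubst \<sigma> (u i)) js)"
  have "trm_val M j Q \<preceq>\<^bsub>M\<^esub> trm_val M j p" if j: "range j \<subseteq> carrier M" for j
  proof -
    define i where "i n = trm_val M j (\<sigma> n)" for n
    have iJ: "i \<in> J" using j by (auto simp: J_def i_def \<sigma>_def)
    have val: "trm_val M j (tsubst \<sigma> t) = trm_val M i t" for t by (simp add: trm_val_tsubst i_def[abs_def])
    have "trm_val M j p = trm_val M i p" by (rule N) (simp add: i_def \<sigma>_def)
    then have le: "trm_val M j (tsubst \<sigma> (u i)) \<preceq>\<^bsub>M\<^esub> trm_val M j p" using u(3)[OF iJ] val by simp
    have "trm_val M j Q \<preceq>\<^bsub>M\<^esub> trm_val M j (tsubst \<sigma> (u i))"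
      unfolding Q_def using j by (rule M.prods_le(2)) (use iJ js u(2) JM[OF iJ] val in auto)
    then show ?thesis using M.le_trans[OF _ le] trm_val_clos[OF M.rl_algebra_axioms j] by blast
  qed
  then have "(Meet Q p, Q) \<in> identities M" by (simp add: identities_def sat_identity_def rl_le_def)
  then have "sat_identity B (Meet Q p, Q)" using B(2) by (auto simp: identities_def)
  then have "trm_val B v Q \<preceq>\<^bsub>B\<^esub> trm_val B v p" using v by (simp add: sat_identity_def rl_le_def)
  moreover have "(Q, One) \<in> identities B"
    unfolding Q_def
    using identities_tsubst[OF B.rl_algebra_axioms u(1), of _ \<sigma>] js by (intro B.prods_identity) auto
  then have "trm_val B v Q = \<one>\<^bsub>B\<^esub>" using v by (simp add: identities_def sat_identity_def)
  ultimately show ?thesis by simp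
qed

text \<open>This is the subalgebra generated by the values of \<open>v\<close>; every element of it
  is given by a term.\<close>

lemma subuniverse_trm_vals:
  assumes "rl_algebra A" "range v \<subseteq> carrier A" shows "subuniverse (range (trm_val A v)) A"
proof (rule subuniverseI)
  show "range (trm_val A v) \<subseteq> carrier A" using trm_val_clos[OF assms] by auto
  show "\<zero>\<^bsub>A\<^esub> \<in> range (trm_val A v)" by (rule range_eqI[of _ _ Zero]) simp
  show "\<one>\<^bsub>A\<^esub> \<in> range (trm_val A v)" by (rule range_eqI[of _ _ One]) simp
  fix x y assume "x \<in> range (trm_val A v)" "y \<in> range (trm_val A v)"
  then obtain s t where "x = trm_val A v s" "y = trm_val A v t" by blast
  then show "x \<curlyvee>\<^bsub>A\<^esub> y \<in> range (trm_val A v)" "x \<curlywedge>\<^bsub>A\<^esub> y \<in> range (trm_val A v)"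
    "x \<otimes>\<^bsub>A\<^esub> y \<in> range (trm_val A v)" "x \<leadsto>\<^bsub>A\<^esub> y \<in> range (trm_val A v)"
    by (simp_all flip: trm_val.simps(2-5))
qed

section \<open>The subalgebra generated by the negative cone of the twist algebra\<close>

definition twist_core :: "'a rlat \<Rightarrow> ('a \<times> 'a) set"
  where "twist_core A = \<Inter> {S. subuniverse S (K A) \<and> carrier A \<times> {\<one>\<^bsub>A\<^esub>} \<subseteq> S}"

lemma twist_core_least: "subuniverse S (K A) \<Longrightarrow> carrier A \<times> {\<one>\<^bsub>A\<^esub>} \<subseteq> S \<Longrightarrow> twist_core A \<subseteq> S"
  unfolding twist_core_def by blast

lemma twist_core_generators: "carrier A \<times> {\<one>\<^bsub>A\<^esub>} \<subseteq> twist_core A"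
  unfolding twist_core_def by blast

locale rigid_zmi = BCRL A for A :: "'a rlat" (structure) +
  assumes fin: "finite (carrier A)" and rigid: "rigid A" and zmi: "zero_meet_irreducible A"
begin

lemma zmiD: "x \<in> carrier A \<Longrightarrow> y \<in> carrier A \<Longrightarrow> x \<curlywedge> y = \<zero> \<Longrightarrow> x = \<zero> \<or> y = \<zero>"
  using zmi unfolding zero_meet_irreducible_def by blast

lemma third_element: "\<exists>a\<in>carrier A. a \<noteq> \<zero> \<and> a \<noteq> \<one>"
proof (rule ccontr)
  assume "\<not> ?thesis"
  then have "carrier A \<subseteq> {\<zero>, \<one>}" by blast
  then have "card (carrier A) \<le> card {\<zero>, \<one>}" by (intro card_mono) auto
  also have "\<dots> \<le> 2" by (simp add: card_insert_if)
  finally show False using rigid fin unfolding rigid_def by linarith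
qed

lemma zero_neq_one: "\<zero> \<noteq> \<one>"
proof
  assume "\<zero> = \<one>"
  obtain a where "a \<in> carrier A" "a \<noteq> \<one>" using third_element by blast
  then show False using zero_least[of a] \<open>\<zero> = \<one>\<close> one_le by simp
qed

lemma rigid_subuniverse: "subuniverse S A \<Longrightarrow> S = carrier A \<or> S = {\<zero>, \<one>}"
  using rigid unfolding rigid_def by blast

abbreviation core :: "('a \<times> 'a) rlat"
  where "core \<equiv> (K A)\<lparr>carrier := twist_core A\<rparr>"

lemma subuniverse_core: "subuniverse (twist_core A) (K A)"
  unfolding twist_core_def
proof (rule subuniverse_Inter)
  have "subuniverse (carrier (K A)) (K A)"
    using rl_algebra_BKL[OF K_BKL] by (simp add: subuniverse_def del: K_simps)
  then show "{S. subuniverse S (K A) \<and> carrier A \<times> {\<one>} \<subseteq> S} \<noteq> {}" by auto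
qed simp

lemma core_BKL: "BKL core"
  by (rule BKL_subuniverse[OF K_BKL subuniverse_core])

lemma core_finite: "finite (twist_core A)"
  using subuniverseD(1)[OF subuniverse_core] fin by (auto intro: finite_subset)

text \<open>Meet irreducibility of \<open>\<zero>\<close> is what keeps the fourth element of \<open>K4\<close> out.\<close>

lemma zero_zero_notin_core: "(\<zero>, \<zero>) \<notin> twist_core A"
proof -
  \<comment> \<open>A product of two pairs other than \<open>(\<zero>, \<zero>)\<close> is not
    \<open>(\<zero>, \<zero>)\<close>: if its second coordinate is \<open>\<zero>\<close>, then
    \<open>zmi\<close> makes one of the two implications \<open>\<zero>\<close>, and
    \<open>key\<close> shows that one of the factors vanishes.\<close>
  have mult0: "(x \<leadsto> w) \<curlywedge> (z \<leadsto> y) \<noteq> \<zero> \<or> x \<otimes> z \<noteq> \<zero>"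
    if "x \<in> carrier A" "y \<in> carrier A" "z \<in> carrier A" "w \<in> carrier A"
      "x \<noteq> \<zero> \<or> y \<noteq> \<zero>" "z \<noteq> \<zero> \<or> w \<noteq> \<zero>" for x y z w
  proof -
    have key: "u = \<zero> \<and> v = \<zero>"
      if "u \<in> carrier A" "v \<in> carrier A" "t \<in> carrier A" "t \<leadsto> u = \<zero>" "t \<otimes> v = \<zero>" for t u v
    proof
      show "u = \<zero>" using le_imp[of t u] le_zero that by simp
      have "v \<otimes> t \<preceq> \<zero>" using that zero_clos by (simp add: m_comm)
      then have "v \<preceq> t \<leadsto> \<zero>" using that zero_clos by (simp add: le_imp_iff)
      then show "v = \<zero>" using le_zero that \<open>u = \<zero>\<close> by simp
    qed
    show ?thesis
      using zmiD[of "x \<leadsto> w" "z \<leadsto> y"] key[of w z x] key[of y x z] that imp_clos m_comm[of x z] by metis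
  qed
  let ?S = "{p \<in> carrier (K A). p \<noteq> (\<zero>, \<zero>)}"
  have join0: "x \<curlyvee> y = \<zero> \<Longrightarrow> x = \<zero> \<and> y = \<zero>" if "x \<in> carrier A" "y \<in> carrier A" for x y
    using that join_ge1 join_ge2 le_zero by metis
  have "subuniverse ?S (K A)"
  proof (rule subuniverseI)
    fix p q assume "p \<in> ?S" "q \<in> ?S"
    then obtain x y z w where pq: "p = (x, y)" "q = (z, w)" "x \<in> carrier A" "y \<in> carrier A" "z \<in> carrier A" "w \<in> carrier A"
      "x \<noteq> \<zero> \<or> y \<noteq> \<zero>" "z \<noteq> \<zero> \<or> w \<noteq> \<zero>" by auto
    show "p \<curlyvee>\<^bsub>K A\<^esub> q \<in> ?S" using pq join0[of x z] zmiD[of y w] by (auto simp: join_clos meet_clos)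
    show "p \<curlywedge>\<^bsub>K A\<^esub> q \<in> ?S" using pq join0[of y w] zmiD[of x z] by (auto simp: join_clos meet_clos)
    show "p \<otimes>\<^bsub>K A\<^esub> q \<in> ?S" using pq mult0[of x y z w] by (auto simp: imp_clos meet_clos)
    \<comment> \<open>An implication has the coordinates of the product of \<open>p\<close> with the
      swapped pair \<open>(w, z)\<close>, in reverse order.\<close>
    show "p \<leadsto>\<^bsub>K A\<^esub> q \<in> ?S" using pq mult0[of x y w z] by (auto simp: imp_clos meet_clos)
  qed (use zero_neq_one zero_clos in auto)
  moreover have "carrier A \<times> {\<one>} \<subseteq> ?S" using zero_neq_one by auto
  ultimately show ?thesis using twist_core_least by blast
qed

text \<open>The a with \<open>(a, \<one>)\<close> in \<open>S\<close> form a subuniverse of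
  \<open>A\<close>, to which rigidity applies. If it is everything, \<open>S\<close> contains the
  generators. Otherwise all coordinates occurring in \<open>S\<close> are \<open>\<zero>\<close> or
  \<open>\<one>\<close>, because meeting with the unit replaces the second coordinate by
  \<open>\<one>\<close> and negation swaps coordinates.\<close>

lemma subuniverse_of_core:
  assumes "subuniverse S (K A)" "S \<subseteq> twist_core A"
  shows "S = twist_core A \<or> S \<subseteq> {(\<one>, \<one>), (\<one>, \<zero>), (\<zero>, \<one>)}"
proof -
  note S = subuniverseD[OF assms(1)]
  let ?S = "{a \<in> carrier A. (a, \<one>) \<in> S}"
  have "subuniverse ?S A"
  proof (rule subuniverseI)
    fix x y assume xy: "x \<in> ?S" "y \<in> ?S"
    show "x \<curlyvee> y \<in> ?S" using S(4)[of "(x, \<one>)" "(y, \<one>)"] xy by (simp add: join_clos)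
    show "x \<curlywedge> y \<in> ?S" using S(5)[of "(x, \<one>)" "(y, \<one>)"] xy by (simp add: meet_clos)
    show "x \<otimes> y \<in> ?S" using S(6)[of "(x, \<one>)" "(y, \<one>)"] xy by simp
    \<comment> \<open>The implication leaves the negative cone; the meet with the unit brings it
      back and keeps the first coordinate.\<close>
    have "(x \<leadsto> y, x) \<in> S" using S(7)[of "(x, \<one>)" "(y, \<one>)"] xy by (simp add: imp_clos)
    then show "x \<leadsto> y \<in> ?S" using S(5)[OF _ S(3), of "(x \<leadsto> y, x)"] xy by (simp add: imp_clos)
  qed (use S(2,3) in \<open>auto simp: zero_clos\<close>)
  then consider "?S = carrier A" | "?S = {\<zero>, \<one>}" using rigid_subuniverse by blast
  then show ?thesis
  proof cases
    case 1
    then have "carrier A \<times> {\<one>} \<subseteq> S" by auto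
    then show ?thesis using twist_core_least[OF assms(1)] assms(2) by blast
  next
    case 2
    have "a \<in> {\<zero>, \<one>} \<and> b \<in> {\<zero>, \<one>}" if ab: "(a, b) \<in> S" for a b
    proof -
      have cl: "a \<in> carrier A" "b \<in> carrier A" using ab S(1) by auto
      have "(b, a) \<in> S" using S(7)[OF ab S(3)] cl by simp
      then have "(a, \<one>) \<in> S" "(b, \<one>) \<in> S" using S(5)[OF _ S(3)] ab cl by fastforce+
      then show ?thesis using 2 cl by blast
    qed
    then show ?thesis using assms(2) zero_zero_notin_core by fast
  qed
qed

text \<open>The lifted homomorphism sends a generator \<open>(a, \<one>)\<close> to
  \<open>(h a, True)\<close>, which lies in \<open>K3\<close>; so the preimage of \<open>K3\<close>
  contains the whole core.\<close>

lemma rl_hom_core_K3: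
  assumes "rl_hom h A two" shows "rl_hom (map_prod h h) core K3"
proof -
  note h = rl_hom_K[OF rl_algebra_axioms assms]
  let ?T = "{(True, True), (True, False), (False, True)}"
  have "subuniverse {x \<in> carrier (K A). map_prod h h x \<in> ?T} (K A)"
    by (rule subuniverse_vimage[OF rl_algebra_BKL[OF K_BKL] h subuniverse_K3])
  moreover have "carrier A \<times> {\<one>} \<subseteq> {x \<in> carrier (K A). map_prod h h x \<in> ?T}"
    using rl_homD(7)[OF assms] by auto
  ultimately have "twist_core A \<subseteq> {x \<in> carrier (K A). map_prod h h x \<in> ?T}" by (rule twist_core_least)
  then show ?thesis
    unfolding K3_def by (intro rl_hom_into_subuniverse rl_hom_subuniverse[OF h subuniverse_core]) auto
qed

text \<open>As \<open>q\<close> differs from \<open>\<one>\<close>, the congruence is not the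
  identity, and rigidity makes its quotient trivial or a copy of \<open>two\<close>. The second case
  is rephrased as a homomorphism whose kernel is contained in the congruence.\<close>

lemma power_cong_cases:
  assumes q: "q \<in> carrier A" "q \<noteq> \<one>"
  shows "power_cong q = carrier A \<times> carrier A \<or>
    (\<exists>h. rl_hom h A two \<and> (\<forall>x\<in>carrier A. \<forall>y\<in>carrier A. h x = h y \<longrightarrow> (x, y) \<in> power_cong q))"
proof (cases "power_cong q = carrier A \<times> carrier A")
  case False
  let ?\<theta> = "power_cong q"
  have c: "congruence A ?\<theta>" by (rule congruence_power_cong[OF q(1)])
  have "?\<theta> \<noteq> Id_on (carrier A)" using power_cong_one[OF q(1)] q(2) by auto
  then obtain g where g: "rl_hom g (quotient_rlat A ?\<theta>) two" "bij_betw g (carrier (quotient_rlat A ?\<theta>)) (carrier two)"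
    using rigid c False unfolding rigid_def rl_iso_def by blast
  let ?h = "g \<circ> (\<lambda>x. ?\<theta> `` {x})"
  have "rl_hom ?h A two" by (rule rl_hom_comp[OF quotient_hom(1)[OF rl_algebra_axioms c] g(1)])
  moreover have "(x, y) \<in> ?\<theta>" if "x \<in> carrier A" "y \<in> carrier A" "?h x = ?h y" for x y
  proof -
    have "?\<theta> `` {x} \<in> carrier (quotient_rlat A ?\<theta>)" "?\<theta> `` {y} \<in> carrier (quotient_rlat A ?\<theta>)"
      using that by (simp_all add: quotient_rlat_def quotientI)
    then have "?\<theta> `` {x} = ?\<theta> `` {y}" using that(3) g(2) unfolding bij_betw_def inj_on_def by simp
    then show ?thesis using that(1,2) c eq_equiv_class unfolding congruence_def by fastforce
  qed
  ultimately show ?thesis by blast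
qed simp

lemma core_le_iff:
  "(a, b) \<in> twist_core A \<Longrightarrow> (c, d) \<in> twist_core A \<Longrightarrow> (a, b) \<preceq>\<^bsub>core\<^esub> (c, d) \<longleftrightarrow> a \<preceq> c \<and> d \<preceq> b"
  using K_le_iff[of a b c d] subuniverseD(1)[OF subuniverse_core] by (auto simp: rl_le_def)

text \<open>The quotient of the core by the filter generated by \<open>q\<close> is trivial or a copy of \<open>K3\<close>.\<close>

lemma power_le_if_K3:
  assumes q: "q \<in> carrier A" "q \<noteq> \<one>" and i: "range i \<subseteq> twist_core A"
    and p: "(p, One) \<in> identities K3" "trm_val core i p = (b, \<one>)"
  shows "\<exists>n::nat. q [^] n \<preceq> b"
proof -
  interpret M: BKL core by (rule core_BKL)
  have pc: "trm_val core i p \<in> twist_core A" using trm_val_clos[OF M.rl_algebra_axioms, of i p] i by simp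
  then have b: "b \<in> carrier A" using p(2) subuniverseD(1)[OF subuniverse_core] by auto
  have "(b, \<one>) \<in> power_cong q"
    using power_cong_cases[OF q]
  proof (elim disjE exE conjE)
    fix h assume h: "rl_hom h A two" "\<forall>x\<in>carrier A. \<forall>y\<in>carrier A. h x = h y \<longrightarrow> (x, y) \<in> power_cong q"
    note k = rl_hom_core_K3[OF h(1)]
    have i': "range i \<subseteq> carrier core" using i by simp
    have "map_prod h h (i n) \<in> carrier K3" for n using i' by (intro rl_homD(1)[OF k]) (simp add: image_subset_iff)
    then have "range (map_prod h h \<circ> i) \<subseteq> carrier K3" by (simp add: image_subset_iff)
    then have "trm_val K3 (map_prod h h \<circ> i) p = \<one>\<^bsub>K3\<^esub>"
      using p(1) by (simp add: identities_def sat_identity_def)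
    then have "map_prod h h (b, \<one>) = \<one>\<^bsub>K3\<^esub>" using trm_val_hom[OF M.rl_algebra_axioms k i', of p] p(2) by simp
    then have "h b = h \<one>" by (auto simp: K3_def)
    then show ?thesis using h(2) b by blast
  qed (use b in simp)
  then obtain n :: nat where "q [^] n \<otimes> \<one> \<preceq> b" unfolding power_cong_def by blast
  then show ?thesis using q by (intro exI[of _ n]) simp
qed

text \<open>The values of \<open>i\<close> generate a subalgebra of the core. If it lies within the
  copy of \<open>K3\<close>, the equation \<open>s = t\<close> holds there and \<open>One\<close>
  serves as \<open>u\<close>. If it is the whole core, a failure of \<open>s' = t'\<close> is
  reached by terms evaluated at \<open>i\<close>, and a power of the resulting cone element lies
  below the value for \<open>s = t\<close>.\<close>

lemma core_local:
  assumes B: "BKL B" "(s', t') \<in> identities B" "(s', t') \<notin> identities core"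
    and st: "(s, t) \<in> identities K3" and i: "range i \<subseteq> carrier core"
  shows "\<exists>u. (u, One) \<in> identities B \<and>
    (\<forall>j. range j \<subseteq> carrier core \<longrightarrow> trm_val core j u \<preceq>\<^bsub>core\<^esub> \<one>\<^bsub>core\<^esub>) \<and>
    trm_val core i u \<preceq>\<^bsub>core\<^esub> trm_val core i (eqv_trm s t)"
proof -
  interpret M: BKL core by (rule core_BKL)
  interpret B: BKL B by fact
  interpret K3: BKL K3 by (rule K3_BKL)
  let ?p = "eqv_trm s t" and ?S = "range (trm_val core i)"
  have p3: "(?p, One) \<in> identities K3"
    using st K3.eqv_trm_val(2) by (simp add: identities_def sat_identity_def)
  have "subuniverse ?S core" by (rule subuniverse_trm_vals[OF M.rl_algebra_axioms i])
  then have S: "subuniverse ?S (K A)" "?S \<subseteq> twist_core A"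
    using subuniverseD(1)[OF subuniverse_core] unfolding subuniverse_def by auto
  have pc: "trm_val core i ?p \<in> twist_core A" using trm_val_clos[OF M.rl_algebra_axioms i] by simp
  consider "?S \<subseteq> {(\<one>, \<one>), (\<one>, \<zero>), (\<zero>, \<one>)}" | "?S = twist_core A" using subuniverse_of_core[OF S] by blast
  then show ?thesis
  proof cases
    case 1
    let ?g = "\<lambda>b. if b then \<one> else \<zero>"
    \<comment> \<open>Reads \<open>i\<close> back as an assignment into \<open>K3\<close>, so that
      validity of \<open>s = t\<close> in \<open>K3\<close> can be transported along the
      embedding.\<close>
    define k where "k n = (fst (i n) = \<one>, snd (i n) = \<one>)" for n
    have in3: "i n \<in> {(\<one>, \<one>), (\<one>, \<zero>), (\<zero>, \<one>)}" for n
      using 1 range_eqI[of "i n" "trm_val core i" "Var n"] by auto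
    have "map_prod ?g ?g (k n) = i n \<and> k n \<in> carrier K3" for n
      using in3[of n] zero_neq_one by (auto simp: k_def K3_def)
    then have gk: "map_prod ?g ?g \<circ> k = i" and k: "range k \<subseteq> carrier K3"
      by (simp_all add: fun_eq_iff image_subset_iff)
    have g: "rl_hom (map_prod ?g ?g) K3 (K A)"
      using rl_hom_subuniverse[OF rl_hom_K[OF rl_algebra_BCRL[OF two_BCRL] rl_hom_two] subuniverse_K3]
      unfolding K3_def .
    have "trm_val core i ?p = map_prod ?g ?g (trm_val K3 k ?p)"
      using trm_val_hom[OF K3.rl_algebra_axioms g k, of ?p] gk by simp
    also have "trm_val K3 k ?p = \<one>\<^bsub>K3\<^esub>" using p3 k by (simp add: identities_def sat_identity_def)
    finally have "trm_val core i ?p = \<one>\<^bsub>core\<^esub>" by (simp add: K3_def)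
    then show ?thesis
      using M.le_refl[OF M.one_closed] by (intro exI[of _ One]) (simp add: identities_def sat_identity_def)
  next
    case 2
    obtain w where w: "range w \<subseteq> twist_core A" "trm_val core w s' \<noteq> trm_val core w t'"
      using B(3) by (auto simp: identities_def sat_identity_def)
    \<comment> \<open>The failing assignment \<open>w\<close> is expressed by terms in
      \<open>i\<close>. After substitution the identity still holds in \<open>B\<close> but fails in
      the core at \<open>i\<close> itself.\<close>
    have "\<exists>t. w n = trm_val core i t" for n using w(1) 2 by blast
    then obtain \<tau> where "\<And>n. w n = trm_val core i (\<tau> n)" by metis
    then have \<tau>: "(\<lambda>n. trm_val core i (\<tau> n)) = w" by (simp add: fun_eq_iff)
    define u where "u = eqv_trm (tsubst \<tau> s') (tsubst \<tau> t')"
    have "(tsubst \<tau> s', tsubst \<tau> t') \<in> identities B" by (rule identities_tsubst[OF B.rl_algebra_axioms B(2)])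
    then have uB: "(u, One) \<in> identities B"
      using B.eqv_trm_val(2) by (simp add: identities_def sat_identity_def u_def)
    have u_le: "trm_val core j u \<preceq>\<^bsub>core\<^esub> \<one>\<^bsub>core\<^esub>" if "range j \<subseteq> carrier core" for j
      unfolding u_def by (rule M.eqv_trm_val(1)[OF that])
    have u1: "trm_val core i u \<noteq> \<one>\<^bsub>core\<^esub>"
      using M.eqv_trm_val(2)[OF i] w(2) by (simp add: u_def trm_val_tsubst \<tau>[simplified])
    have uc: "trm_val core i u \<in> twist_core A" using trm_val_clos[OF M.rl_algebra_axioms i] by simp
    have below: "\<exists>a\<in>carrier A. x = (a, \<one>)" if x: "x \<in> twist_core A" "x \<preceq>\<^bsub>core\<^esub> \<one>\<^bsub>core\<^esub>" for x
    proof -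
      obtain a b where ab: "x = (a, b)" "a \<in> carrier A" "b \<in> carrier A"
        using x(1) subuniverseD(1)[OF subuniverse_core] by auto
      then have "\<one> \<preceq> b" using x core_le_iff[of a b \<one> \<one>] subuniverseD(3)[OF subuniverse_core] by simp
      then show ?thesis using ab one_le by simp
    qed
    obtain q where q: "q \<in> carrier A" "trm_val core i u = (q, \<one>)" using below[OF uc u_le[OF i]] by blast
    obtain b where b: "b \<in> carrier A" "trm_val core i ?p = (b, \<one>)" using below[OF pc M.eqv_trm_val(1)[OF i]] by blast
    have "q \<noteq> \<one>" using u1 q by simp
    then obtain n :: nat where n: "q [^] n \<preceq> b"
      using power_le_if_K3[OF q(1) _ _ p3 b(2)] i by auto
    \<comment> \<open>The exponent is realized by a term: the n-fold product of \<open>u\<close> has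
      value \<open>(q [^] n, \<one>)\<close> at \<open>i\<close> and still equals \<open>One\<close>
      identically in \<open>B\<close>.\<close>
    let ?u = "prods (replicate n u)"
    have "trm_val core i ?u = (q [^] n, \<one>)"
    proof (induction n)
      case (Suc n)
      then show ?case using q by (simp add: prods_def m_comm)
    qed (simp add: prods_def)
    then have "trm_val core i ?u \<preceq>\<^bsub>core\<^esub> trm_val core i ?p"
      using n b q(1) twist_core_generators[of A] by (simp add: core_le_iff subset_iff)
    moreover have "trm_val core j ?u \<preceq>\<^bsub>core\<^esub> \<one>\<^bsub>core\<^esub>" if "range j \<subseteq> carrier core" for j
      using M.prods_le(1)[OF that, of "replicate n u"] u_le[OF that] by auto
    moreover have "(?u, One) \<in> identities B" using uB by (intro B.prods_identity) auto
    ultimately show ?thesis by blast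
  qed
qed

text \<open>Excluded middle would make \<open>A\<close> Boolean; an element other than
  \<open>\<zero>\<close> and \<open>\<one>\<close> and its complement would then meet in
  \<open>\<zero>\<close> without either being \<open>\<zero>\<close>.\<close>

lemma core_em: "em_identity \<notin> identities core"
proof
  interpret M: BKL core by (rule core_BKL)
  assume em: "em_identity \<in> identities core"
  have "a \<curlyvee> (a \<leadsto> \<zero>) = \<one>" if a: "a \<in> carrier A" for a
  proof -
    have "(a, \<one>) \<in> twist_core A" using twist_core_generators[of A] a by auto
    then have "(a, \<one>) \<in> carrier (neg_cone core)" using a by (simp add: rl_le_def)
    then have "(a, \<one>) \<curlyvee>\<^bsub>core\<^esub> (((a, \<one>) \<leadsto>\<^bsub>core\<^esub> \<zero>\<^bsub>core\<^esub>) \<curlywedge>\<^bsub>core\<^esub> \<one>\<^bsub>core\<^esub>) = \<one>\<^bsub>core\<^esub>"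
      using M.em_identity_iff em by blast
    then show ?thesis using a zero_clos imp_clos by simp
  qed
  then interpret boolean_rlat A using boolean_iff by blast
  obtain a where a: "a \<in> carrier A" "a \<noteq> \<zero>" "a \<noteq> \<one>" using third_element by blast
  then obtain y where "y \<in> carrier A" "a \<curlyvee> y = \<one>" "a \<curlywedge> y = \<zero>" using complemented by blast
  then show False using zmiD[of a y] a by auto
qed

text \<open>A variety \<open>U\<close> strictly between would have a member \<open>B\<close> outside
  the atom, so some identity of \<open>K3\<close> fails in \<open>B\<close>. As \<open>U\<close>
  does not include the variety of the core, some identity of \<open>B\<close> fails in the core, and
  this forces the former identity to hold in \<open>B\<close> after all.\<close>

lemma almost_minimal_core:
  assumes inf: "infinite (UNIV :: 'u set)"
  shows "almost_minimal (variety_generated core :: 'u rlat set)"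
    and "(variety_generated core :: 'u rlat set) \<noteq> K_BA"
proof -
  have fin: "finite (carrier core)" using core_finite by simp
  note sub_iff = variety_generated_subset_iff[OF inf rl_algebra_BKL[OF core_BKL] fin]
  have "\<zero>\<^bsub>core\<^esub> \<noteq> \<one>\<^bsub>core\<^esub>" using zero_neq_one by simp
  then have le: "(variety_generated K3 :: 'u rlat set) \<subseteq> variety_generated core"
    using variety_generated_mono[OF identities_subset_K3[OF core_BKL]] by blast
  have ne: "(variety_generated K3 :: 'u rlat set) \<noteq> variety_generated core"
    using sub_iff[of K3] K3_em core_em by blast
  have "\<not> (variety_generated K3 \<subset> U \<and> U \<subset> variety_generated core)" if U: "U \<in> subvarieties_BKL" for U :: "'u rlat set"
  proof
    assume b: "variety_generated K3 \<subset> U \<and> U \<subset> variety_generated core"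
    then obtain B where B: "B \<in> U" "B \<notin> variety_generated K3" by blast
    have "variety U" "BKL B" "B \<in> variety_generated core"
      using U b B(1) unfolding subvarieties_BKL_def by blast+
    then have BB: "BKL B" "identities core \<subseteq> identities B" by (simp_all add: mem_variety_generated_iff)
    obtain s t where st: "(s, t) \<in> identities K3" "(s, t) \<notin> identities B"
      using B(2) rl_algebra_BKL[OF BB(1)] by (auto simp: mem_variety_generated_iff)
    have "\<not> identities B \<subseteq> identities core"
      using variety_generated_subset_variety[OF \<open>variety U\<close> B(1), of core] b by blast
    then obtain s' t' where st': "(s', t') \<in> identities B" "(s', t') \<notin> identities core" by auto
    interpret B: BKL B by (rule BB(1))
    have "trm_val B v s = trm_val B v t" if v: "range v \<subseteq> carrier B" for v
    proof -
      have "\<one>\<^bsub>B\<^esub> \<preceq>\<^bsub>B\<^esub> trm_val B v (eqv_trm s t)"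
        by (rule one_le_if_locally[OF core_BKL fin BB core_local[OF BB(1) st' st(1)] v])
      then show ?thesis
        using B.eqv_trm_val[OF v, of s t] B.le_antisym trm_val_clos[OF B.rl_algebra_axioms v] B.one_closed by metis
    qed
    then show False using st(2) by (simp add: identities_def sat_identity_def)
  qed
  then show "almost_minimal (variety_generated core :: 'u rlat set)"
    unfolding almost_minimal_iff[OF inf] covers_in_def
    using le ne generated_in_subvarieties[OF core_BKL] generated_in_subvarieties[OF K3_BKL] by blast
  show "(variety_generated core :: 'u rlat set) \<noteq> K_BA"
    using sub_iff[of K4] K4_em core_em variety_generated_K4 by blast
qed

end

text \<open>The first conjunct shows that the excluded variety of the first part, generated by
  \<open>K4\<close>, and that of the second part, K(BA), are the same.\<close>

theorem theorem2p9:
  assumes universe: "infinite (UNIV :: 'u set)"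
  shows "(variety_generated K4 :: 'u rlat set) = K_BA
    \<and> (\<forall>A :: 'a rlat.
        BKL A \<and> finite (carrier A) \<and> subdirectly_irreducible A \<and>
        almost_minimal (variety_generated A :: 'u rlat set) \<and>
        (variety_generated A :: 'u rlat set) \<noteq> variety_generated K4
        \<longrightarrow> rigid (neg_cone A))
    \<and> (\<forall>A :: 'b rlat.
        BCRL A \<and> finite (carrier A) \<and> rigid A \<and> zero_meet_irreducible A
        \<longrightarrow> (\<exists>S. subuniverse S (K A) \<and>
              almost_minimal (variety_generated ((K A)\<lparr>carrier := S\<rparr>) :: 'u rlat set) \<and>
              (variety_generated ((K A)\<lparr>carrier := S\<rparr>) :: 'u rlat set) \<noteq> K_BA))"
proof (intro conjI allI impI)
  show "(variety_generated K4 :: 'u rlat set) = K_BA" by (rule variety_generated_K4)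
next
  fix A :: "'a rlat"
  assume "BKL A \<and> finite (carrier A) \<and> subdirectly_irreducible A \<and>
    almost_minimal (variety_generated A :: 'u rlat set) \<and>
    (variety_generated A :: 'u rlat set) \<noteq> variety_generated K4"
  then show "rigid (neg_cone A)" using rigid_neg_cone[OF universe] by blast
next
  fix A :: "'b rlat"
  assume "BCRL A \<and> finite (carrier A) \<and> rigid A \<and> zero_meet_irreducible A"
  then interpret rigid_zmi A by (simp add: rigid_zmi_def rigid_zmi_axioms_def)
  show "\<exists>S. subuniverse S (K A) \<and>
    almost_minimal (variety_generated ((K A)\<lparr>carrier := S\<rparr>) :: 'u rlat set) \<and>
    (variety_generated ((K A)\<lparr>carrier := S\<rparr>) :: 'u rlat set) \<noteq> K_BA"
    using subuniverse_core almost_minimal_core[OF universe] by blast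
qed

end
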